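(* Let $\mathcal{E}$ be an elementary topos satisfying (NS). Then $\mathcal{E}$ satisfies (DQO) and (DSO) if and only if $\mathcal{E}$ is precohesive over $\mathrm{Dec}(\mathcal{E})$.
   Context: An object $X$ of a topos $\mathcal{E}$ is decidable if its diagonal $X\rightarrowtail X\times X$ is a complemented subobject. $\mathrm{Dec}(\mathcal{E})$ is the full subcategory of $\mathcal{E}$ on the decidable objects. $2$ denotes $1+1$. (NS): any object of $\mathcal{E}$ is either initial or has a global element (an arrow from the terminal object $1$). (DQO): for every object $X$ there exists a unique (up to isomorphism under $X$) decidable quotient of $X$, i.e. an epimorphism $p_X:X\twoheadrightarrow \Pi X$ with $\Pi X$ decidable, along which any arrow $X\to 2$ factors uniquely. (DSO): for every object $X$ there exists a unique decidable subobject of $X$ containing all of its points, i.e. a unique subobject $D\rightarrowtail X$ with $D$ decidable such that every arrow $1\to X$ factors through $D$. A topos $\mathcal{E}$ is precohesive over a topos $\mathcal{S}$ if there is a string of adjunctions $f_!\dashv f^*\dashv f_*\dashv f^!$ with $f_!,f_*:\mathcal{E}\to\mathcal{S}$ and $f^*,f^!:\mathcal{S}\to\mathcal{E}$ such that $f^*$ is fully faithful, $f_!$ preserves finite products, and the counit $f^*f_*\to 1_{\mathcal{E}}$ is monic. "$\mathcal{E}$ is precohesive over $\mathrm{Dec}(\mathcal{E})$" means that $\mathrm{Dec}(\mathcal{E})$ is a topos and there is such a string with $\mathcal{S}=\mathrm{Dec}(\mathcal{E})$ and $f^*$ the inclusion $\mathrm{Dec}(\mathcal{E})\hookrightarrow\mathcal{E}$.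 *)

theory Defs
  imports Main
begin

text \<open>
  A category is a record whose objects and arrows form subsets of two types; the
  operations are meaningful only on these subsets, and \<open>g \<cdot>\<^bsub>C\<^esub> f\<close> is ``g after f''.
\<close>

record ('o, 'a) precategory =
  Obj :: "'o set"
  Arr :: "'a set"
  Dom :: "'a \<Rightarrow> 'o"
  Cod :: "'a \<Rightarrow> 'o"
  Ide :: "'o \<Rightarrow> 'a"
  Comp :: "'a \<Rightarrow> 'a \<Rightarrow> 'a"  (infixr \<open>\<cdot>\<index>\<close> 70)

definition Hom :: "('o, 'a) precategory \<Rightarrow> 'o \<Rightarrow> 'o \<Rightarrow> 'a set" where
  "Hom C X Y = {f \<in> Arr C. Dom C f = X \<and> Cod C f = Y}"

locale category =
  fixes C :: "('o, 'a) precategory" (structure)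
  assumes Dom_closed: "f \<in> Arr C \<Longrightarrow> Dom C f \<in> Obj C"
    and Cod_closed: "f \<in> Arr C \<Longrightarrow> Cod C f \<in> Obj C"
    and Ide_closed: "X \<in> Obj C \<Longrightarrow> Ide C X \<in> Hom C X X"
    and Comp_closed: "\<lbrakk>f \<in> Hom C X Y; g \<in> Hom C Y Z\<rbrakk> \<Longrightarrow> g \<cdot> f \<in> Hom C X Z"
    and Ide_left: "f \<in> Hom C X Y \<Longrightarrow> Ide C Y \<cdot> f = f"
    and Ide_right: "f \<in> Hom C X Y \<Longrightarrow> f \<cdot> Ide C X = f"
    and Comp_assoc:
      "\<lbrakk>f \<in> Hom C W X; g \<in> Hom C X Y; h \<in> Hom C Y Z\<rbrakk> \<Longrightarrow> (h \<cdot> g) \<cdot> f = h \<cdot> (g \<cdot> f)"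

definition monic :: "('o, 'a) precategory \<Rightarrow> 'a \<Rightarrow> bool" where
  "monic C m \<longleftrightarrow> m \<in> Arr C \<and>
     (\<forall>Z\<in>Obj C. \<forall>f\<in>Hom C Z (Dom C m). \<forall>g\<in>Hom C Z (Dom C m).
        m \<cdot>\<^bsub>C\<^esub> f = m \<cdot>\<^bsub>C\<^esub> g \<longrightarrow> f = g)"

definition epic :: "('o, 'a) precategory \<Rightarrow> 'a \<Rightarrow> bool" where
  "epic C e \<longleftrightarrow> e \<in> Arr C \<and>
     (\<forall>Z\<in>Obj C. \<forall>f\<in>Hom C (Cod C e) Z. \<forall>g\<in>Hom C (Cod C e) Z.
        f \<cdot>\<^bsub>C\<^esub> e = g \<cdot>\<^bsub>C\<^esub> e \<longrightarrow> f = g)"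

definition isomorphism :: "('o, 'a) precategory \<Rightarrow> 'a \<Rightarrow> bool" where
  "isomorphism C f \<longleftrightarrow> f \<in> Arr C \<and>
     (\<exists>g\<in>Hom C (Cod C f) (Dom C f).
        g \<cdot>\<^bsub>C\<^esub> f = Ide C (Dom C f) \<and> f \<cdot>\<^bsub>C\<^esub> g = Ide C (Cod C f))"

definition full_subcategory ::
    "('o, 'a) precategory \<Rightarrow> ('o \<Rightarrow> bool) \<Rightarrow> ('o, 'a) precategory" where
  "full_subcategory C P =
     C\<lparr>Obj := {X \<in> Obj C. P X}, Arr := {f \<in> Arr C. P (Dom C f) \<and> P (Cod C f)}\<rparr>"

definition initial :: "('o, 'a) precategory \<Rightarrow> 'o \<Rightarrow> bool" where
  "initial C I \<longleftrightarrow> I \<in> Obj C \<and> (\<forall>X\<in>Obj C. \<exists>!f. f \<in> Hom C I X)"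

definition terminal :: "('o, 'a) precategory \<Rightarrow> 'o \<Rightarrow> bool" where
  "terminal C T \<longleftrightarrow> T \<in> Obj C \<and> (\<forall>X\<in>Obj C. \<exists>!f. f \<in> Hom C X T)"

definition is_product ::
    "('o, 'a) precategory \<Rightarrow> 'o \<Rightarrow> 'o \<Rightarrow> 'o \<Rightarrow> 'a \<Rightarrow> 'a \<Rightarrow> bool" where
  "is_product C X Y P p q \<longleftrightarrow> p \<in> Hom C P X \<and> q \<in> Hom C P Y \<and>
     (\<forall>Z\<in>Obj C. \<forall>f\<in>Hom C Z X. \<forall>g\<in>Hom C Z Y.
        \<exists>!h. h \<in> Hom C Z P \<and> p \<cdot>\<^bsub>C\<^esub> h = f \<and> q \<cdot>\<^bsub>C\<^esub> h = g)"

definition is_coproduct ::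
    "('o, 'a) precategory \<Rightarrow> 'o \<Rightarrow> 'o \<Rightarrow> 'o \<Rightarrow> 'a \<Rightarrow> 'a \<Rightarrow> bool" where
  "is_coproduct C X Y S i j \<longleftrightarrow> i \<in> Hom C X S \<and> j \<in> Hom C Y S \<and>
     (\<forall>Z\<in>Obj C. \<forall>f\<in>Hom C X Z. \<forall>g\<in>Hom C Y Z.
        \<exists>!h. h \<in> Hom C S Z \<and> h \<cdot>\<^bsub>C\<^esub> i = f \<and> h \<cdot>\<^bsub>C\<^esub> j = g)"

definition is_equalizer :: "('o, 'a) precategory \<Rightarrow> 'a \<Rightarrow> 'a \<Rightarrow> 'a \<Rightarrow> bool" where
  "is_equalizer C f g e \<longleftrightarrow>
     e \<in> Hom C (Dom C e) (Dom C f) \<and> f \<cdot>\<^bsub>C\<^esub> e = g \<cdot>\<^bsub>C\<^esub> e \<and>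
     (\<forall>Z\<in>Obj C. \<forall>k\<in>Hom C Z (Dom C f). f \<cdot>\<^bsub>C\<^esub> k = g \<cdot>\<^bsub>C\<^esub> k \<longrightarrow>
        (\<exists>!h. h \<in> Hom C Z (Dom C e) \<and> e \<cdot>\<^bsub>C\<^esub> h = k))"

text \<open>\<open>is_pullback C f g p q\<close>: the square \<open>f \<cdot> p = g \<cdot> q\<close> is a pullback.\<close>

definition is_pullback :: "('o, 'a) precategory \<Rightarrow> 'a \<Rightarrow> 'a \<Rightarrow> 'a \<Rightarrow> 'a \<Rightarrow> bool" where
  "is_pullback C f g p q \<longleftrightarrow>
     f \<in> Arr C \<and> g \<in> Hom C (Dom C g) (Cod C f) \<and>
     p \<in> Hom C (Dom C p) (Dom C f) \<and> q \<in> Hom C (Dom C p) (Dom C g) \<and>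
     f \<cdot>\<^bsub>C\<^esub> p = g \<cdot>\<^bsub>C\<^esub> q \<and>
     (\<forall>Z\<in>Obj C. \<forall>a\<in>Hom C Z (Dom C f). \<forall>b\<in>Hom C Z (Dom C g). f \<cdot>\<^bsub>C\<^esub> a = g \<cdot>\<^bsub>C\<^esub> b \<longrightarrow>
        (\<exists>!h. h \<in> Hom C Z (Dom C p) \<and> p \<cdot>\<^bsub>C\<^esub> h = a \<and> q \<cdot>\<^bsub>C\<^esub> h = b))"

text \<open>
  \<open>is_exponential C Y Z W P p q ev\<close>: \<open>W\<close> is the exponential of \<open>Z\<close> by \<open>Y\<close>, with
  evaluation \<open>ev\<close> defined on the product \<open>P\<close> of \<open>W\<close> and \<open>Y\<close>. The arrow \<open>k\<close> below is
  \<open>h \<times> Y\<close>, so \<open>h\<close> is the transpose of \<open>f\<close>.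
\<close>

definition is_exponential ::
    "('o, 'a) precategory \<Rightarrow> 'o \<Rightarrow> 'o \<Rightarrow> 'o \<Rightarrow> 'o \<Rightarrow> 'a \<Rightarrow> 'a \<Rightarrow> 'a \<Rightarrow> bool" where
  "is_exponential C Y Z W P p q ev \<longleftrightarrow> is_product C W Y P p q \<and> ev \<in> Hom C P Z \<and>
     (\<forall>X Q a b. is_product C X Y Q a b \<longrightarrow> (\<forall>f\<in>Hom C Q Z.
        \<exists>!h. h \<in> Hom C X W \<and>
          (\<exists>k\<in>Hom C Q P. p \<cdot>\<^bsub>C\<^esub> k = h \<cdot>\<^bsub>C\<^esub> a \<and> q \<cdot>\<^bsub>C\<^esub> k = b \<and> ev \<cdot>\<^bsub>C\<^esub> k = f)))"

definition is_subobject_classifier ::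
    "('o, 'a) precategory \<Rightarrow> 'o \<Rightarrow> 'o \<Rightarrow> 'a \<Rightarrow> bool" where
  "is_subobject_classifier C T \<Omega> t \<longleftrightarrow> terminal C T \<and> t \<in> Hom C T \<Omega> \<and>
     (\<forall>m. monic C m \<longrightarrow>
        (\<exists>!\<chi>. \<chi> \<in> Hom C (Cod C m) \<Omega> \<and> (\<exists>u\<in>Hom C (Dom C m) T. is_pullback C \<chi> t m u)))"

locale elementary_topos = category +
  assumes has_terminal: "\<exists>T. terminal C T"
    and has_products: "\<lbrakk>X \<in> Obj C; Y \<in> Obj C\<rbrakk> \<Longrightarrow> \<exists>P p q. is_product C X Y P p q"
    and has_equalizers: "\<lbrakk>f \<in> Hom C X Y; g \<in> Hom C X Y\<rbrakk> \<Longrightarrow> \<exists>e. is_equalizer C f g e"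
    and has_exponentials:
      "\<lbrakk>Y \<in> Obj C; Z \<in> Obj C\<rbrakk> \<Longrightarrow> \<exists>W P p q ev. is_exponential C Y Z W P p q ev"
    and has_subobject_classifier: "\<exists>T \<Omega> t. is_subobject_classifier C T \<Omega> t"

definition factors_through :: "('o, 'a) precategory \<Rightarrow> 'a \<Rightarrow> 'a \<Rightarrow> bool" where
  "factors_through C f m \<longleftrightarrow> (\<exists>h\<in>Hom C (Dom C f) (Dom C m). m \<cdot>\<^bsub>C\<^esub> h = f)"

text \<open>
  Subobjects are represented by monomorphisms, preordered by \<^const>\<open>factors_through\<close>;
  two of them are the same subobject when they factor through each other.
\<close>

definition subobject :: "('o, 'a) precategory \<Rightarrow> 'o \<Rightarrow> 'a \<Rightarrow> bool" where
  "subobject C X m \<longleftrightarrow> monic C m \<and> Cod C m = X"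

definition same_subobject :: "('o, 'a) precategory \<Rightarrow> 'a \<Rightarrow> 'a \<Rightarrow> bool" where
  "same_subobject C m n \<longleftrightarrow> factors_through C m n \<and> factors_through C n m"

text \<open>
  A complement in the lattice of subobjects of \<open>X\<close>: the meet of \<open>m\<close> and \<open>n\<close> is the
  least subobject and their join is the greatest one.
\<close>

definition complements ::
    "('o, 'a) precategory \<Rightarrow> 'o \<Rightarrow> 'a \<Rightarrow> 'a \<Rightarrow> bool" where
  "complements C X m n \<longleftrightarrow> subobject C X m \<and> subobject C X n \<and>
     (\<forall>k. subobject C X k \<and> factors_through C k m \<and> factors_through C k n \<longrightarrow>
        (\<forall>l. subobject C X l \<longrightarrow> factors_through C k l)) \<and>
     (\<forall>k. subobject C X k \<and> factors_through C m k \<and> factors_through C n k \<longrightarrow>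
        (\<forall>l. subobject C X l \<longrightarrow> factors_through C l k))"

definition complemented :: "('o, 'a) precategory \<Rightarrow> 'a \<Rightarrow> bool" where
  "complemented C m \<longleftrightarrow> (\<exists>n. complements C (Cod C m) m n)"

definition decidable :: "('o, 'a) precategory \<Rightarrow> 'o \<Rightarrow> bool" where
  "decidable C X \<longleftrightarrow> X \<in> Obj C \<and>
     (\<exists>P p q d. is_product C X X P p q \<and>
        d \<in> Hom C X P \<and> p \<cdot>\<^bsub>C\<^esub> d = Ide C X \<and> q \<cdot>\<^bsub>C\<^esub> d = Ide C X \<and> complemented C d)"

definition Dec :: "('o, 'a) precategory \<Rightarrow> ('o, 'a) precategory" where
  "Dec C = full_subcategory C (decidable C)"

definition is_point :: "('o, 'a) precategory \<Rightarrow> 'o \<Rightarrow> 'a \<Rightarrow> bool" where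
  "is_point C X x \<longleftrightarrow> (\<exists>T. terminal C T \<and> x \<in> Hom C T X)"

text \<open>
  Terminal objects, squares \<open>X \<times> X\<close> and coproducts \<open>1 + 1\<close> are not chosen: the notions below
  ask for some such object. They do not depend on which one, and in a topos all exist.
\<close>

definition is_two :: "('o, 'a) precategory \<Rightarrow> 'o \<Rightarrow> bool" where
  "is_two C B \<longleftrightarrow> (\<exists>T i j. terminal C T \<and> is_coproduct C T T B i j)"

definition NS :: "('o, 'a) precategory \<Rightarrow> bool" where
  "NS C \<longleftrightarrow> (\<forall>X\<in>Obj C. initial C X \<or> (\<exists>x. is_point C X x))"

definition decidable_quotient :: "('o, 'a) precategory \<Rightarrow> 'o \<Rightarrow> 'a \<Rightarrow> bool" where
  "decidable_quotient C X p \<longleftrightarrow> epic C p \<and> Dom C p = X \<and> decidable C (Cod C p) \<and>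
     (\<exists>B. is_two C B \<and>
        (\<forall>g\<in>Hom C X B. \<exists>!h. h \<in> Hom C (Cod C p) B \<and> h \<cdot>\<^bsub>C\<^esub> p = g))"

definition DQO :: "('o, 'a) precategory \<Rightarrow> bool" where
  "DQO C \<longleftrightarrow> (\<forall>X\<in>Obj C. \<exists>p. decidable_quotient C X p \<and>
     (\<forall>q. decidable_quotient C X q \<longrightarrow>
        (\<exists>i\<in>Hom C (Cod C p) (Cod C q). isomorphism C i \<and> i \<cdot>\<^bsub>C\<^esub> p = q)))"

definition decidable_subobject_of_points ::
    "('o, 'a) precategory \<Rightarrow> 'o \<Rightarrow> 'a \<Rightarrow> bool" where
  "decidable_subobject_of_points C X d \<longleftrightarrow> subobject C X d \<and> decidable C (Dom C d) \<and>
     (\<forall>x. is_point C X x \<longrightarrow> factors_through C x d)"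

definition DSO :: "('o, 'a) precategory \<Rightarrow> bool" where
  "DSO C \<longleftrightarrow> (\<forall>X\<in>Obj C. \<exists>d. decidable_subobject_of_points C X d \<and>
     (\<forall>e. decidable_subobject_of_points C X e \<longrightarrow> same_subobject C e d))"

record ('o, 'a, 'p, 'b) prefunctor =
  on_obj :: "'o \<Rightarrow> 'p"
  on_arr :: "'a \<Rightarrow> 'b"

locale functor_between = source: category C + target: category D
  for C :: "('o, 'a) precategory" and D :: "('p, 'b) precategory" +
  fixes F :: "('o, 'a, 'p, 'b) prefunctor"
  assumes on_obj_closed: "X \<in> Obj C \<Longrightarrow> on_obj F X \<in> Obj D"
    and on_arr_closed: "f \<in> Hom C X Y \<Longrightarrow> on_arr F f \<in> Hom D (on_obj F X) (on_obj F Y)"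
    and on_arr_Ide: "X \<in> Obj C \<Longrightarrow> on_arr F (Ide C X) = Ide D (on_obj F X)"
    and on_arr_Comp: "\<lbrakk>f \<in> Hom C X Y; g \<in> Hom C Y Z\<rbrakk> \<Longrightarrow>
      on_arr F (g \<cdot>\<^bsub>C\<^esub> f) = on_arr F g \<cdot>\<^bsub>D\<^esub> on_arr F f"

definition inclusion :: "('o, 'a, 'o, 'a) prefunctor" where
  "inclusion = \<lparr>on_obj = (\<lambda>X. X), on_arr = (\<lambda>f. f)\<rparr>"

definition fully_faithful ::
    "('o, 'a) precategory \<Rightarrow> ('p, 'b) precategory \<Rightarrow> ('o, 'a, 'p, 'b) prefunctor \<Rightarrow> bool" where
  "fully_faithful C D F \<longleftrightarrow> (\<forall>X\<in>Obj C. \<forall>Y\<in>Obj C.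
     bij_betw (on_arr F) (Hom C X Y) (Hom D (on_obj F X) (on_obj F Y)))"

definition preserves_finite_products ::
    "('o, 'a) precategory \<Rightarrow> ('p, 'b) precategory \<Rightarrow> ('o, 'a, 'p, 'b) prefunctor \<Rightarrow> bool" where
  "preserves_finite_products C D F \<longleftrightarrow>
     (\<forall>T. terminal C T \<longrightarrow> terminal D (on_obj F T)) \<and>
     (\<forall>X Y P p q. is_product C X Y P p q \<longrightarrow>
        is_product D (on_obj F X) (on_obj F Y) (on_obj F P) (on_arr F p) (on_arr F q))"

text \<open>\<open>adjunction C D F G \<eta> \<epsilon>\<close>: \<open>F : C \<rightarrow> D\<close> is left adjoint to \<open>G : D \<rightarrow> C\<close>.\<close>

locale adjunction = left: functor_between C D F + right: functor_between D C G
  for C :: "('o, 'a) precategory" and D :: "('p, 'b) precategory"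
    and F :: "('o, 'a, 'p, 'b) prefunctor" and G :: "('p, 'b, 'o, 'a) prefunctor" +
  fixes \<eta> :: "'o \<Rightarrow> 'a" and \<epsilon> :: "'p \<Rightarrow> 'b"
  assumes unit_closed: "X \<in> Obj C \<Longrightarrow> \<eta> X \<in> Hom C X (on_obj G (on_obj F X))"
    and counit_closed: "A \<in> Obj D \<Longrightarrow> \<epsilon> A \<in> Hom D (on_obj F (on_obj G A)) A"
    and unit_natural: "f \<in> Hom C X Y \<Longrightarrow>
      \<eta> Y \<cdot>\<^bsub>C\<^esub> f = on_arr G (on_arr F f) \<cdot>\<^bsub>C\<^esub> \<eta> X"
    and counit_natural: "g \<in> Hom D A B \<Longrightarrow>
      g \<cdot>\<^bsub>D\<^esub> \<epsilon> A = \<epsilon> B \<cdot>\<^bsub>D\<^esub> on_arr F (on_arr G g)"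
    and triangle_left: "X \<in> Obj C \<Longrightarrow>
      \<epsilon> (on_obj F X) \<cdot>\<^bsub>D\<^esub> on_arr F (\<eta> X) = Ide D (on_obj F X)"
    and triangle_right: "A \<in> Obj D \<Longrightarrow>
      on_arr G (\<epsilon> A) \<cdot>\<^bsub>C\<^esub> \<eta> (on_obj G A) = Ide C (on_obj G A)"

text \<open>
  \<open>precohesive_via E S f\<^sub>s\<close>: the topos \<open>E\<close> is precohesive over the topos \<open>S\<close> by a string
  of adjunctions whose inverse image functor is \<open>f\<^sub>s\<close>. In the usual notation, \<open>f\<^sub>l\<close>, \<open>f\<^sub>s\<close>,
  \<open>f\<^sub>p\<close> and \<open>f\<^sub>u\<close> are lower shriek, upper star, lower star and upper shriek.
\<close>

definition precohesive_via ::
    "('o, 'a) precategory \<Rightarrow> ('p, 'b) precategory \<Rightarrow> ('p, 'b, 'o, 'a) prefunctor \<Rightarrow> bool" where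
  "precohesive_via E S f\<^sub>s \<longleftrightarrow> elementary_topos E \<and> elementary_topos S \<and>
     (\<exists>f\<^sub>l f\<^sub>p f\<^sub>u \<eta> \<epsilon> \<eta>' \<epsilon>' \<eta>'' \<epsilon>''.
        adjunction E S f\<^sub>l f\<^sub>s \<eta> \<epsilon> \<and>
        adjunction S E f\<^sub>s f\<^sub>p \<eta>' \<epsilon>' \<and>
        adjunction E S f\<^sub>p f\<^sub>u \<eta>'' \<epsilon>'' \<and>
        fully_faithful S E f\<^sub>s \<and>
        preserves_finite_products E S f\<^sub>l \<and>
        (\<forall>X\<in>Obj E. monic E (\<epsilon>' X)))"

definition precohesive_over_Dec :: "('o, 'a) precategory \<Rightarrow> bool" where
  "precohesive_over_Dec E \<longleftrightarrow> precohesive_via E (Dec E) inclusion"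

end

theory Submission
  imports Defs
begin

text \<open>
  Under (NS), an arrow into a decidable object is determined by its values on points, since the
  complement of an equalizer without points is initial. (DSO) adds that a subobject of a decidable
  object is everything as soon as it contains all points. So maps between decidable objects, and
  factorizations through them, can be constructed and compared pointwise.

  From (DQO) and (DSO): the decidable subobject of points is a coreflection, every decidable object
  has complemented subobjects, hence decidable objects form a Boolean topos with classifier \<open>2\<close>.
  Points lift along \<open>X \<rightarrow> \<Pi> X\<close> and points of a decidable object are separated by maps to \<open>2\<close>, so
  \<open>\<Pi>\<close> is a reflection, and it preserves products because a product of points can be moved one
  coordinate at a time. The codiscrete objects are subobjects of powers of the object of
  \<open>\<not>\<not>\<close>-closed truth values.

  Conversely, the coreflection of the subobject classifier has only the two points true and false,
  which exhibits it as \<open>2\<close>. Bijectivity on points yields monicity and, in the balanced topos of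
  decidable objects, invertibility; this gives both uniqueness clauses.
\<close>

section \<open>Arrows, subobjects and products\<close>

text \<open>Pullbacks, images, unions, coproducts and an initial object are not among the topos
  axioms used here, yet complements are defined in the lattice of subobjects and have to be stable
  under pullback. The way out is to know a subobject only by the arrows that factor through it, and
  to derive a single quantifier, universal quantification along an arrow, from exponentials of the
  subobject classifier. It yields pseudo-complements, stability of covers, and relations of the form
  "every x over d has value a". Such a relation replaces an image: it is the graph of an induced
  arrow as soon as its first projection is invertible. This is how arrows are glued along
  complements and how they are factored through quotients.

  The degenerate topos, in which the terminal object is initial, satisfies (NS). Arguments that
  reach a point of an empty object therefore close by strictness of the initial object, which then
  makes every object initial.\<close>

context category
begin

abbreviation through (infix \<open>\<sqsubseteq>\<close> 50) where
  "f \<sqsubseteq> m \<equiv> factors_through C f m"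

lemma Hom_iff [simp]: "f \<in> Hom C X Y \<longleftrightarrow> f \<in> Arr C \<and> Dom C f = X \<and> Cod C f = Y"
  by (simp add: Hom_def)

lemma Ide_arr [simp]:
  assumes "X \<in> Obj C"
  shows "Ide C X \<in> Arr C" "Dom C (Ide C X) = X" "Cod C (Ide C X) = X"
  using Ide_closed [OF assms] by simp_all

lemma Dom_Cod_obj [simp]: "f \<in> Arr C \<Longrightarrow> Dom C f \<in> Obj C" "f \<in> Arr C \<Longrightarrow> Cod C f \<in> Obj C"
  by (simp_all add: Dom_closed Cod_closed)

lemma Comp_arr [simp]:
  assumes "f \<in> Arr C" "g \<in> Arr C" "Cod C f = Dom C g"
  shows "g \<cdot> f \<in> Arr C" "Dom C (g \<cdot> f) = Dom C f" "Cod C (g \<cdot> f) = Cod C g"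
  using Comp_closed [of f "Dom C f" "Dom C g" g "Cod C g"] assms by simp_all

lemma Comp_Ide [simp]:
  "\<lbrakk>f \<in> Arr C; Cod C f = Y\<rbrakk> \<Longrightarrow> Ide C Y \<cdot> f = f"
  "\<lbrakk>f \<in> Arr C; Dom C f = X\<rbrakk> \<Longrightarrow> f \<cdot> Ide C X = f"
  using Ide_left [of f "Dom C f" "Cod C f"] Ide_right [of f "Dom C f" "Cod C f"] by simp_all

lemma Comp_assoc' [simp]:
  "\<lbrakk>f \<in> Arr C; g \<in> Arr C; h \<in> Arr C; Cod C f = Dom C g; Cod C g = Dom C h\<rbrakk>
    \<Longrightarrow> (h \<cdot> g) \<cdot> f = h \<cdot> (g \<cdot> f)"
  using Comp_assoc [of f "Dom C f" "Dom C g" g "Dom C h" h "Cod C h"] by simp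

text \<open>Composites are kept associated to the right, where an equation about
  \<open>g \<cdot> f\<close> is hidden inside \<open>g \<cdot> (f \<cdot> w)\<close>; this exposes
  it.\<close>

lemma Comp_eq:
  "\<lbrakk>g \<cdot> f = k; f \<in> Arr C; g \<in> Arr C; w \<in> Arr C; Cod C f = Dom C g; Cod C w = Dom C f\<rbrakk>
    \<Longrightarrow> g \<cdot> (f \<cdot> w) = k \<cdot> w"
  by (metis Comp_assoc')

section \<open>Monomorphisms and epimorphisms\<close>

lemma monic_arr [simp]: "monic C m \<Longrightarrow> m \<in> Arr C"
  by (simp add: monic_def)

lemma monicD:
  "\<lbrakk>monic C m; m \<cdot> f = m \<cdot> g; f \<in> Arr C; g \<in> Arr C; Cod C f = Dom C m; Cod C g = Dom C m;
    Dom C f = Dom C g\<rbrakk> \<Longrightarrow> f = g"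
  unfolding monic_def by (metis Dom_Cod_obj(1) Hom_iff)

lemma monicI:
  assumes "m \<in> Arr C"
    and "\<And>f g. \<lbrakk>f \<in> Arr C; g \<in> Arr C; Dom C f = Dom C g; Cod C f = Dom C m; Cod C g = Dom C m;
      m \<cdot> f = m \<cdot> g\<rbrakk> \<Longrightarrow> f = g"
  shows "monic C m"
  unfolding monic_def
  by (intro conjI ballI impI, rule assms(1), rule assms(2)) (simp_all only: Hom_iff)

lemma epic_arr [simp]: "epic C e \<Longrightarrow> e \<in> Arr C"
  by (simp add: epic_def)

lemma epicD:
  "\<lbrakk>epic C e; f \<cdot> e = g \<cdot> e; f \<in> Arr C; g \<in> Arr C; Dom C f = Cod C e; Dom C g = Cod C e;
    Cod C f = Cod C g\<rbrakk> \<Longrightarrow> f = g"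
  unfolding epic_def by (metis Dom_Cod_obj(2) Hom_iff)

lemma epicI:
  assumes "e \<in> Arr C"
    and "\<And>f g. \<lbrakk>f \<in> Arr C; g \<in> Arr C; Cod C f = Cod C g; Dom C f = Cod C e; Dom C g = Cod C e;
      f \<cdot> e = g \<cdot> e\<rbrakk> \<Longrightarrow> f = g"
  shows "epic C e"
  unfolding epic_def
  by (intro conjI ballI impI, rule assms(1), rule assms(2)) (simp_all only: Hom_iff)

lemma monic_Ide: "X \<in> Obj C \<Longrightarrow> monic C (Ide C X)"
  by (rule monicI) auto

lemma monic_Comp:
  assumes "monic C m" "monic C n" "Cod C n = Dom C m"
  shows "monic C (m \<cdot> n)"
proof (rule monicI)
  fix f g
  assume *: "f \<in> Arr C" "g \<in> Arr C" "Dom C f = Dom C g" "Cod C f = Dom C (m \<cdot> n)"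
    "Cod C g = Dom C (m \<cdot> n)" "(m \<cdot> n) \<cdot> f = (m \<cdot> n) \<cdot> g"
  with assms have "n \<cdot> f = n \<cdot> g"
    by - (rule monicD [of m], simp_all)
  with * assms show "f = g"
    by - (rule monicD [of n], simp_all)
qed (use assms in simp)

lemma split_monic:
  assumes "m \<in> Arr C" "r \<in> Arr C" "Cod C m = Dom C r" "r \<cdot> m = Ide C (Dom C m)"
  shows "monic C m"
proof (rule monicI)
  fix f g
  assume *: "f \<in> Arr C" "g \<in> Arr C" "Dom C f = Dom C g" "Cod C f = Dom C m"
    "Cod C g = Dom C m" "m \<cdot> f = m \<cdot> g"
  have "(r \<cdot> m) \<cdot> f = (r \<cdot> m) \<cdot> g"
    using assms(1-3) * by simp
  then show "f = g"
    unfolding assms(4) using *(1-5) by simp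
qed (rule assms)

section \<open>Factorization of generalized elements through subobjects\<close>

lemma through_iff:
  "f \<sqsubseteq> m \<longleftrightarrow> (\<exists>h. h \<in> Arr C \<and> Dom C h = Dom C f \<and> Cod C h = Dom C m \<and> m \<cdot> h = f)"
  by (auto simp: factors_through_def)

lemma throughE:
  assumes "f \<sqsubseteq> m"
  obtains h where "h \<in> Arr C" "Dom C h = Dom C f" "Cod C h = Dom C m" "m \<cdot> h = f"
  using assms by (auto simp: through_iff)

lemma through_Comp: "\<lbrakk>m \<in> Arr C; h \<in> Arr C; Cod C h = Dom C m\<rbrakk> \<Longrightarrow> m \<cdot> h \<sqsubseteq> m"
  by (auto simp: through_iff)

lemma through_refl: "m \<in> Arr C \<Longrightarrow> m \<sqsubseteq> m"
  by (auto simp: through_iff intro!: exI [of _ "Ide C (Dom C m)"])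

lemma through_precomp:
  assumes "f \<sqsubseteq> m" "m \<in> Arr C" "w \<in> Arr C" "Cod C w = Dom C f"
  shows "f \<cdot> w \<sqsubseteq> m"
proof -
  obtain h where h: "h \<in> Arr C" "Dom C h = Dom C f" "Cod C h = Dom C m" "m \<cdot> h = f"
    using assms(1) by (rule throughE)
  then have "m \<cdot> (h \<cdot> w) = f \<cdot> w"
    using assms Comp_eq by simp
  then show ?thesis
    using through_Comp [of m "h \<cdot> w"] h assms by simp
qed

lemma through_trans:
  "\<lbrakk>f \<sqsubseteq> m; m \<sqsubseteq> k; m \<in> Arr C; k \<in> Arr C\<rbrakk> \<Longrightarrow> f \<sqsubseteq> k"
  by (metis throughE through_precomp)

lemma through_all:
  "\<lbrakk>Ide C (Cod C w) \<sqsubseteq> k; k \<in> Arr C; w \<in> Arr C\<rbrakk> \<Longrightarrow> w \<sqsubseteq> k"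
  using through_precomp [of "Ide C (Cod C w)" k w] by simp

text \<open>Cancelling \<open>m\<close> makes a subobject of a subobject comparable inside the
  larger object.\<close>

lemma through_Comp_monic:
  assumes "monic C m" "n \<in> Arr C" "Cod C n = Dom C m" "w \<in> Arr C" "Cod C w = Dom C m"
  shows "m \<cdot> w \<sqsubseteq> m \<cdot> n \<longleftrightarrow> w \<sqsubseteq> n"
proof
  assume "m \<cdot> w \<sqsubseteq> m \<cdot> n"
  then obtain h where "h \<in> Arr C" "Dom C h = Dom C w" "Cod C h = Dom C n" "m \<cdot> (n \<cdot> h) = m \<cdot> w"
    by (rule throughE) (use assms in simp)
  with assms have "n \<cdot> h = w"
    by - (rule monicD [of m], simp_all)
  with \<open>h \<in> Arr C\<close> \<open>Cod C h = Dom C n\<close> assms show "w \<sqsubseteq> n"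
    using through_Comp by blast
next
  assume "w \<sqsubseteq> n"
  then show "m \<cdot> w \<sqsubseteq> m \<cdot> n"
    by (rule throughE) (use assms in \<open>auto simp: through_iff\<close>)
qed

lemma subobject_iff: "subobject C X m \<longleftrightarrow> monic C m \<and> Cod C m = X"
  by (simp add: subobject_def)

section \<open>Terminal and initial objects\<close>

lemma terminal_obj: "terminal C T \<Longrightarrow> T \<in> Obj C"
  by (simp add: terminal_def)

lemma terminal_eq:
  "\<lbrakk>terminal C T; f \<in> Arr C; g \<in> Arr C; Cod C f = T; Cod C g = T; Dom C f = Dom C g\<rbrakk> \<Longrightarrow> f = g"
  unfolding terminal_def by (metis Dom_Cod_obj(1) Hom_iff)

lemma terminal_arrow:
  assumes "terminal C T" "X \<in> Obj C"
  obtains u where "u \<in> Arr C" "Dom C u = X" "Cod C u = T"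
  using assms by (metis terminal_def Hom_iff)

lemma monic_from_terminal: "\<lbrakk>terminal C T; x \<in> Arr C; Dom C x = T\<rbrakk> \<Longrightarrow> monic C x"
  by (rule monicI, simp, rule terminal_eq) simp_all

lemma initial_eq:
  "\<lbrakk>initial C I; f \<in> Arr C; g \<in> Arr C; Dom C f = I; Dom C g = I; Cod C f = Cod C g\<rbrakk> \<Longrightarrow> f = g"
  unfolding initial_def by (metis Dom_Cod_obj(2) Hom_iff)

lemma initial_arrow:
  assumes "initial C I" "X \<in> Obj C"
  obtains u where "u \<in> Arr C" "Dom C u = I" "Cod C u = X"
  using assms by (metis initial_def Hom_iff)

lemma initial_through:
  assumes "initial C (Dom C w)" "w \<in> Arr C" "k \<in> Arr C" "Cod C w = Cod C k"
  shows "w \<sqsubseteq> k"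
proof -
  obtain u where u: "u \<in> Arr C" "Dom C u = Dom C w" "Cod C u = Dom C k"
    using assms initial_arrow [of "Dom C w" "Dom C k"] by auto
  with assms have "k \<cdot> u = w"
    by - (rule initial_eq [OF assms(1)], simp_all)
  with u assms show ?thesis
    by (auto simp: through_iff)
qed

section \<open>Binary products\<close>

lemma is_productD:
  assumes "is_product C X Y P p q"
  shows "p \<in> Arr C" "Dom C p = P" "Cod C p = X" "q \<in> Arr C" "Dom C q = P" "Cod C q = Y"
  using assms by (simp_all add: is_product_def)

lemma is_product_ex1:
  assumes "is_product C X Y P p q" "f \<in> Arr C" "g \<in> Arr C" "Dom C f = Dom C g" "Cod C f = X" "Cod C g = Y"
  shows "\<exists>!h. h \<in> Hom C (Dom C f) P \<and> p \<cdot> h = f \<and> q \<cdot> h = g"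
  using assms(1) [unfolded is_product_def, THEN conjunct2, THEN conjunct2, rule_format, of "Dom C f" f g]
    assms(2-) by simp

lemma is_product_pair:
  assumes "is_product C X Y P p q" "f \<in> Arr C" "g \<in> Arr C" "Dom C f = Dom C g" "Cod C f = X" "Cod C g = Y"
  obtains h where "h \<in> Arr C" "Dom C h = Dom C f" "Cod C h = P" "p \<cdot> h = f" "q \<cdot> h = g"
  using is_product_ex1 [OF assms] that by auto

lemma is_product_eq:
  assumes "is_product C X Y P p q" "f \<in> Arr C" "g \<in> Arr C" "Dom C f = Dom C g" "Cod C f = P" "Cod C g = P"
    "p \<cdot> f = p \<cdot> g" "q \<cdot> f = q \<cdot> g"
  shows "f = g"
proof -
  have "\<exists>!h. h \<in> Hom C (Dom C (p \<cdot> f)) P \<and> p \<cdot> h = p \<cdot> f \<and> q \<cdot> h = q \<cdot> f"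
    by (rule is_product_ex1 [OF assms(1)]) (use assms(2-6) is_productD [OF assms(1)] in simp_all)
  then show ?thesis
    using assms(2-) is_productD [OF assms(1)] by auto
qed

lemma is_productI:
  assumes "p \<in> Arr C" "Dom C p = P" "Cod C p = X" "q \<in> Arr C" "Dom C q = P" "Cod C q = Y"
    and "\<And>f g. \<lbrakk>f \<in> Arr C; g \<in> Arr C; Dom C f = Dom C g; Cod C f = X; Cod C g = Y\<rbrakk>
      \<Longrightarrow> \<exists>h. h \<in> Arr C \<and> Dom C h = Dom C f \<and> Cod C h = P \<and> p \<cdot> h = f \<and> q \<cdot> h = g"
    and "\<And>f g. \<lbrakk>f \<in> Arr C; g \<in> Arr C; Dom C f = Dom C g; Cod C f = P; Cod C g = P;
      p \<cdot> f = p \<cdot> g; q \<cdot> f = q \<cdot> g\<rbrakk> \<Longrightarrow> f = g"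
  shows "is_product C X Y P p q"
  unfolding is_product_def
proof (intro conjI ballI)
  fix Z f g
  assume "Z \<in> Obj C" and f: "f \<in> Hom C Z X" and g: "g \<in> Hom C Z Y"
  then obtain h where "h \<in> Hom C Z P" "p \<cdot> h = f" "q \<cdot> h = g"
    using assms(7) [of f g] by auto
  then show "\<exists>!h. h \<in> Hom C Z P \<and> p \<cdot> h = f \<and> q \<cdot> h = g"
    using assms(8) by (intro ex1I [of _ h]) auto
qed (use assms in auto)

end

section \<open>Elementary toposes\<close>

context elementary_topos
begin

section \<open>The classifier as a test for factorization\<close>

definition truth where
  "truth = (SOME t. \<exists>T \<Omega>. is_subobject_classifier C T \<Omega> t)"

definition one where
  "one = Dom C truth"

definition Om where
  "Om = Cod C truth"

definition bang where
  "bang X = (SOME u. u \<in> Arr C \<and> Dom C u = X \<and> Cod C u = one)"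

definition tr where
  "tr X = truth \<cdot> bang X"

lemma truth_classifies: "is_subobject_classifier C one Om truth"
proof -
  have "\<exists>T \<Omega>. is_subobject_classifier C T \<Omega> truth"
    unfolding truth_def by (rule someI_ex) (use has_subobject_classifier in blast)
  then show ?thesis
    by (auto simp: is_subobject_classifier_def one_def Om_def)
qed

lemma one_terminal: "terminal C one"
  using truth_classifies by (simp add: is_subobject_classifier_def)

lemma truth_arr [simp]: "truth \<in> Arr C" "Dom C truth = one" "Cod C truth = Om"
  using truth_classifies by (simp_all add: is_subobject_classifier_def)

lemma one_obj [simp]: "one \<in> Obj C"
  by (rule terminal_obj [OF one_terminal])

lemma Om_obj [simp]: "Om \<in> Obj C"
  using Dom_Cod_obj(2) [of truth] by simp

lemmas one_eq = terminal_eq [OF one_terminal]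

lemma bang_arr [simp]:
  assumes "X \<in> Obj C"
  shows "bang X \<in> Arr C" "Dom C (bang X) = X" "Cod C (bang X) = one"
proof -
  have "bang X \<in> Arr C \<and> Dom C (bang X) = X \<and> Cod C (bang X) = one"
    unfolding bang_def by (rule someI_ex) (use terminal_arrow [OF one_terminal assms] in blast)
  then show "bang X \<in> Arr C" "Dom C (bang X) = X" "Cod C (bang X) = one"
    by simp_all
qed

lemma bang_Comp [simp]: "\<lbrakk>w \<in> Arr C; Cod C w = X\<rbrakk> \<Longrightarrow> bang X \<cdot> w = bang (Dom C w)"
  by (rule one_eq) auto

lemma bang_unique: "\<lbrakk>w \<in> Arr C; Cod C w = one\<rbrakk> \<Longrightarrow> w = bang (Dom C w)"
  by (rule one_eq) auto

lemma one_Ide: "\<lbrakk>x \<in> Arr C; Dom C x = one; Cod C x = one\<rbrakk> \<Longrightarrow> x = Ide C one"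
  by (rule one_eq) simp_all

lemma tr_arr [simp]:
  "X \<in> Obj C \<Longrightarrow> tr X \<in> Arr C" "X \<in> Obj C \<Longrightarrow> Dom C (tr X) = X" "X \<in> Obj C \<Longrightarrow> Cod C (tr X) = Om"
  by (simp_all add: tr_def)

lemma tr_Comp [simp]: "\<lbrakk>w \<in> Arr C; Cod C w = X\<rbrakk> \<Longrightarrow> tr X \<cdot> w = tr (Dom C w)"
  by (auto simp: tr_def)

lemma tr_one: "tr one = truth"
proof -
  have "bang one = Ide C one"
    by (rule one_Ide) simp_all
  then show ?thesis
    by (simp add: tr_def)
qed

text \<open>The leg of a square that ends in the terminal object is forced, so the pullback property
  only says which arrows factor through \<open>m\<close>. This turns the classifier axiom into a
  statement about generalized elements, the form in which subobjects are handled from here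
  on.\<close>

lemma pullback_truth_iff:
  assumes m: "monic C m" and \<chi>: "\<chi> \<in> Arr C" "Dom C \<chi> = Cod C m" "Cod C \<chi> = Om"
  shows "(\<exists>u\<in>Hom C (Dom C m) one. is_pullback C \<chi> truth m u) \<longleftrightarrow>
    (\<forall>w\<in>Arr C. Cod C w = Cod C m \<longrightarrow> (w \<sqsubseteq> m \<longleftrightarrow> \<chi> \<cdot> w = tr (Dom C w)))" (is "?L \<longleftrightarrow> ?R")
proof
  assume ?L
  then obtain u where u: "u \<in> Arr C" "Dom C u = Dom C m" "Cod C u = one"
    and pb: "is_pullback C \<chi> truth m u"
    by auto
  have eq: "\<chi> \<cdot> m = tr (Dom C m)"
    using pb bang_unique [OF u(1,3)] u(2) by (simp add: is_pullback_def tr_def)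
  show ?R
  proof (intro ballI impI)
    fix w
    assume w: "w \<in> Arr C" "Cod C w = Cod C m"
    show "w \<sqsubseteq> m \<longleftrightarrow> \<chi> \<cdot> w = tr (Dom C w)"
    proof
      assume "w \<sqsubseteq> m"
      then obtain h where "h \<in> Arr C" "Dom C h = Dom C w" "Cod C h = Dom C m" "m \<cdot> h = w"
        by (rule throughE)
      with Comp_eq [OF eq, of h] m \<chi> show "\<chi> \<cdot> w = tr (Dom C w)"
        by simp
    next
      assume "\<chi> \<cdot> w = tr (Dom C w)"
      then have "\<exists>!h. h \<in> Hom C (Dom C w) (Dom C m) \<and> m \<cdot> h = w \<and> u \<cdot> h = bang (Dom C w)"
        using pb w m \<chi> unfolding is_pullback_def by (simp add: tr_def)
      then show "w \<sqsubseteq> m"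
        by (auto simp: through_iff)
    qed
  qed
next
  assume R: ?R
  have "\<chi> \<cdot> m = tr (Dom C m)"
    using R m through_refl [of m] by simp
  then have "is_pullback C \<chi> truth m (bang (Dom C m))"
    unfolding is_pullback_def
  proof (intro conjI ballI impI)
    fix Z a b
    assume Z: "Z \<in> Obj C" and a: "a \<in> Hom C Z (Dom C \<chi>)" and b: "b \<in> Hom C Z (Dom C truth)"
      and eq: "\<chi> \<cdot> a = truth \<cdot> b"
    have "b = bang Z"
      using b bang_unique [of b] by simp
    with eq have "\<chi> \<cdot> a = tr (Dom C a)"
      using a by (simp add: tr_def)
    with R a \<chi> have "a \<sqsubseteq> m"
      by simp
    then obtain h where h: "h \<in> Arr C" "Dom C h = Dom C a" "Cod C h = Dom C m" "m \<cdot> h = a"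
      by (rule throughE)
    show "\<exists>!h. h \<in> Hom C Z (Dom C m) \<and> m \<cdot> h = a \<and> bang (Dom C m) \<cdot> h = b"
    proof (rule ex1I [of _ h])
      show "h \<in> Hom C Z (Dom C m) \<and> m \<cdot> h = a \<and> bang (Dom C m) \<cdot> h = b"
        using h a \<open>b = bang Z\<close> m by simp
      show "h' = h" if "h' \<in> Hom C Z (Dom C m) \<and> m \<cdot> h' = a \<and> bang (Dom C m) \<cdot> h' = b" for h'
        by (rule monicD [OF m]) (use that h a in simp_all)
    qed
  qed (use m \<chi> in \<open>simp_all add: tr_def\<close>)
  then show ?L
    using m by (intro bexI [of _ "bang (Dom C m)"]) simp_all
qed

lemma characteristic_ex1:
  assumes "monic C m"
  shows "\<exists>!\<chi>. \<chi> \<in> Hom C (Cod C m) Om \<and>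
    (\<forall>w\<in>Arr C. Cod C w = Cod C m \<longrightarrow> (w \<sqsubseteq> m \<longleftrightarrow> \<chi> \<cdot> w = tr (Dom C w)))"
proof -
  have "\<exists>!\<chi>. \<chi> \<in> Hom C (Cod C m) Om \<and> (\<exists>u\<in>Hom C (Dom C m) one. is_pullback C \<chi> truth m u)"
    using truth_classifies assms by (simp add: is_subobject_classifier_def)
  moreover have "\<chi> \<in> Hom C (Cod C m) Om \<and> (\<exists>u\<in>Hom C (Dom C m) one. is_pullback C \<chi> truth m u) \<longleftrightarrow>
    \<chi> \<in> Hom C (Cod C m) Om \<and>
    (\<forall>w\<in>Arr C. Cod C w = Cod C m \<longrightarrow> (w \<sqsubseteq> m \<longleftrightarrow> \<chi> \<cdot> w = tr (Dom C w)))" for \<chi>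
    using pullback_truth_iff [OF assms, of \<chi>] by auto
  ultimately show ?thesis
    by simp
qed

definition chi where
  "chi m = (THE \<chi>. \<chi> \<in> Hom C (Cod C m) Om \<and>
    (\<forall>w\<in>Arr C. Cod C w = Cod C m \<longrightarrow> (w \<sqsubseteq> m \<longleftrightarrow> \<chi> \<cdot> w = tr (Dom C w))))"

lemma chi_props:
  assumes "monic C m"
  shows "chi m \<in> Hom C (Cod C m) Om \<and>
    (\<forall>w\<in>Arr C. Cod C w = Cod C m \<longrightarrow> (w \<sqsubseteq> m \<longleftrightarrow> chi m \<cdot> w = tr (Dom C w)))"
  unfolding chi_def by (rule theI' [OF characteristic_ex1 [OF assms]])

lemma chi_arr [simp]:
  assumes "monic C m"
  shows "chi m \<in> Arr C" "Dom C (chi m) = Cod C m" "Cod C (chi m) = Om"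
  using chi_props [OF assms] by simp_all

lemma chi_iff:
  "\<lbrakk>monic C m; w \<in> Arr C; Cod C w = Cod C m\<rbrakk> \<Longrightarrow> chi m \<cdot> w = tr (Dom C w) \<longleftrightarrow> w \<sqsubseteq> m"
  using chi_props [of m] by simp

section \<open>Equalizers, preimages and meets described by their elements\<close>

lemma equalizer:
  assumes "f \<in> Arr C" "g \<in> Arr C" "Dom C f = Dom C g" "Cod C f = Cod C g"
  obtains e where "monic C e" "Cod C e = Dom C f"
    "\<And>w. \<lbrakk>w \<in> Arr C; Cod C w = Dom C f\<rbrakk> \<Longrightarrow> w \<sqsubseteq> e \<longleftrightarrow> f \<cdot> w = g \<cdot> w"
proof -
  obtain e where "is_equalizer C f g e"
    using has_equalizers [of f "Dom C f" "Cod C f" g] assms by auto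
  then have e: "e \<in> Arr C" "Cod C e = Dom C f" "f \<cdot> e = g \<cdot> e"
    and u: "\<And>k. \<lbrakk>k \<in> Arr C; Cod C k = Dom C f; f \<cdot> k = g \<cdot> k\<rbrakk>
      \<Longrightarrow> \<exists>!h. h \<in> Hom C (Dom C k) (Dom C e) \<and> e \<cdot> h = k"
    unfolding is_equalizer_def by simp_all
  have *: "f \<cdot> (e \<cdot> w) = g \<cdot> (e \<cdot> w)" if "w \<in> Arr C" "Cod C w = Dom C e" for w
    using Comp_eq [OF e(3), of w] that e assms by simp
  have "monic C e"
  proof (rule monicI)
    fix a b
    assume ab: "a \<in> Arr C" "b \<in> Arr C" "Dom C a = Dom C b" "Cod C a = Dom C e" "Cod C b = Dom C e"
      "e \<cdot> a = e \<cdot> b"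
    have "\<exists>!h. h \<in> Hom C (Dom C (e \<cdot> a)) (Dom C e) \<and> e \<cdot> h = e \<cdot> a"
      by (rule u) (use ab e * in simp_all)
    with ab e show "a = b"
      by auto
  qed (rule e)
  moreover have "w \<sqsubseteq> e \<longleftrightarrow> f \<cdot> w = g \<cdot> w" if "w \<in> Arr C" "Cod C w = Dom C f" for w
  proof
    assume "w \<sqsubseteq> e"
    then show "f \<cdot> w = g \<cdot> w"
      by (rule throughE) (use * in auto)
  next
    assume "f \<cdot> w = g \<cdot> w"
    with u [OF that] show "w \<sqsubseteq> e"
      by (auto simp: through_iff)
  qed
  ultimately show ?thesis
    using that e(2) by blast
qed

text \<open>The form in which arrows are compared on a cover: every mono with the defining property
  of the equalizer has to be everything. That property is handed to the caller, because the covering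
  argument needs it.\<close>

lemma equal_if_through_all:
  assumes "f \<in> Arr C" "g \<in> Arr C" "Dom C f = Dom C g" "Cod C f = Cod C g"
    and "\<And>e. \<lbrakk>monic C e; Cod C e = Dom C f; 
      \<And>w. \<lbrakk>w \<in> Arr C; Cod C w = Dom C f\<rbrakk> \<Longrightarrow> w \<sqsubseteq> e \<longleftrightarrow> f \<cdot> w = g \<cdot> w\<rbrakk> \<Longrightarrow> Ide C (Dom C f) \<sqsubseteq> e"
  shows "f = g"
proof -
  obtain e where e: "monic C e" "Cod C e = Dom C f"
    "\<And>w. \<lbrakk>w \<in> Arr C; Cod C w = Dom C f\<rbrakk> \<Longrightarrow> w \<sqsubseteq> e \<longleftrightarrow> f \<cdot> w = g \<cdot> w"
    using equalizer [OF assms(1-4)] by blast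
  have "f \<cdot> Ide C (Dom C f) = g \<cdot> Ide C (Dom C f)"
    using assms(5) [OF e] e(3) [of "Ide C (Dom C f)"] assms(1) by simp
  then show ?thesis
    using assms(1-3) by simp
qed

text \<open>The preimage is the equalizer of \<open>chi m \<cdot> h\<close> with the constantly true
  arrow.\<close>

lemma preimage:
  assumes "h \<in> Arr C" "monic C m" "Cod C h = Cod C m"
  obtains k where "monic C k" "Cod C k = Dom C h"
    "\<And>w. \<lbrakk>w \<in> Arr C; Cod C w = Dom C h\<rbrakk> \<Longrightarrow> w \<sqsubseteq> k \<longleftrightarrow> h \<cdot> w \<sqsubseteq> m"
proof -
  obtain k where k: "monic C k" "Cod C k = Dom C (chi m \<cdot> h)"
    "\<And>w. \<lbrakk>w \<in> Arr C; Cod C w = Dom C (chi m \<cdot> h)\<rbrakk>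
      \<Longrightarrow> w \<sqsubseteq> k \<longleftrightarrow> (chi m \<cdot> h) \<cdot> w = tr (Dom C h) \<cdot> w"
    using equalizer [of "chi m \<cdot> h" "tr (Dom C h)"] assms by auto
  show ?thesis
  proof (rule that)
    show "w \<sqsubseteq> k \<longleftrightarrow> h \<cdot> w \<sqsubseteq> m" if "w \<in> Arr C" "Cod C w = Dom C h" for w
      using k(3) [of w] chi_iff [of m "h \<cdot> w"] that assms by simp
  qed (use k assms in simp_all)
qed

text \<open>The meet is the preimage of \<open>n\<close> along \<open>m\<close>, carried back by
  \<open>m\<close> into the common codomain.\<close>

lemma meet:
  assumes "monic C m" "monic C n" "Cod C m = Cod C n"
  obtains k where "monic C k" "Cod C k = Cod C m"
    "\<And>w. \<lbrakk>w \<in> Arr C; Cod C w = Cod C m\<rbrakk> \<Longrightarrow> w \<sqsubseteq> k \<longleftrightarrow> w \<sqsubseteq> m \<and> w \<sqsubseteq> n"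
proof -
  obtain r where r: "monic C r" "Cod C r = Dom C m"
    "\<And>w. \<lbrakk>w \<in> Arr C; Cod C w = Dom C m\<rbrakk> \<Longrightarrow> w \<sqsubseteq> r \<longleftrightarrow> m \<cdot> w \<sqsubseteq> n"
    using preimage [of m n] assms by auto
  show ?thesis
  proof (rule that)
    show "monic C (m \<cdot> r)" "Cod C (m \<cdot> r) = Cod C m"
      using assms r by (simp_all add: monic_Comp)
    fix w
    assume w: "w \<in> Arr C" "Cod C w = Cod C m"
    show "w \<sqsubseteq> m \<cdot> r \<longleftrightarrow> w \<sqsubseteq> m \<and> w \<sqsubseteq> n"
    proof
      assume "w \<sqsubseteq> m \<cdot> r"
      then obtain h where h: "h \<in> Arr C" "Dom C h = Dom C w" "Cod C h = Dom C r" "m \<cdot> (r \<cdot> h) = w"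
        by (rule throughE) (use assms r in simp)
      have "r \<cdot> h \<sqsubseteq> r"
        using h r(1,2) by (simp add: through_Comp)
      with r(3) [of "r \<cdot> h"] h r(1,2) have "w \<sqsubseteq> n"
        by simp
      moreover have "w \<sqsubseteq> m"
        using through_Comp [of m "r \<cdot> h"] h r(1,2) assms by simp
      ultimately show "w \<sqsubseteq> m \<and> w \<sqsubseteq> n"
        by simp
    next
      assume *: "w \<sqsubseteq> m \<and> w \<sqsubseteq> n"
      then obtain h where h: "h \<in> Arr C" "Dom C h = Dom C w" "Cod C h = Dom C m" "m \<cdot> h = w"
        by (auto elim: throughE)
      with r(3) [of h] * have "h \<sqsubseteq> r"
        by simp
      then show "w \<sqsubseteq> m \<cdot> r"
        using through_Comp_monic [of m r h] assms h r by simp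
    qed
  qed
qed

text \<open>Both arrows classify the subobject on which \<open>\<phi>\<close> is true, and a
  classifying arrow is unique.\<close>

lemma Om_ext:
  assumes \<phi>: "\<phi> \<in> Arr C" "Cod C \<phi> = Om" and \<psi>: "\<psi> \<in> Arr C" "Cod C \<psi> = Om" and dom: "Dom C \<phi> = Dom C \<psi>"
    and eq: "\<And>w. \<lbrakk>w \<in> Arr C; Cod C w = Dom C \<phi>\<rbrakk>
      \<Longrightarrow> \<phi> \<cdot> w = tr (Dom C w) \<longleftrightarrow> \<psi> \<cdot> w = tr (Dom C w)"
  shows "\<phi> = \<psi>"
proof -
  obtain m where m: "monic C m" "Cod C m = Dom C \<phi>"
    "\<And>w. \<lbrakk>w \<in> Arr C; Cod C w = Dom C \<phi>\<rbrakk> \<Longrightarrow> w \<sqsubseteq> m \<longleftrightarrow> \<phi> \<cdot> w = tr (Dom C \<phi>) \<cdot> w"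
    using equalizer [of \<phi> "tr (Dom C \<phi>)"] \<phi> by auto
  have iff: "\<forall>w\<in>Arr C. Cod C w = Cod C m \<longrightarrow> (w \<sqsubseteq> m \<longleftrightarrow> \<phi> \<cdot> w = tr (Dom C w))"
    "\<forall>w\<in>Arr C. Cod C w = Cod C m \<longrightarrow> (w \<sqsubseteq> m \<longleftrightarrow> \<psi> \<cdot> w = tr (Dom C w))"
    using m eq by simp_all
  show ?thesis
    by (rule Uniq_D [OF ex1_iff_ex_Uniq [THEN iffD1, THEN conjunct2, OF characteristic_ex1 [OF m(1)]]])
      (use iff \<phi> \<psi> dom m(2) in \<open>simp_all only: Hom_iff simp_thms\<close>)
qed

section \<open>Chosen binary products\<close>

definition Prod_data where
  "Prod_data X Y = (SOME t. is_product C X Y (fst t) (fst (snd t)) (snd (snd t)))"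

definition Pr where
  "Pr X Y = fst (Prod_data X Y)"

definition p1 where
  "p1 X Y = fst (snd (Prod_data X Y))"

definition p2 where
  "p2 X Y = snd (snd (Prod_data X Y))"

definition pair where
  "pair f g = (SOME h. h \<in> Arr C \<and> Dom C h = Dom C f \<and> Cod C h = Pr (Cod C f) (Cod C g) \<and>
    p1 (Cod C f) (Cod C g) \<cdot> h = f \<and> p2 (Cod C f) (Cod C g) \<cdot> h = g)"

lemma Pr_is_product:
  assumes "X \<in> Obj C" "Y \<in> Obj C"
  shows "is_product C X Y (Pr X Y) (p1 X Y) (p2 X Y)"
  unfolding Pr_def p1_def p2_def Prod_data_def
proof (rule someI_ex [of "\<lambda>t. is_product C X Y (fst t) (fst (snd t)) (snd (snd t))"])
  show "\<exists>t. is_product C X Y (fst t) (fst (snd t)) (snd (snd t))"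
    using has_products [OF assms] by simp
qed

lemma proj_arr [simp]:
  assumes "X \<in> Obj C" "Y \<in> Obj C"
  shows "p1 X Y \<in> Arr C" "Dom C (p1 X Y) = Pr X Y" "Cod C (p1 X Y) = X"
    "p2 X Y \<in> Arr C" "Dom C (p2 X Y) = Pr X Y" "Cod C (p2 X Y) = Y"
  using is_productD [OF Pr_is_product [OF assms]] by simp_all

lemma Pr_obj [simp]: "\<lbrakk>X \<in> Obj C; Y \<in> Obj C\<rbrakk> \<Longrightarrow> Pr X Y \<in> Obj C"
  using Dom_Cod_obj(1) [of "p1 X Y"] by simp

lemma pair_props:
  assumes "f \<in> Arr C" "g \<in> Arr C" "Dom C f = Dom C g"
  shows "pair f g \<in> Arr C \<and> Dom C (pair f g) = Dom C f \<and> Cod C (pair f g) = Pr (Cod C f) (Cod C g) \<and>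
    p1 (Cod C f) (Cod C g) \<cdot> pair f g = f \<and> p2 (Cod C f) (Cod C g) \<cdot> pair f g = g"
  unfolding pair_def
  by (rule someI_ex, rule is_product_pair [OF Pr_is_product assms]) (use assms in auto)

lemma pair_arr [simp]:
  assumes "f \<in> Arr C" "g \<in> Arr C" "Dom C f = Dom C g"
  shows "pair f g \<in> Arr C" "Dom C (pair f g) = Dom C f" "Cod C (pair f g) = Pr (Cod C f) (Cod C g)"
  using pair_props [OF assms] by simp_all

lemma proj_pair [simp]:
  assumes "f \<in> Arr C" "g \<in> Arr C" "Dom C f = Dom C g" "Cod C f = X" "Cod C g = Y"
  shows "p1 X Y \<cdot> pair f g = f" "p2 X Y \<cdot> pair f g = g"
  using pair_props [OF assms(1-3)] assms(4,5) by simp_all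

lemma pair_eqI:
  assumes "f \<in> Arr C" "g \<in> Arr C" "Dom C f = Dom C g" "Cod C f = Pr X Y" "Cod C g = Pr X Y"
    "X \<in> Obj C" "Y \<in> Obj C" "p1 X Y \<cdot> f = p1 X Y \<cdot> g" "p2 X Y \<cdot> f = p2 X Y \<cdot> g"
  shows "f = g"
  by (rule is_product_eq [OF Pr_is_product]) (use assms in simp_all)

lemma pair_eq_iff:
  assumes "f \<in> Arr C" "g \<in> Arr C" "f' \<in> Arr C" "g' \<in> Arr C" "Dom C f = Dom C g" "Dom C f' = Dom C g'"
    "Cod C f = Cod C f'" "Cod C g = Cod C g'"
  shows "pair f g = pair f' g' \<longleftrightarrow> f = f' \<and> g = g'"
proof
  assume eq: "pair f g = pair f' g'"
  have "p1 (Cod C f) (Cod C g) \<cdot> pair f g = f" "p2 (Cod C f) (Cod C g) \<cdot> pair f g = g"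
    "p1 (Cod C f) (Cod C g) \<cdot> pair f' g' = f'" "p2 (Cod C f) (Cod C g) \<cdot> pair f' g' = g'"
    using assms by simp_all
  with eq show "f = f' \<and> g = g'"
    by (simp only: eq)
qed simp

lemma pair_Comp [simp]:
  assumes "f \<in> Arr C" "g \<in> Arr C" "Dom C f = Dom C g" "w \<in> Arr C" "Cod C w = Dom C f"
  shows "pair f g \<cdot> w = pair (f \<cdot> w) (g \<cdot> w)"
proof (rule pair_eqI [of _ _ "Cod C f" "Cod C g"])
  show "p1 (Cod C f) (Cod C g) \<cdot> (pair f g \<cdot> w) = p1 (Cod C f) (Cod C g) \<cdot> pair (f \<cdot> w) (g \<cdot> w)"
    using Comp_eq [OF proj_pair(1) [OF assms(1-3) refl refl], of w] assms by simp
  show "p2 (Cod C f) (Cod C g) \<cdot> (pair f g \<cdot> w) = p2 (Cod C f) (Cod C g) \<cdot> pair (f \<cdot> w) (g \<cdot> w)"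
    using Comp_eq [OF proj_pair(2) [OF assms(1-3) refl refl], of w] assms by simp
qed (use assms in simp_all)

lemma pair_eta:
  assumes "w \<in> Arr C" "Cod C w = Pr X Y" "X \<in> Obj C" "Y \<in> Obj C"
  shows "pair (p1 X Y \<cdot> w) (p2 X Y \<cdot> w) = w"
  by (rule pair_eqI [of _ _ X Y]) (use assms in simp_all)

text \<open>Transposition and extensionality are restated on generalized elements \<open>x\<close>,
  \<open>y\<close> and on the chosen product. The exponential supplied by the axioms may live on
  another product \<open>P\<close>, so its evaluation is transported along the comparison arrow
  \<open>u\<close>.\<close>

lemma exponential:
  assumes Y: "Y \<in> Obj C" and Z: "Z \<in> Obj C"
  obtains W ev where "W \<in> Obj C" "ev \<in> Arr C" "Dom C ev = Pr W Y" "Cod C ev = Z"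
    "\<And>X f. \<lbrakk>X \<in> Obj C; f \<in> Arr C; Dom C f = Pr X Y; Cod C f = Z\<rbrakk> \<Longrightarrow>
      \<exists>h. h \<in> Arr C \<and> Dom C h = X \<and> Cod C h = W \<and>
        (\<forall>x y. x \<in> Arr C \<longrightarrow> y \<in> Arr C \<longrightarrow> Dom C x = Dom C y \<longrightarrow> Cod C x = X \<longrightarrow> Cod C y = Y \<longrightarrow>
          ev \<cdot> pair (h \<cdot> x) y = f \<cdot> pair x y)"
    "\<And>g h. \<lbrakk>g \<in> Arr C; h \<in> Arr C; Dom C g = Dom C h; Cod C g = W; Cod C h = W;
      \<And>x y. \<lbrakk>x \<in> Arr C; y \<in> Arr C; Dom C x = Dom C y; Cod C x = Dom C g; Cod C y = Y\<rbrakk>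
        \<Longrightarrow> ev \<cdot> pair (g \<cdot> x) y = ev \<cdot> pair (h \<cdot> x) y\<rbrakk> \<Longrightarrow> g = h"
proof -
  obtain W P p q ev where E: "is_exponential C Y Z W P p q ev"
    using has_exponentials [OF assms] by blast
  then have P: "is_product C W Y P p q" and ev: "ev \<in> Arr C" "Dom C ev = P" "Cod C ev = Z"
    by (simp_all add: is_exponential_def)
  have W: "W \<in> Obj C"
    using is_productD [OF P] Dom_Cod_obj by blast
  note pq = is_productD [OF P]
  obtain u where u: "u \<in> Arr C" "Dom C u = Pr W Y" "Cod C u = P" "p \<cdot> u = p1 W Y" "q \<cdot> u = p2 W Y"
    using is_product_pair [OF P, of "p1 W Y" "p2 W Y"] W Y by auto
  have u_pair: "p \<cdot> (u \<cdot> pair a b) = a" "q \<cdot> (u \<cdot> pair a b) = b"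
    if "a \<in> Arr C" "b \<in> Arr C" "Dom C a = Dom C b" "Cod C a = W" "Cod C b = Y" for a b
    using Comp_eq [OF u(4), of "pair a b"] Comp_eq [OF u(5), of "pair a b"] that u pq by simp_all
  have E1: "\<exists>!h. h \<in> Hom C X W \<and>
      (\<exists>k\<in>Hom C (Pr X Y) P. p \<cdot> k = h \<cdot> p1 X Y \<and> q \<cdot> k = p2 X Y \<and> ev \<cdot> k = f)"
    if "X \<in> Obj C" "f \<in> Arr C" "Dom C f = Pr X Y" "Cod C f = Z" for X f
    using E Pr_is_product [OF that(1) Y] that unfolding is_exponential_def by simp
  show ?thesis
  proof (rule that)
    show "ev \<cdot> u \<in> Arr C" "Dom C (ev \<cdot> u) = Pr W Y" "Cod C (ev \<cdot> u) = Z"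
      using ev u by simp_all
  next
    fix X f
    assume f: "X \<in> Obj C" "f \<in> Arr C" "Dom C f = Pr X Y" "Cod C f = Z"
    obtain h k where h': "h \<in> Hom C X W" and k': "k \<in> Hom C (Pr X Y) P"
      and eqs: "p \<cdot> k = h \<cdot> p1 X Y" "q \<cdot> k = p2 X Y" "ev \<cdot> k = f"
      using ex1_implies_ex [OF E1 [OF f]] by blast
    have h: "h \<in> Arr C" "Dom C h = X" "Cod C h = W"
      and k: "k \<in> Arr C" "Dom C k = Pr X Y" "Cod C k = P" "p \<cdot> k = h \<cdot> p1 X Y" "q \<cdot> k = p2 X Y" "ev \<cdot> k = f"
      using h' k' eqs by simp_all
    have "(ev \<cdot> u) \<cdot> pair (h \<cdot> x) y = f \<cdot> pair x y"
      if xy: "x \<in> Arr C" "y \<in> Arr C" "Dom C x = Dom C y" "Cod C x = X" "Cod C y = Y" for x y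
    proof -
      have "k \<cdot> pair x y = u \<cdot> pair (h \<cdot> x) y"
        by (rule is_product_eq [OF P])
          (use Comp_eq [OF k(4), of "pair x y"] Comp_eq [OF k(5), of "pair x y"] u_pair [of "h \<cdot> x" y]
            xy k h u pq f Y in simp_all)
      then show ?thesis
        using Comp_eq [OF k(6), of "pair x y"] xy k h u ev by simp
    qed
    with h show "\<exists>h. h \<in> Arr C \<and> Dom C h = X \<and> Cod C h = W \<and>
        (\<forall>x y. x \<in> Arr C \<longrightarrow> y \<in> Arr C \<longrightarrow> Dom C x = Dom C y \<longrightarrow> Cod C x = X \<longrightarrow> Cod C y = Y \<longrightarrow>
          (ev \<cdot> u) \<cdot> pair (h \<cdot> x) y = f \<cdot> pair x y)"
      by blast
  next
    fix g h
    assume gh: "g \<in> Arr C" "h \<in> Arr C" "Dom C g = Dom C h" "Cod C g = W" "Cod C h = W"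
      and eq: "\<And>x y. \<lbrakk>x \<in> Arr C; y \<in> Arr C; Dom C x = Dom C y; Cod C x = Dom C g; Cod C y = Y\<rbrakk>
        \<Longrightarrow> (ev \<cdot> u) \<cdot> pair (g \<cdot> x) y = (ev \<cdot> u) \<cdot> pair (h \<cdot> x) y"
    define X where "X = Dom C g"
    have X: "X \<in> Obj C" "Dom C g = X" "Dom C h = X"
      using gh by (simp_all add: X_def)
    \<comment> \<open>\<open>?k g\<close> is \<open>g \<times> Y\<close> landing in
      \<open>P\<close>. By hypothesis \<open>g\<close> and \<open>h\<close> give the same arrow
      after evaluation, so both are the transpose of that arrow.\<close>
    let ?k = "\<lambda>g. u \<cdot> pair (g \<cdot> p1 X Y) (p2 X Y)"
    have "\<exists>!h. h \<in> Hom C X W \<and>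
      (\<exists>k\<in>Hom C (Pr X Y) P. p \<cdot> k = h \<cdot> p1 X Y \<and> q \<cdot> k = p2 X Y \<and> ev \<cdot> k = ev \<cdot> ?k g)"
      by (rule E1) (use X Y gh u ev in simp_all)
    moreover have "g \<in> Hom C X W \<and>
      (\<exists>k\<in>Hom C (Pr X Y) P. p \<cdot> k = g \<cdot> p1 X Y \<and> q \<cdot> k = p2 X Y \<and> ev \<cdot> k = ev \<cdot> ?k g)"
      using gh X Y u u_pair [of "g \<cdot> p1 X Y" "p2 X Y"] by (intro conjI bexI [of _ "?k g"]) simp_all
    moreover have "ev \<cdot> ?k h = ev \<cdot> ?k g"
      using eq [of "p1 X Y" "p2 X Y"] X Y gh u ev by simp
    then have "h \<in> Hom C X W \<and>
      (\<exists>k\<in>Hom C (Pr X Y) P. p \<cdot> k = h \<cdot> p1 X Y \<and> q \<cdot> k = p2 X Y \<and> ev \<cdot> k = ev \<cdot> ?k g)"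
      using gh X Y u u_pair [of "h \<cdot> p1 X Y" "p2 X Y"] by (intro conjI bexI [of _ "?k h"]) simp_all
    ultimately show "g = h"
      by blast
  qed (rule W)
qed

text \<open>\<^term>\<open>a\<close> consists of those \<open>y\<close> for which the graph of \<^term>\<open>h\<close> and the graph of its restriction to
  \<^term>\<open>k\<close> have the same fibre over \<open>y\<close>.\<close>

lemma universal_image:
  assumes h: "h \<in> Arr C" and k: "monic C k" "Cod C k = Dom C h"
  obtains a where "monic C a" "Cod C a = Cod C h"
    "\<And>g. \<lbrakk>g \<in> Arr C; Cod C g = Cod C h\<rbrakk> \<Longrightarrow> g \<sqsubseteq> a \<longleftrightarrow>
      (\<forall>s w. s \<in> Arr C \<longrightarrow> w \<in> Arr C \<longrightarrow> Dom C s = Dom C w \<longrightarrow> Cod C s = Dom C h \<longrightarrow> Cod C w = Dom C g \<longrightarrow>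
        h \<cdot> s = g \<cdot> w \<longrightarrow> s \<sqsubseteq> k)"
proof -
  define S where "S = Dom C h"
  define Y where "Y = Cod C h"
  have obj: "S \<in> Obj C" "Y \<in> Obj C" and h': "Dom C h = S" "Cod C h = Y" and k': "Cod C k = S"
    using h k by (simp_all add: S_def Y_def)
  obtain W ev where W: "W \<in> Obj C" and ev: "ev \<in> Arr C" "Dom C ev = Pr W S" "Cod C ev = Om"
    and cur: "\<And>X f. \<lbrakk>X \<in> Obj C; f \<in> Arr C; Dom C f = Pr X S; Cod C f = Om\<rbrakk> \<Longrightarrow>
      \<exists>h. h \<in> Arr C \<and> Dom C h = X \<and> Cod C h = W \<and>
        (\<forall>x y. x \<in> Arr C \<longrightarrow> y \<in> Arr C \<longrightarrow> Dom C x = Dom C y \<longrightarrow> Cod C x = X \<longrightarrow> Cod C y = S \<longrightarrow>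
          ev \<cdot> pair (h \<cdot> x) y = f \<cdot> pair x y)"
    and ext: "\<And>g h. \<lbrakk>g \<in> Arr C; h \<in> Arr C; Dom C g = Dom C h; Cod C g = W; Cod C h = W;
      \<And>x y. \<lbrakk>x \<in> Arr C; y \<in> Arr C; Dom C x = Dom C y; Cod C x = Dom C g; Cod C y = S\<rbrakk>
        \<Longrightarrow> ev \<cdot> pair (g \<cdot> x) y = ev \<cdot> pair (h \<cdot> x) y\<rbrakk> \<Longrightarrow> g = h"
    using exponential [OF obj(1) Om_obj] by blast
  define j where "j = pair h (Ide C S)"
  have j: "j \<in> Arr C" "Dom C j = S" "Cod C j = Pr Y S"
    using h h' obj by (simp_all add: j_def)
  have mj: "monic C j"
    by (rule split_monic [of _ "p2 Y S"]) (use h h' obj j in \<open>simp_all add: j_def\<close>)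
  have mjk: "monic C (j \<cdot> k)"
    using monic_Comp [OF mj k(1)] j k' by simp
  \<comment> \<open>\<open>W\<close> is the power object of \<open>S\<close>; \<open>h1\<close> and
    \<open>h2\<close> name the two fibres as its elements, and \<open>a\<close> is the part of
    \<open>Y\<close> where the names agree.\<close>
  obtain h1 where h1: "h1 \<in> Arr C" "Dom C h1 = Y" "Cod C h1 = W"
    "\<And>x y. \<lbrakk>x \<in> Arr C; y \<in> Arr C; Dom C x = Dom C y; Cod C x = Y; Cod C y = S\<rbrakk>
      \<Longrightarrow> ev \<cdot> pair (h1 \<cdot> x) y = chi j \<cdot> pair x y"
    using cur [of Y "chi j"] mj j obj by auto
  obtain h2 where h2: "h2 \<in> Arr C" "Dom C h2 = Y" "Cod C h2 = W"
    "\<And>x y. \<lbrakk>x \<in> Arr C; y \<in> Arr C; Dom C x = Dom C y; Cod C x = Y; Cod C y = S\<rbrakk>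
      \<Longrightarrow> ev \<cdot> pair (h2 \<cdot> x) y = chi (j \<cdot> k) \<cdot> pair x y"
    using cur [of Y "chi (j \<cdot> k)"] mjk j obj k k' by auto
  have j_iff: "pair y s \<sqsubseteq> j \<longleftrightarrow> y = h \<cdot> s" and jk_iff: "pair y s \<sqsubseteq> j \<cdot> k \<longleftrightarrow> y = h \<cdot> s \<and> s \<sqsubseteq> k"
    if ys: "y \<in> Arr C" "s \<in> Arr C" "Dom C y = Dom C s" "Cod C y = Y" "Cod C s = S" for y s
  proof -
    have js: "j \<cdot> t = pair (h \<cdot> t) t" if "t \<in> Arr C" "Cod C t = S" for t
      using that h h' obj by (simp add: j_def)
    show j_iff: "pair y s \<sqsubseteq> j \<longleftrightarrow> y = h \<cdot> s"
    proof
      assume "pair y s \<sqsubseteq> j"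
      then obtain t where t: "t \<in> Arr C" "Dom C t = Dom C s" "Cod C t = S" "j \<cdot> t = pair y s"
        by (rule throughE) (use ys j in simp)
      then have "pair (h \<cdot> t) t = pair y s"
        using js by simp
      then show "y = h \<cdot> s"
        using pair_eq_iff [of "h \<cdot> t" t y s] t(1-3) ys h h' by auto
    next
      assume "y = h \<cdot> s"
      then show "pair y s \<sqsubseteq> j"
        using js [of s] through_Comp [of j s] ys j by simp
    qed
    show "pair y s \<sqsubseteq> j \<cdot> k \<longleftrightarrow> y = h \<cdot> s \<and> s \<sqsubseteq> k"
    proof (cases "y = h \<cdot> s")
      case True
      then show ?thesis
        using js [of s] through_Comp_monic [OF mj, of k s] ys j k k' by simp
    next
      case False
      then have "\<not> pair y s \<sqsubseteq> j \<cdot> k"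
        using j_iff through_trans [of "pair y s" "j \<cdot> k" j] through_Comp [of j k] j k k' mjk by auto
      with False show ?thesis
        by simp
    qed
  qed
  obtain a where a: "monic C a" "Cod C a = Y"
    "\<And>w. \<lbrakk>w \<in> Arr C; Cod C w = Y\<rbrakk> \<Longrightarrow> w \<sqsubseteq> a \<longleftrightarrow> h1 \<cdot> w = h2 \<cdot> w"
    using equalizer [of h1 h2] h1(1-3) h2(1-3) by auto
  show ?thesis
  proof (rule that)
    fix g
    assume "g \<in> Arr C" "Cod C g = Cod C h"
    then have g: "g \<in> Arr C" "Cod C g = Y"
      using h' by simp_all
    show "g \<sqsubseteq> a \<longleftrightarrow>
      (\<forall>s w. s \<in> Arr C \<longrightarrow> w \<in> Arr C \<longrightarrow> Dom C s = Dom C w \<longrightarrow> Cod C s = Dom C h \<longrightarrow> Cod C w = Dom C g \<longrightarrow>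
        h \<cdot> s = g \<cdot> w \<longrightarrow> s \<sqsubseteq> k)" (is "_ \<longleftrightarrow> ?R")
    proof
      assume "g \<sqsubseteq> a"
      then have eq: "h1 \<cdot> g = h2 \<cdot> g"
        using a(3) [OF g] by simp
      show ?R
      proof (intro allI impI)
        fix s w
        assume sw: "s \<in> Arr C" "w \<in> Arr C" "Dom C s = Dom C w" "Cod C s = Dom C h" "Cod C w = Dom C g"
          "h \<cdot> s = g \<cdot> w"
        have "h1 \<cdot> (g \<cdot> w) = h2 \<cdot> (g \<cdot> w)"
          using Comp_eq [OF eq, of w] g h1(1-3) h2(1-3) sw by simp
        then have "chi j \<cdot> pair (g \<cdot> w) s = chi (j \<cdot> k) \<cdot> pair (g \<cdot> w) s"
          using h1(4) [of "g \<cdot> w" s] h2(4) [of "g \<cdot> w" s] g sw h' by simp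
        moreover have "chi j \<cdot> pair (g \<cdot> w) s = tr (Dom C (pair (g \<cdot> w) s))"
          using chi_iff [OF mj, of "pair (g \<cdot> w) s"] j_iff [of "g \<cdot> w" s] g sw h' j by simp
        ultimately show "s \<sqsubseteq> k"
          using chi_iff [OF mjk, of "pair (g \<cdot> w) s"] jk_iff [of "g \<cdot> w" s] g sw h' j k k' by simp
      qed
    next
      assume R: ?R
      have "h1 \<cdot> g = h2 \<cdot> g"
      proof (rule ext)
        fix x y
        assume xy: "x \<in> Arr C" "y \<in> Arr C" "Dom C x = Dom C y" "Cod C x = Dom C (h1 \<cdot> g)" "Cod C y = S"
        then have x: "Cod C x = Dom C g"
          using g h1 by simp
        have "chi j \<cdot> pair (g \<cdot> x) y = chi (j \<cdot> k) \<cdot> pair (g \<cdot> x) y"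
        proof (rule Om_ext)
          fix w
          assume "w \<in> Arr C" "Cod C w = Dom C (chi j \<cdot> pair (g \<cdot> x) y)"
          then have w: "w \<in> Arr C" "Cod C w = Dom C y"
            using xy x g mj j by simp_all
          have "pair (g \<cdot> x) y \<cdot> w \<sqsubseteq> j \<longleftrightarrow> pair (g \<cdot> x) y \<cdot> w \<sqsubseteq> j \<cdot> k"
            using j_iff [of "g \<cdot> (x \<cdot> w)" "y \<cdot> w"] jk_iff [of "g \<cdot> (x \<cdot> w)" "y \<cdot> w"]
              R [rule_format, of "y \<cdot> w" "x \<cdot> w"] w xy x g h' by auto
          then show "(chi j \<cdot> pair (g \<cdot> x) y) \<cdot> w = tr (Dom C w) \<longleftrightarrow>
              (chi (j \<cdot> k) \<cdot> pair (g \<cdot> x) y) \<cdot> w = tr (Dom C w)"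
            using chi_iff [OF mj, of "pair (g \<cdot> x) y \<cdot> w"] chi_iff [OF mjk, of "pair (g \<cdot> x) y \<cdot> w"]
              w xy x g j mj mjk k k' by simp
        qed (use xy x g j mj mjk k k' in simp_all)
        then show "ev \<cdot> pair ((h1 \<cdot> g) \<cdot> x) y = ev \<cdot> pair ((h2 \<cdot> g) \<cdot> x) y"
          using h1 h2 xy x g by simp
      qed (use h1(1-3) h2(1-3) g in simp_all)
      then show "g \<sqsubseteq> a"
        using a(3) [OF g] by simp
    qed
  qed (use a h' in simp_all)
qed

section \<open>Balancedness and strictness of the initial object\<close>

lemma epic_through_monic:
  assumes "epic C e" "monic C m" "Cod C e = Cod C m" "e \<sqsubseteq> m"
  shows "Ide C (Cod C m) \<sqsubseteq> m"
proof -
  \<comment> \<open>An epi that factors through \<open>m\<close> cannot tell the classifier of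
    \<open>m\<close> from the constantly true arrow, so the two are equal.\<close>
  have "chi m \<cdot> e = tr (Cod C m) \<cdot> e"
    using chi_iff [of m e] assms by simp
  then have "chi m = tr (Cod C m)"
    by - (rule epicD [OF assms(1)], use assms in simp_all)
  then show ?thesis
    using chi_iff [of m "Ide C (Cod C m)"] assms by simp
qed

lemma monic_full_inverse:
  assumes "monic C m" "Ide C (Cod C m) \<sqsubseteq> m"
  obtains h where "h \<in> Arr C" "Dom C h = Cod C m" "Cod C h = Dom C m"
    "m \<cdot> h = Ide C (Cod C m)" "h \<cdot> m = Ide C (Dom C m)"
proof -
  obtain h where h: "h \<in> Arr C" "Dom C h = Cod C m" "Cod C h = Dom C m" "m \<cdot> h = Ide C (Cod C m)"
    using assms(2) by (rule throughE) (use assms(1) in simp)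
  have "h \<cdot> m = Ide C (Dom C m)"
    by (rule monicD [OF assms(1)]) (use Comp_eq [OF h(4), of m] assms(1) h(1-3) in simp_all)
  with h that show ?thesis
    by blast
qed

lemma balanced:
  assumes "monic C m" "epic C m"
  shows "isomorphism C m"
proof -
  obtain h where "h \<in> Arr C" "Dom C h = Cod C m" "Cod C h = Dom C m"
    "m \<cdot> h = Ide C (Cod C m)" "h \<cdot> m = Ide C (Dom C m)"
    using monic_full_inverse [OF assms(1)] epic_through_monic [OF assms(2,1)] through_refl assms by auto
  then show ?thesis
    using assms unfolding isomorphism_def by (intro conjI bexI [of _ h]) simp_all
qed

text \<open>Every \<open>a\<close> from \<open>X\<close> to \<open>Z\<close> is
  \<open>a \<cdot> p2 I' X\<close> restricted along \<open>pair f (Ide C X)\<close>. Arrows from the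
  product of \<open>I'\<close> and \<open>X\<close> to \<open>Z\<close> are transposes of arrows
  from \<open>I'\<close> to the exponential \<open>W\<close>, and there is exactly one of
  these.\<close>

lemma strict_initial:
  assumes f: "f \<in> Arr C" and I: "initial C (Cod C f)"
  shows "initial C (Dom C f)"
  unfolding initial_def
proof (intro conjI ballI)
  define X where "X = Dom C f"
  define I' where "I' = Cod C f"
  have X: "X \<in> Obj C" "Dom C f = X" and I': "I' \<in> Obj C" "Cod C f = I'" "initial C I'"
    using f I by (simp_all add: X_def I'_def)
  fix Z
  assume Z: "Z \<in> Obj C"
  obtain W ev where W: "W \<in> Obj C" and ev: "ev \<in> Arr C" "Dom C ev = Pr W X" "Cod C ev = Z"
    and cur: "\<And>V f. \<lbrakk>V \<in> Obj C; f \<in> Arr C; Dom C f = Pr V X; Cod C f = Z\<rbrakk> \<Longrightarrow>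
      \<exists>h. h \<in> Arr C \<and> Dom C h = V \<and> Cod C h = W \<and>
        (\<forall>x y. x \<in> Arr C \<longrightarrow> y \<in> Arr C \<longrightarrow> Dom C x = Dom C y \<longrightarrow> Cod C x = V \<longrightarrow> Cod C y = X \<longrightarrow>
          ev \<cdot> pair (h \<cdot> x) y = f \<cdot> pair x y)"
    by (rule exponential [OF X(1) Z], rule that)
  obtain u where u: "u \<in> Arr C" "Dom C u = I'" "Cod C u = W"
    using initial_arrow [OF I'(3) W] by blast
  have *: "a = ev \<cdot> pair (u \<cdot> f) (Ide C X)" if a: "a \<in> Arr C" "Dom C a = X" "Cod C a = Z" for a
  proof -
    obtain h where h: "h \<in> Arr C" "Dom C h = I'" "Cod C h = W"
      "\<And>x y. \<lbrakk>x \<in> Arr C; y \<in> Arr C; Dom C x = Dom C y; Cod C x = I'; Cod C y = X\<rbrakk> \<Longrightarrow>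
          ev \<cdot> pair (h \<cdot> x) y = (a \<cdot> p2 I' X) \<cdot> pair x y"
      using cur [of I' "a \<cdot> p2 I' X"] a X I' by auto
    have "h = u"
      by (rule initial_eq [OF I'(3)]) (use h u in simp_all)
    then show ?thesis
      using h(4) [of f "Ide C X"] f X I' a by simp
  qed
  show "\<exists>!g. g \<in> Hom C (Dom C f) Z"
  proof (rule ex1I)
    show "ev \<cdot> pair (u \<cdot> f) (Ide C X) \<in> Hom C (Dom C f) Z"
      using ev u f X I' by simp
    show "g = ev \<cdot> pair (u \<cdot> f) (Ide C X)" if "g \<in> Hom C (Dom C f) Z" for g
      by (rule *) (use that X in simp_all)
  qed
qed (use f in simp)

text \<open>By strictness, parallel arrows into an initial object start at an initial object, hence
  agree.\<close>

lemma monic_from_initial: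
  assumes "u \<in> Arr C" "initial C (Dom C u)"
  shows "monic C u"
proof (rule monicI)
  fix a b
  assume ab: "a \<in> Arr C" "b \<in> Arr C" "Dom C a = Dom C b" "Cod C a = Dom C u" "Cod C b = Dom C u"
  then have "initial C (Dom C b)"
    using strict_initial [of b] assms by simp
  then show "a = b"
    by (rule initial_eq) (use ab in simp_all)
qed (rule assms)

lemma through_initial_iff:
  assumes "z \<in> Arr C" "initial C (Dom C z)" "w \<in> Arr C" "Cod C w = Cod C z"
  shows "w \<sqsubseteq> z \<longleftrightarrow> initial C (Dom C w)"
proof
  assume "w \<sqsubseteq> z"
  then obtain h where h: "h \<in> Arr C" "Dom C h = Dom C w" "Cod C h = Dom C z" "z \<cdot> h = w"
    by (rule throughE)
  then show "initial C (Dom C w)"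
    using strict_initial [of h] assms(2) by (simp only:)
next
  assume "initial C (Dom C w)"
  then show "w \<sqsubseteq> z"
    by (rule initial_through) (use assms in simp_all)
qed

end

section \<open>Complements of subobjects\<close>

locale nullstellensatz_topos = elementary_topos +
  assumes nullstellensatz: "NS C"
begin

lemma point_ex:
  assumes "X \<in> Obj C" "\<not> initial C X"
  obtains x where "x \<in> Arr C" "Dom C x = one" "Cod C x = X"
proof -
  obtain T x where x: "terminal C T" "x \<in> Arr C" "Dom C x = T" "Cod C x = X"
    using nullstellensatz assms unfolding NS_def is_point_def by auto
  obtain u where "u \<in> Arr C" "Dom C u = one" "Cod C u = T"
    using terminal_arrow [OF x(1) one_obj] by blast
  then show ?thesis
    using that [of "x \<cdot> u"] x by simp
qed

text \<open>Without an initial object (NS) would give every object a point, including every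
  subobject of \<open>one\<close>. A pointed subobject of \<open>one\<close> is everything, so the
  equalizer of any two points would be full, and \<open>one\<close> would be initial after
  all.\<close>

lemma initial_ex: "\<exists>I. initial C I"
proof (rule ccontr)
  assume no: "\<not> (\<exists>I. initial C I)"
  have "initial C one"
    unfolding initial_def
  proof (intro conjI ballI)
    fix X
    assume "X \<in> Obj C"
    then obtain x where x: "x \<in> Arr C" "Dom C x = one" "Cod C x = X"
      using point_ex no by blast
    show "\<exists>!f. f \<in> Hom C one X"
    proof (rule ex1I)
      show "x \<in> Hom C one X"
        using x by simp
      fix y
      assume y: "y \<in> Hom C one X"
      show "y = x"
      proof (rule equal_if_through_all)
        fix e
        assume e: "monic C e" "Cod C e = Dom C y"
        obtain z where z: "z \<in> Arr C" "Dom C z = one" "Cod C z = Dom C e"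
          using point_ex [of "Dom C e"] no e by auto
        have "e \<cdot> z = Ide C one"
          by (rule one_Ide) (use z e y in simp_all)
        then show "Ide C (Dom C y) \<sqsubseteq> e"
          using through_Comp [of e z] z e y by simp
      qed (use x y in simp_all)
    qed
  qed simp
  with no show False
    by blast
qed

lemma zero_subobject:
  assumes "Y \<in> Obj C"
  obtains z where "monic C z" "Cod C z = Y" "initial C (Dom C z)"
proof -
  obtain I where I: "initial C I"
    using initial_ex by blast
  then obtain u where "u \<in> Arr C" "Dom C u = I" "Cod C u = Y"
    using initial_arrow assms by blast
  with I that [of u] monic_from_initial [of u] show ?thesis
    by simp
qed

section \<open>The calculus of complementary subobjects\<close>

lemma complements_monic:
  assumes "complements C S e v"
  shows "monic C e" "Cod C e = S" "monic C v" "Cod C v = S"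
  using assms by (simp_all add: complements_def subobject_iff)

lemma complements_top:
  assumes c: "complements C S e v" and k: "monic C k" "Cod C k = S" "e \<sqsubseteq> k" "v \<sqsubseteq> k"
  shows "Ide C S \<sqsubseteq> k"
proof -
  have "S \<in> Obj C"
    using k Dom_Cod_obj(2) [of k] by simp
  then show ?thesis
    using c [unfolded complements_def subobject_iff, THEN conjunct2, THEN conjunct2, THEN conjunct2,
        rule_format, of k "Ide C S"] k monic_Ide [of S] by simp
qed

text \<open>The definition bounds only subobjects below both \<open>e\<close> and \<open>v\<close>.
  Their meet lies in the zero subobject, and strictness passes this on to any \<open>w\<close> that
  factors through the meet.\<close>

lemma complements_disjoint:
  assumes c: "complements C S e v" and w: "w \<in> Arr C" "Cod C w = S" "w \<sqsubseteq> e" "w \<sqsubseteq> v"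
  shows "initial C (Dom C w)"
proof -
  note ev = complements_monic [OF c]
  obtain k where k: "monic C k" "Cod C k = S"
    "\<And>w. \<lbrakk>w \<in> Arr C; Cod C w = S\<rbrakk> \<Longrightarrow> w \<sqsubseteq> k \<longleftrightarrow> w \<sqsubseteq> e \<and> w \<sqsubseteq> v"
    using meet [of e v] ev by auto
  have "S \<in> Obj C"
    using ev Dom_Cod_obj(2) [of e] by simp
  then obtain z where z: "monic C z" "Cod C z = S" "initial C (Dom C z)"
    using zero_subobject by blast
  have "k \<sqsubseteq> e" "k \<sqsubseteq> v"
    using k(3) [of k] k(1,2) through_refl by simp_all
  then have "k \<sqsubseteq> z"
    using c k(1,2) z unfolding complements_def subobject_iff by blast
  moreover have "w \<sqsubseteq> k"
    using k(3) w by simp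
  ultimately have "w \<sqsubseteq> z"
    using through_trans [of w k z] k(1) z(1) by simp
  with through_initial_iff [of z w] z w show ?thesis
    by simp
qed

text \<open>Unions of complementary subobjects are stable under pullback, because pulling back subobjects
  along \<^term>\<open>h\<close> has a right adjoint.\<close>

lemma complements_cover:
  assumes c: "complements C S e v" and h: "h \<in> Arr C" "Cod C h = S" and k: "monic C k" "Cod C k = Dom C h"
    and e: "\<And>s. \<lbrakk>s \<in> Arr C; Cod C s = Dom C h; h \<cdot> s \<sqsubseteq> e\<rbrakk> \<Longrightarrow> s \<sqsubseteq> k"
    and v: "\<And>s. \<lbrakk>s \<in> Arr C; Cod C s = Dom C h; h \<cdot> s \<sqsubseteq> v\<rbrakk> \<Longrightarrow> s \<sqsubseteq> k"
  shows "Ide C (Dom C h) \<sqsubseteq> k"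
proof -
  note ev = complements_monic [OF c]
  obtain a where a: "monic C a" "Cod C a = Cod C h"
    and a_iff: "\<And>g. \<lbrakk>g \<in> Arr C; Cod C g = Cod C h\<rbrakk> \<Longrightarrow> g \<sqsubseteq> a \<longleftrightarrow>
      (\<forall>s w. s \<in> Arr C \<longrightarrow> w \<in> Arr C \<longrightarrow> Dom C s = Dom C w \<longrightarrow> Cod C s = Dom C h \<longrightarrow> Cod C w = Dom C g \<longrightarrow>
        h \<cdot> s = g \<cdot> w \<longrightarrow> s \<sqsubseteq> k)"
    using universal_image [OF h(1) k] by blast
  have "m \<sqsubseteq> a" if m: "monic C m" "Cod C m = S"
    and *: "\<And>s. \<lbrakk>s \<in> Arr C; Cod C s = Dom C h; h \<cdot> s \<sqsubseteq> m\<rbrakk> \<Longrightarrow> s \<sqsubseteq> k" for m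
  proof (rule a_iff [THEN iffD2])
    show "\<forall>s w. s \<in> Arr C \<longrightarrow> w \<in> Arr C \<longrightarrow> Dom C s = Dom C w \<longrightarrow> Cod C s = Dom C h \<longrightarrow> Cod C w = Dom C m \<longrightarrow>
        h \<cdot> s = m \<cdot> w \<longrightarrow> s \<sqsubseteq> k"
      using * through_Comp m(1) by simp
  qed (use m h in simp_all)
  then have "e \<sqsubseteq> a" "v \<sqsubseteq> a"
    using ev e v by blast+
  then have "Ide C S \<sqsubseteq> a"
    using complements_top [OF c] a h(2) by simp
  moreover have "S \<in> Obj C"
    using h Dom_Cod_obj(2) [of h] by simp
  ultimately show ?thesis
    using a_iff [of "Ide C S", THEN iffD1, rule_format, of "Ide C (Dom C h)" h] h
    by simp
qed

lemma complementsI: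
  assumes "monic C e" "monic C v" "Cod C e = S" "Cod C v = S"
    and disj: "\<And>w. \<lbrakk>w \<in> Arr C; Cod C w = S; w \<sqsubseteq> e; w \<sqsubseteq> v\<rbrakk> \<Longrightarrow> initial C (Dom C w)"
    and cov: "\<And>k. \<lbrakk>monic C k; Cod C k = S; e \<sqsubseteq> k; v \<sqsubseteq> k\<rbrakk> \<Longrightarrow> Ide C S \<sqsubseteq> k"
  shows "complements C S e v"
  unfolding complements_def subobject_iff
proof (intro conjI allI impI)
  show "k \<sqsubseteq> l" if "(monic C k \<and> Cod C k = S) \<and> k \<sqsubseteq> e \<and> k \<sqsubseteq> v" "monic C l \<and> Cod C l = S" for k l
    using initial_through [of k l] disj [of k] that by simp
  show "l \<sqsubseteq> k" if "(monic C k \<and> Cod C k = S) \<and> e \<sqsubseteq> k \<and> v \<sqsubseteq> k" "monic C l \<and> Cod C l = S" for k l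
    using through_all [of l k] cov [of k] that by simp
qed (use assms in auto)

lemma complements_cong:
  assumes c: "complements C S e v" and "monic C e'" "Cod C e' = S" "e \<sqsubseteq> e'" "e' \<sqsubseteq> e"
  shows "complements C S e' v"
proof (rule complementsI)
  note ev = complements_monic [OF c]
  show "initial C (Dom C w)" if "w \<in> Arr C" "Cod C w = S" "w \<sqsubseteq> e'" "w \<sqsubseteq> v" for w
    using complements_disjoint [OF c, of w] through_trans [of w e' e] that assms ev by simp
  show "Ide C S \<sqsubseteq> k" if "monic C k" "Cod C k = S" "e' \<sqsubseteq> k" "v \<sqsubseteq> k" for k
  proof -
    have "e \<sqsubseteq> k"
      using through_trans [of e e' k] that assms by simp
    then show ?thesis
      using complements_top [OF c] that by simp
  qed
qed (use complements_monic [OF c] assms in simp_all)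

text \<open>Disjointness pulls back at once; that the preimages still cover is the content of
  \<open>complements_cover\<close>.\<close>

lemma complements_preimage:
  assumes c: "complements C S e v" and h: "h \<in> Arr C" "Cod C h = S"
  obtains e' v' where "complements C (Dom C h) e' v'"
    "\<And>w. \<lbrakk>w \<in> Arr C; Cod C w = Dom C h\<rbrakk> \<Longrightarrow> w \<sqsubseteq> e' \<longleftrightarrow> h \<cdot> w \<sqsubseteq> e"
    "\<And>w. \<lbrakk>w \<in> Arr C; Cod C w = Dom C h\<rbrakk> \<Longrightarrow> w \<sqsubseteq> v' \<longleftrightarrow> h \<cdot> w \<sqsubseteq> v"
proof -
  note ev = complements_monic [OF c]
  obtain e' where e': "monic C e'" "Cod C e' = Dom C h"
    and e_iff: "\<And>w. \<lbrakk>w \<in> Arr C; Cod C w = Dom C h\<rbrakk> \<Longrightarrow> w \<sqsubseteq> e' \<longleftrightarrow> h \<cdot> w \<sqsubseteq> e"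
    using preimage [of h e] h ev by auto
  obtain v' where v': "monic C v'" "Cod C v' = Dom C h"
    and v_iff: "\<And>w. \<lbrakk>w \<in> Arr C; Cod C w = Dom C h\<rbrakk> \<Longrightarrow> w \<sqsubseteq> v' \<longleftrightarrow> h \<cdot> w \<sqsubseteq> v"
    using preimage [of h v] h ev by auto
  have "complements C (Dom C h) e' v'"
  proof (rule complementsI)
    show "initial C (Dom C w)" if "w \<in> Arr C" "Cod C w = Dom C h" "w \<sqsubseteq> e'" "w \<sqsubseteq> v'" for w
      using complements_disjoint [OF c, of "h \<cdot> w"] e_iff v_iff that h by simp
    show "Ide C (Dom C h) \<sqsubseteq> k" if k: "monic C k" "Cod C k = Dom C h" "e' \<sqsubseteq> k" "v' \<sqsubseteq> k" for k
      by (rule complements_cover [OF c h k(1,2)])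
        (use e_iff v_iff k e' v' through_trans in \<open>metis monic_arr\<close>)+
  qed (use e' v' in simp_all)
  then show ?thesis
    using that e_iff v_iff by blast
qed

text \<open>The pseudo-complement is universal quantification along \<open>e\<close>, applied to the
  zero subobject of \<open>Dom C e\<close>.\<close>

lemma negation:
  assumes e: "monic C e"
  obtains v where "monic C v" "Cod C v = Cod C e"
    "\<And>w. \<lbrakk>w \<in> Arr C; Cod C w = Cod C e\<rbrakk> \<Longrightarrow> w \<sqsubseteq> v \<longleftrightarrow>
      (\<forall>u. u \<in> Arr C \<longrightarrow> Cod C u = Dom C w \<longrightarrow> w \<cdot> u \<sqsubseteq> e \<longrightarrow> initial C (Dom C u))"
proof -
  obtain z where z: "monic C z" "Cod C z = Dom C e" "initial C (Dom C z)"
    using zero_subobject [of "Dom C e"] e by auto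
  obtain v where v: "monic C v" "Cod C v = Cod C e"
    and v_iff: "\<And>g. \<lbrakk>g \<in> Arr C; Cod C g = Cod C e\<rbrakk> \<Longrightarrow> g \<sqsubseteq> v \<longleftrightarrow>
      (\<forall>s w. s \<in> Arr C \<longrightarrow> w \<in> Arr C \<longrightarrow> Dom C s = Dom C w \<longrightarrow> Cod C s = Dom C e \<longrightarrow> Cod C w = Dom C g \<longrightarrow>
        e \<cdot> s = g \<cdot> w \<longrightarrow> s \<sqsubseteq> z)"
    using universal_image [of e z] e z by auto
  show ?thesis
  proof (rule that [OF v])
    fix w
    assume w: "w \<in> Arr C" "Cod C w = Cod C e"
    show "w \<sqsubseteq> v \<longleftrightarrow>
      (\<forall>u. u \<in> Arr C \<longrightarrow> Cod C u = Dom C w \<longrightarrow> w \<cdot> u \<sqsubseteq> e \<longrightarrow> initial C (Dom C u))"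
      unfolding v_iff [OF w]
    proof (intro iffI allI impI)
      fix u
      assume *: "\<forall>s u. s \<in> Arr C \<longrightarrow> u \<in> Arr C \<longrightarrow> Dom C s = Dom C u \<longrightarrow> Cod C s = Dom C e \<longrightarrow> Cod C u = Dom C w \<longrightarrow>
        e \<cdot> s = w \<cdot> u \<longrightarrow> s \<sqsubseteq> z"
        and u: "u \<in> Arr C" "Cod C u = Dom C w" "w \<cdot> u \<sqsubseteq> e"
      from u(3) obtain s where s: "s \<in> Arr C" "Dom C s = Dom C u" "Cod C s = Dom C e" "e \<cdot> s = w \<cdot> u"
        by (rule throughE) (use u w in simp)
      with * u have "s \<sqsubseteq> z"
        by blast
      with through_initial_iff [of z s] s z show "initial C (Dom C u)"
        by simp
    next
      fix s u
      assume *: "\<forall>u. u \<in> Arr C \<longrightarrow> Cod C u = Dom C w \<longrightarrow> w \<cdot> u \<sqsubseteq> e \<longrightarrow> initial C (Dom C u)"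
        and su: "s \<in> Arr C" "u \<in> Arr C" "Dom C s = Dom C u" "Cod C s = Dom C e" "Cod C u = Dom C w"
        "e \<cdot> s = w \<cdot> u"
      have "w \<cdot> u \<sqsubseteq> e"
        using through_Comp [of e s] su e by simp
      with * su have "initial C (Dom C s)"
        by simp
      with through_initial_iff [of z s] su z show "s \<sqsubseteq> z"
        by simp
    qed
  qed
qed

text \<open>The pseudo-complement is disjoint from \<open>e\<close> in any case, so only the
  covering condition remains. The inner premise says elementwise that \<open>k\<close> contains the
  pseudo-complement, so that callers need not name it.\<close>

lemma complemented_negI:
  assumes e: "monic C e" "Cod C e = S"
    and cov: "\<And>k. \<lbrakk>monic C k; Cod C k = S; e \<sqsubseteq> k;
      \<And>w. \<lbrakk>w \<in> Arr C; Cod C w = S; \<And>u. \<lbrakk>u \<in> Arr C; Cod C u = Dom C w; w \<cdot> u \<sqsubseteq> e\<rbrakk> \<Longrightarrow> initial C (Dom C u)\<rbrakk>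
        \<Longrightarrow> w \<sqsubseteq> k\<rbrakk> \<Longrightarrow> Ide C S \<sqsubseteq> k"
  shows "complemented C e"
proof -
  obtain v where v: "monic C v" "Cod C v = Cod C e"
    and v_iff: "\<And>w. \<lbrakk>w \<in> Arr C; Cod C w = Cod C e\<rbrakk> \<Longrightarrow> w \<sqsubseteq> v \<longleftrightarrow>
      (\<forall>u. u \<in> Arr C \<longrightarrow> Cod C u = Dom C w \<longrightarrow> w \<cdot> u \<sqsubseteq> e \<longrightarrow> initial C (Dom C u))"
    using negation [OF e(1)] by blast
  have "complements C S e v"
  proof (rule complementsI)
    fix w
    assume w: "w \<in> Arr C" "Cod C w = S" "w \<sqsubseteq> e" "w \<sqsubseteq> v"
    show "initial C (Dom C w)"
      using v_iff [of w, THEN iffD1, rule_format, of "Ide C (Dom C w)"] w e by simp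
  next
    fix k
    assume k: "monic C k" "Cod C k = S" "e \<sqsubseteq> k" "v \<sqsubseteq> k"
    show "Ide C S \<sqsubseteq> k"
    proof (rule cov)
      fix w
      assume w: "w \<in> Arr C" "Cod C w = S"
        "\<And>u. \<lbrakk>u \<in> Arr C; Cod C u = Dom C w; w \<cdot> u \<sqsubseteq> e\<rbrakk> \<Longrightarrow> initial C (Dom C u)"
      then have "w \<sqsubseteq> v"
        using v_iff [of w] e by simp
      then show "w \<sqsubseteq> k"
        by (rule through_trans) (use k v in simp_all)
    qed (use k in simp_all)
  qed (use e v in simp_all)
  then show ?thesis
    using e by (auto simp: complemented_def)
qed

section \<open>Decidability expressed by complemented equalizers\<close>

lemma complemented_equalizer:
  assumes X: "decidable C X" and ab: "a \<in> Arr C" "b \<in> Arr C" "Dom C a = S" "Dom C b = S" "Cod C a = X" "Cod C b = X"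
  obtains e v where "complements C S e v"
    "\<And>w. \<lbrakk>w \<in> Arr C; Cod C w = S\<rbrakk> \<Longrightarrow> w \<sqsubseteq> e \<longleftrightarrow> a \<cdot> w = b \<cdot> w"
proof -
  obtain P p q d n where P: "is_product C X X P p q" and d: "d \<in> Arr C" "Dom C d = X" "Cod C d = P"
    "p \<cdot> d = Ide C X" "q \<cdot> d = Ide C X" and n: "complements C P d n"
    using X unfolding decidable_def complemented_def by auto
  note pq = is_productD [OF P]
  \<comment> \<open>The equalizer of \<open>a\<close> and \<open>b\<close> is the preimage of the
    diagonal under \<open>h\<close>, the arrow with components \<open>a\<close> and
    \<open>b\<close>; preimages of complemented subobjects are complemented.\<close>
  obtain h where h: "h \<in> Arr C" "Dom C h = S" "Cod C h = P" "p \<cdot> h = a" "q \<cdot> h = b"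
    using is_product_pair [OF P, of a b] ab by auto
  obtain e v where ev: "complements C (Dom C h) e v"
    and e_iff: "\<And>w. \<lbrakk>w \<in> Arr C; Cod C w = Dom C h\<rbrakk> \<Longrightarrow> w \<sqsubseteq> e \<longleftrightarrow> h \<cdot> w \<sqsubseteq> d"
    by (rule complements_preimage [OF n h(1,3)], rule that)
  note ev = ev [unfolded h(2)] and e_iff = e_iff [unfolded h(2)]
  show ?thesis
  proof (rule that [OF ev])
    fix w
    assume w: "w \<in> Arr C" "Cod C w = S"
    have hw: "p \<cdot> (h \<cdot> w) = a \<cdot> w" "q \<cdot> (h \<cdot> w) = b \<cdot> w"
      using Comp_eq [OF h(4), of w] Comp_eq [OF h(5), of w] w h(1-3) pq by simp_all
    have dt: "p \<cdot> (d \<cdot> t) = t" "q \<cdot> (d \<cdot> t) = t" if "t \<in> Arr C" "Cod C t = X" for t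
      using Comp_eq [OF d(4), of t] Comp_eq [OF d(5), of t] that d(1-3) pq by simp_all
    show "w \<sqsubseteq> e \<longleftrightarrow> a \<cdot> w = b \<cdot> w"
      unfolding e_iff [OF w]
    proof
      assume "h \<cdot> w \<sqsubseteq> d"
      then obtain t where t: "t \<in> Arr C" "Cod C t = X" "d \<cdot> t = h \<cdot> w"
        by (rule throughE) (use d in simp)
      then show "a \<cdot> w = b \<cdot> w"
        using dt [of t] hw by simp
    next
      assume eq: "a \<cdot> w = b \<cdot> w"
      have "d \<cdot> (a \<cdot> w) = h \<cdot> w"
        by (rule is_product_eq [OF P]) (use dt [of "a \<cdot> w"] hw eq d(1-3) h(1-3) ab w in simp_all)
      then show "h \<cdot> w \<sqsubseteq> d"
        using through_Comp [of d "a \<cdot> w"] d(1-3) ab w by simp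
    qed
  qed
qed

text \<open>The diagonal and the equalizer of the two projections are the same subobject; the
  equalizer is the form whose elements are easy to describe.\<close>

lemma decidableI:
  assumes X: "X \<in> Obj C" and e: "complemented C e" "monic C e" "Cod C e = Pr X X"
    and e_iff: "\<And>w. \<lbrakk>w \<in> Arr C; Cod C w = Pr X X\<rbrakk> \<Longrightarrow> w \<sqsubseteq> e \<longleftrightarrow> p1 X X \<cdot> w = p2 X X \<cdot> w"
  shows "decidable C X"
proof -
  define d where "d = pair (Ide C X) (Ide C X)"
  have d: "d \<in> Arr C" "Dom C d = X" "Cod C d = Pr X X" "p1 X X \<cdot> d = Ide C X" "p2 X X \<cdot> d = Ide C X"
    using X by (simp_all add: d_def)
  have "monic C d"
    by (rule split_monic [of _ "p1 X X"]) (use d X in simp_all)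
  moreover have "d \<sqsubseteq> e"
    using e_iff [of d] d by simp
  moreover have "e \<sqsubseteq> d"
  proof -
    have "p1 X X \<cdot> e = p2 X X \<cdot> e"
      using e_iff [of e] e through_refl [of e] by simp
    then have "d \<cdot> (p1 X X \<cdot> e) = e"
      using pair_eta [of e X X] X e by (simp add: d_def)
    then show ?thesis
      using through_Comp [of d "p1 X X \<cdot> e"] d(1-3) X e by simp
  qed
  ultimately have "complemented C d"
    using e(1,3) complements_cong [of "Pr X X" e _ d] d(3) unfolding complemented_def by auto
  then show ?thesis
    using X d Pr_is_product [OF X X] unfolding decidable_def by auto
qed

section \<open>Decidable objects and points\<close>

text \<open>By strictness along the arrow to \<open>one\<close>. Arguments that find a point in an
  empty object end here.\<close>

lemma degenerate: "\<lbrakk>initial C one; X \<in> Obj C\<rbrakk> \<Longrightarrow> initial C X"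
  using strict_initial [of "bang X"] by simp

lemma is_pointE:
  assumes "is_point C X x"
  obtains T u where "terminal C T" "x \<in> Arr C" "Dom C x = T" "Cod C x = X"
    "u \<in> Arr C" "Dom C u = T" "Cod C u = one"
  using assms terminal_obj bang_arr unfolding is_point_def Hom_iff by blast

lemma is_pointI: "\<lbrakk>x \<in> Arr C; Dom C x = one; Cod C x = X\<rbrakk> \<Longrightarrow> is_point C X x"
  using one_terminal unfolding is_point_def by auto

text \<open>(NS) makes the topos two-valued: a subobject of \<open>one\<close> that is not initial
  has a point, and this point is a section of it.\<close>

lemma truth_value_cases:
  assumes r: "monic C r" "Cod C r = one"
  obtains "initial C (Dom C r)" | "Ide C one \<sqsubseteq> r"
proof (cases "initial C (Dom C r)")
  case False
  then obtain y where y: "y \<in> Arr C" "Dom C y = one" "Cod C y = Dom C r"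
    using point_ex [of "Dom C r"] r by auto
  have "r \<cdot> y = Ide C one"
    by (rule one_Ide) (use r y in simp_all)
  then show ?thesis
    using that(2) through_Comp [of r y] r y by simp
qed (use that in blast)

lemma complements_sym:
  assumes c: "complements C S e v"
  shows "complements C S v e"
  by (rule complementsI)
    (use complements_monic [OF c] complements_disjoint [OF c] complements_top [OF c] in simp_all)

text \<open>Complementary subobjects are jointly epic: the equalizer of \<open>h\<close> and
  \<open>h'\<close> contains both, hence their join.\<close>

lemma complements_ext:
  assumes c: "complements C S e v" and h: "h \<in> Arr C" "Dom C h = S" and h': "h' \<in> Arr C" "Dom C h' = S"
    and eq: "Cod C h = Cod C h'" "h \<cdot> e = h' \<cdot> e" "h \<cdot> v = h' \<cdot> v"
  shows "h = h'"
proof (rule equal_if_through_all)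
  note ev = complements_monic [OF c]
  fix k
  assume k: "monic C k" "Cod C k = Dom C h"
    and k_iff: "\<And>w. \<lbrakk>w \<in> Arr C; Cod C w = Dom C h\<rbrakk> \<Longrightarrow> w \<sqsubseteq> k \<longleftrightarrow> h \<cdot> w = h' \<cdot> w"
  then show "Ide C (Dom C h) \<sqsubseteq> k"
    using complements_top [OF c, of k] k_iff [of e] k_iff [of v] ev h eq by simp
qed (use assms in simp_all)

text \<open>Pull the cover back along \<open>x\<close> to \<open>one\<close>. By two-valuedness the
  preimage of \<open>e\<close> is full or empty, and if it is empty the preimage of \<open>v\<close>
  has to cover alone.\<close>

lemma point_complements:
  assumes c: "complements C S e v" and x: "x \<in> Arr C" "Dom C x = one" "Cod C x = S"
  shows "x \<sqsubseteq> e \<or> x \<sqsubseteq> v"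
proof -
  note ev = complements_monic [OF c]
  obtain r where r: "monic C r" "Cod C r = one"
    and r_iff: "\<And>w. \<lbrakk>w \<in> Arr C; Cod C w = one\<rbrakk> \<Longrightarrow> w \<sqsubseteq> r \<longleftrightarrow> x \<cdot> w \<sqsubseteq> e"
    by (rule preimage [of x e, unfolded x(2)]) (use x ev that in simp_all)
  obtain k where k: "monic C k" "Cod C k = one"
    and k_iff: "\<And>w. \<lbrakk>w \<in> Arr C; Cod C w = one\<rbrakk> \<Longrightarrow> w \<sqsubseteq> k \<longleftrightarrow> x \<cdot> w \<sqsubseteq> v"
    by (rule preimage [of x v, unfolded x(2)]) (use x ev that in simp_all)
  show ?thesis
  proof (rule truth_value_cases [OF r])
    assume zero: "initial C (Dom C r)"
    have "Ide C (Dom C x) \<sqsubseteq> k"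
    proof (rule complements_cover [OF c])
      fix s
      assume s: "s \<in> Arr C" "Cod C s = Dom C x" "x \<cdot> s \<sqsubseteq> e"
      then have "s \<sqsubseteq> r"
        using r_iff x by simp
      then have "initial C (Dom C s)"
        using through_initial_iff [of r s] zero r s x by simp
      then show "s \<sqsubseteq> k"
        by (rule initial_through) (use s k x in simp_all)
    qed (use x k k_iff in simp_all)
    then show ?thesis
      using k_iff [of "Ide C one"] x by simp
  next
    assume "Ide C one \<sqsubseteq> r"
    then show ?thesis
      using r_iff [of "Ide C one"] x by simp
  qed
qed

lemma decidable_eqI:
  assumes X: "decidable C X" and ab: "a \<in> Arr C" "b \<in> Arr C" "Dom C a = Dom C b" "Cod C a = X" "Cod C b = X"
    and pts: "\<And>x. \<lbrakk>x \<in> Arr C; Dom C x = one; Cod C x = Dom C a\<rbrakk> \<Longrightarrow> a \<cdot> x = b \<cdot> x"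
  shows "a = b"
proof -
  obtain e v where c: "complements C (Dom C a) e v"
    and e_iff: "\<And>w. \<lbrakk>w \<in> Arr C; Cod C w = Dom C a\<rbrakk> \<Longrightarrow> w \<sqsubseteq> e \<longleftrightarrow> a \<cdot> w = b \<cdot> w"
    by (rule complemented_equalizer [OF X ab(1,2) refl ab(3)[symmetric] ab(4,5)], rule that)
  note ev = complements_monic [OF c]
  have "initial C (Dom C v)"
  proof (rule ccontr)
    assume no: "\<not> initial C (Dom C v)"
    then obtain y where y: "y \<in> Arr C" "Dom C y = one" "Cod C y = Dom C v"
      using point_ex [of "Dom C v"] ev by auto
    have "v \<cdot> y \<sqsubseteq> e" "v \<cdot> y \<sqsubseteq> v"
      using e_iff [of "v \<cdot> y"] pts [of "v \<cdot> y"] y ev(3,4) through_Comp [of v y] by simp_all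
    then have "initial C one"
      using complements_disjoint [OF c, of "v \<cdot> y"] y ev(3,4) by simp
    with no degenerate ev(3) show False
      by simp
  qed
  then have "v \<sqsubseteq> e"
    by (rule initial_through) (use ev in simp_all)
  then have "Ide C (Dom C a) \<sqsubseteq> e"
    using complements_top [OF c] ev through_refl [of e] by simp
  then show ?thesis
    using e_iff [of "Ide C (Dom C a)"] ab by simp
qed

text \<open>The arrows to be compared end in \<open>Dom C m\<close>, and its decidability reduces
  their equality to points. Codomains such as the power object in \<open>codiscrete\<close> are
  thereby included.\<close>

lemma monic_if_injective_on_points:
  assumes m: "m \<in> Arr C" "decidable C (Dom C m)"
    and inj: "\<And>x y. \<lbrakk>x \<in> Arr C; y \<in> Arr C; Dom C x = one; Dom C y = one; Cod C x = Dom C m; Cod C y = Dom C m;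
      m \<cdot> x = m \<cdot> y\<rbrakk> \<Longrightarrow> x = y"
  shows "monic C m"
proof (rule monicI)
  fix a b
  assume ab: "a \<in> Arr C" "b \<in> Arr C" "Dom C a = Dom C b" "Cod C a = Dom C m" "Cod C b = Dom C m"
    "m \<cdot> a = m \<cdot> b"
  show "a = b"
  proof (rule decidable_eqI [OF m(2)])
    fix x
    assume x: "x \<in> Arr C" "Dom C x = one" "Cod C x = Dom C a"
    show "a \<cdot> x = b \<cdot> x"
      by (rule inj) (use Comp_eq [OF ab(6), of x] x ab m in simp_all)
  qed (use ab in simp_all)
qed (rule m)

section \<open>Closure properties of decidable objects\<close>

lemma decidable_obj: "decidable C X \<Longrightarrow> X \<in> Obj C"
  by (simp add: decidable_def)

text \<open>Since \<open>m\<close> is monic, the diagonal of its domain is the equalizer of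
  \<open>m \<cdot> p1\<close> and \<open>m \<cdot> p2\<close>, two arrows into a decidable
  object.\<close>

lemma decidable_subobject:
  assumes m: "monic C m" and X: "decidable C (Cod C m)"
  shows "decidable C (Dom C m)"
proof -
  define U where "U = Dom C m"
  have U: "U \<in> Obj C" "Dom C m = U"
    using m by (simp_all add: U_def)
  obtain e v where c: "complements C (Pr U U) e v"
    and e_iff: "\<And>w. \<lbrakk>w \<in> Arr C; Cod C w = Pr U U\<rbrakk> \<Longrightarrow> w \<sqsubseteq> e \<longleftrightarrow> (m \<cdot> p1 U U) \<cdot> w = (m \<cdot> p2 U U) \<cdot> w"
    by (rule complemented_equalizer [OF X, of "m \<cdot> p1 U U" "m \<cdot> p2 U U" "Pr U U"])
      (use m U that in simp_all)
  have "decidable C U"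
  proof (rule decidableI)
    show "complemented C e"
      using c complements_monic [OF c] by (auto simp: complemented_def)
    show "w \<sqsubseteq> e \<longleftrightarrow> p1 U U \<cdot> w = p2 U U \<cdot> w" if w: "w \<in> Arr C" "Cod C w = Pr U U" for w
      using e_iff [OF w] monicD [OF m, of "p1 U U \<cdot> w" "p2 U U \<cdot> w"] w U m by auto
  qed (use U complements_monic [OF c] in simp_all)
  then show ?thesis
    using U by simp
qed

lemma complements_full_zero:
  assumes "monic C z" "initial C (Dom C z)"
  shows "complements C (Cod C z) (Ide C (Cod C z)) z"
proof (rule complementsI)
  show "initial C (Dom C w)" if "w \<in> Arr C" "Cod C w = Cod C z" "w \<sqsubseteq> z" for w
    using through_initial_iff [of z w] that assms by simp
qed (use assms monic_Ide in simp_all)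

lemma decidable_terminal:
  assumes T: "terminal C T"
  shows "decidable C T"
proof -
  have T': "T \<in> Obj C"
    by (rule terminal_obj [OF T])
  then obtain z where "monic C z" "Cod C z = Pr T T" "initial C (Dom C z)"
    using zero_subobject [of "Pr T T"] by auto
  then have c: "complements C (Pr T T) (Ide C (Pr T T)) z"
    using complements_full_zero [of z] by simp
  show ?thesis
  proof (rule decidableI)
    show "complemented C (Ide C (Pr T T))"
      using c T' by (auto simp: complemented_def)
    fix w
    assume w: "w \<in> Arr C" "Cod C w = Pr T T"
    have "p1 T T \<cdot> w = p2 T T \<cdot> w"
      by (rule terminal_eq [OF T]) (use w T' in simp_all)
    moreover have "w \<sqsubseteq> Ide C (Pr T T)"
      using through_Comp [of "Ide C (Pr T T)" w] w T' by simp
    ultimately show "w \<sqsubseteq> Ide C (Pr T T) \<longleftrightarrow> p1 T T \<cdot> w = p2 T T \<cdot> w"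
      by simp
  qed (use T' monic_Ide in simp_all)
qed

lemma decidable_one: "decidable C one"
  by (rule decidable_terminal [OF one_terminal])

text \<open>The diagonal \<open>e\<close> is the meet of \<open>e1\<close> and \<open>e2\<close>, on
  which the first and the second coordinates agree. Its complement is the union of \<open>v1\<close>
  and \<open>v2\<close>; the union is never formed, since \<open>complemented_negI\<close> only asks
  that each of the two avoid \<open>e\<close>.\<close>

lemma decidable_Pr:
  assumes X: "decidable C X" and Y: "decidable C Y"
  shows "decidable C (Pr X Y)"
proof -
  note obj [simp] = decidable_obj [OF X] decidable_obj [OF Y]
  define Q where "Q = Pr X Y"
  have Q [simp]: "Q \<in> Obj C"
    by (simp add: Q_def)
  have proj [simp]: "p1 X Y \<in> Arr C" "Dom C (p1 X Y) = Q" "Cod C (p1 X Y) = X"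
    "p2 X Y \<in> Arr C" "Dom C (p2 X Y) = Q" "Cod C (p2 X Y) = Y"
    by (simp_all add: Q_def)
  define S where "S = Pr Q Q"
  have proj' [simp]: "S \<in> Obj C" "p1 Q Q \<in> Arr C" "Dom C (p1 Q Q) = S" "Cod C (p1 Q Q) = Q"
    "p2 Q Q \<in> Arr C" "Dom C (p2 Q Q) = S" "Cod C (p2 Q Q) = Q"
    by (simp_all add: S_def)
  obtain e where e: "monic C e" "Cod C e = S"
    and e_iff: "\<And>w. \<lbrakk>w \<in> Arr C; Cod C w = S\<rbrakk> \<Longrightarrow> w \<sqsubseteq> e \<longleftrightarrow> p1 Q Q \<cdot> w = p2 Q Q \<cdot> w"
    by (rule equalizer [of "p1 Q Q" "p2 Q Q"]) (use that in simp_all)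
  obtain e1 v1 where c1: "complements C S e1 v1"
    and e1_iff: "\<And>w. \<lbrakk>w \<in> Arr C; Cod C w = S\<rbrakk>
      \<Longrightarrow> w \<sqsubseteq> e1 \<longleftrightarrow> (p1 X Y \<cdot> p1 Q Q) \<cdot> w = (p1 X Y \<cdot> p2 Q Q) \<cdot> w"
    by (rule complemented_equalizer [OF X, of "p1 X Y \<cdot> p1 Q Q" "p1 X Y \<cdot> p2 Q Q" S])
      (use that in simp_all)
  obtain e2 v2 where c2: "complements C S e2 v2"
    and e2_iff: "\<And>w. \<lbrakk>w \<in> Arr C; Cod C w = S\<rbrakk>
      \<Longrightarrow> w \<sqsubseteq> e2 \<longleftrightarrow> (p2 X Y \<cdot> p1 Q Q) \<cdot> w = (p2 X Y \<cdot> p2 Q Q) \<cdot> w"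
    by (rule complemented_equalizer [OF Y, of "p2 X Y \<cdot> p1 Q Q" "p2 X Y \<cdot> p2 Q Q" S])
      (use that in simp_all)
  note m1 = complements_monic [OF c1] and m2 = complements_monic [OF c2]
  have e12: "w \<sqsubseteq> e \<longleftrightarrow> w \<sqsubseteq> e1 \<and> w \<sqsubseteq> e2" if w: "w \<in> Arr C" "Cod C w = S" for w
  proof -
    have "p1 Q Q \<cdot> w = p2 Q Q \<cdot> w"
      if "p1 X Y \<cdot> p1 Q Q \<cdot> w = p1 X Y \<cdot> p2 Q Q \<cdot> w" "p2 X Y \<cdot> p1 Q Q \<cdot> w = p2 X Y \<cdot> p2 Q Q \<cdot> w"
      by (rule pair_eqI [of _ _ X Y]) (use w that Q_def [symmetric] in simp_all)
    then show ?thesis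
      using e_iff [OF w] e1_iff [OF w] e2_iff [OF w] w by auto
  qed
  have "complemented C e"
  proof (rule complemented_negI [OF e])
    fix k
    assume k: "monic C k" "Cod C k = S" "e \<sqsubseteq> k"
      and neg: "\<And>w. \<lbrakk>w \<in> Arr C; Cod C w = S;
        \<And>u. \<lbrakk>u \<in> Arr C; Cod C u = Dom C w; w \<cdot> u \<sqsubseteq> e\<rbrakk> \<Longrightarrow> initial C (Dom C u)\<rbrakk> \<Longrightarrow> w \<sqsubseteq> k"
    have v_le: "w \<sqsubseteq> k" if w: "w \<in> Arr C" "Cod C w = S" "w \<sqsubseteq> v1 \<or> w \<sqsubseteq> v2" for w
    proof (rule neg [OF w(1,2)])
      fix u
      assume u: "u \<in> Arr C" "Cod C u = Dom C w" "w \<cdot> u \<sqsubseteq> e"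
      then have "w \<cdot> u \<sqsubseteq> e1" "w \<cdot> u \<sqsubseteq> e2"
        using e12 [of "w \<cdot> u"] w by simp_all
      moreover have "w \<cdot> u \<sqsubseteq> v1 \<or> w \<cdot> u \<sqsubseteq> v2"
        using through_precomp [of w v1 u] through_precomp [of w v2 u] w u m1 m2 by auto
      ultimately show "initial C (Dom C u)"
        using complements_disjoint [OF c1, of "w \<cdot> u"] complements_disjoint [OF c2, of "w \<cdot> u"] w u by auto
    qed
    have "e1 \<sqsubseteq> k"
    proof -
      obtain k' where k': "monic C k'" "Cod C k' = Dom C e1"
        and k'_iff: "\<And>w. \<lbrakk>w \<in> Arr C; Cod C w = Dom C e1\<rbrakk> \<Longrightarrow> w \<sqsubseteq> k' \<longleftrightarrow> e1 \<cdot> w \<sqsubseteq> k"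
        by (rule preimage [of e1 k]) (use m1 k that in simp_all)
      \<comment> \<open>Inside \<open>e1\<close> the pieces of \<open>e2\<close> and
        \<open>v2\<close> still cover: the first lies in the diagonal, the second avoids it.\<close>
      have "Ide C (Dom C e1) \<sqsubseteq> k'"
      proof (rule complements_cover [OF c2])
        fix s
        assume s: "s \<in> Arr C" "Cod C s = Dom C e1" "e1 \<cdot> s \<sqsubseteq> e2"
        then have "e1 \<cdot> s \<sqsubseteq> e"
          using e12 [of "e1 \<cdot> s"] m1 through_Comp [of e1 s] by simp
        then have "e1 \<cdot> s \<sqsubseteq> k"
          using through_trans [of _ e k] k e by simp
        then show "s \<sqsubseteq> k'"
          using k'_iff s by simp
      next
        fix s
        assume "s \<in> Arr C" "Cod C s = Dom C e1" "e1 \<cdot> s \<sqsubseteq> v2"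
        then show "s \<sqsubseteq> k'"
          using k'_iff v_le [of "e1 \<cdot> s"] m1 by simp
      qed (use m1 k' in simp_all)
      then show ?thesis
        using k'_iff [of "Ide C (Dom C e1)"] m1 by simp
    qed
    then show "Ide C S \<sqsubseteq> k"
      using complements_top [OF c1] v_le [of v1] m1 k through_refl [of v1] by simp
  qed
  then have "decidable C Q"
    by (rule decidableI [OF Q]) (use e e_iff S_def [symmetric] in simp_all)
  then show ?thesis
    by (simp add: Q_def)
qed

lemma decidable_product:
  assumes P: "is_product C X Y P p q" and X: "decidable C X" and Y: "decidable C Y"
  shows "decidable C P"
proof -
  note pq = is_productD [OF P] and obj = decidable_obj [OF X] decidable_obj [OF Y]
  have "monic C (pair p q)"
  proof (rule monicI)
    fix f g
    assume fg: "f \<in> Arr C" "g \<in> Arr C" "Dom C f = Dom C g" "Cod C f = Dom C (pair p q)"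
      "Cod C g = Dom C (pair p q)" "pair p q \<cdot> f = pair p q \<cdot> g"
    then have "p \<cdot> f = p \<cdot> g \<and> q \<cdot> f = q \<cdot> g"
      using pair_eq_iff [of "p \<cdot> f" "q \<cdot> f" "p \<cdot> g" "q \<cdot> g"] pq by simp
    then show "f = g"
      using is_product_eq [OF P, of f g] fg pq by simp
  qed (use pq in simp)
  then show ?thesis
    using decidable_subobject [of "pair p q"] decidable_Pr [OF X Y] pq by simp
qed

text \<open>Arrows with a common domain lift in only one way to a terminal object.\<close>

lemma through_terminal_eq:
  assumes "f \<sqsubseteq> m" "g \<sqsubseteq> m" "Dom C f = Dom C g" "terminal C (Dom C m)"
  shows "f = g"
proof -
  obtain s where s: "s \<in> Arr C" "Dom C s = Dom C f" "Cod C s = Dom C m" "m \<cdot> s = f"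
    using assms(1) by (rule throughE)
  obtain t where t: "t \<in> Arr C" "Dom C t = Dom C g" "Cod C t = Dom C m" "m \<cdot> t = g"
    using assms(2) by (rule throughE)
  have "s = t"
    by (rule terminal_eq [OF assms(4)]) (use s t assms(3) in simp_all)
  with s t show ?thesis
    by simp
qed

text \<open>The pieces \<open>i\<close> and \<open>j\<close> cut the square of \<open>B\<close> into
  four. On the two pure pieces both coordinates are the same constant, so these lie in the diagonal;
  on the mixed pieces the coordinates lie in disjoint subobjects, so these avoid it.\<close>

lemma decidable_if_terminal_complements:
  assumes c: "complements C B i j" and T: "terminal C (Dom C i)" "terminal C (Dom C j)"
  shows "decidable C B"
proof -
  note ij = complements_monic [OF c]
  have B [simp]: "B \<in> Obj C"
    using Dom_Cod_obj(2) [of i] ij by simp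
  obtain e where e: "monic C e" "Cod C e = Pr B B"
    and e_iff: "\<And>w. \<lbrakk>w \<in> Arr C; Cod C w = Pr B B\<rbrakk> \<Longrightarrow> w \<sqsubseteq> e \<longleftrightarrow> p1 B B \<cdot> w = p2 B B \<cdot> w"
    by (rule equalizer [of "p1 B B" "p2 B B"]) (use that in simp_all)
  have "complemented C e"
  proof (rule complemented_negI [OF e])
    fix k
    assume k: "monic C k" "Cod C k = Pr B B" "e \<sqsubseteq> k"
      and neg: "\<And>w. \<lbrakk>w \<in> Arr C; Cod C w = Pr B B;
        \<And>u. \<lbrakk>u \<in> Arr C; Cod C u = Dom C w; w \<cdot> u \<sqsubseteq> e\<rbrakk> \<Longrightarrow> initial C (Dom C u)\<rbrakk> \<Longrightarrow> w \<sqsubseteq> k"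
    \<comment> \<open>This treats the part of the square whose first coordinate lies in
      \<open>m\<close>; it is used for \<open>i\<close> with complement \<open>j\<close>, and then
      with the roles exchanged.\<close>
    have *: "s \<sqsubseteq> k"
      if c: "complements C B m n" and T: "terminal C (Dom C m)"
        and s: "s \<in> Arr C" "Cod C s = Pr B B" "p1 B B \<cdot> s \<sqsubseteq> m" for m n s
    proof -
      note mn = complements_monic [OF c]
      obtain k' where k': "monic C k'" "Cod C k' = Dom C s"
        and k'_iff: "\<And>w. \<lbrakk>w \<in> Arr C; Cod C w = Dom C s\<rbrakk> \<Longrightarrow> w \<sqsubseteq> k' \<longleftrightarrow> s \<cdot> w \<sqsubseteq> k"
        by (rule preimage [of s k]) (use s k that in simp_all)
      have m_in: "p1 B B \<cdot> (s \<cdot> t) \<sqsubseteq> m" if "t \<in> Arr C" "Cod C t = Dom C s" for t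
        using through_precomp [OF s(3), of t] that s mn by simp
      have "Ide C (Dom C (p2 B B \<cdot> s)) \<sqsubseteq> k'"
      proof (rule complements_cover [OF c])
        fix t
        assume "t \<in> Arr C" "Cod C t = Dom C (p2 B B \<cdot> s)" "(p2 B B \<cdot> s) \<cdot> t \<sqsubseteq> m"
        then have t: "t \<in> Arr C" "Cod C t = Dom C s" "p2 B B \<cdot> (s \<cdot> t) \<sqsubseteq> m"
          using s by simp_all
        have "p1 B B \<cdot> (s \<cdot> t) = p2 B B \<cdot> (s \<cdot> t)"
          by (rule through_terminal_eq [OF m_in t(3) _ T]) (use t s in simp_all)
        then have "s \<cdot> t \<sqsubseteq> e"
          using e_iff t s by simp
        then have "s \<cdot> t \<sqsubseteq> k"
          using through_trans [of _ e k] k e by simp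
        then show "t \<sqsubseteq> k'"
          using k'_iff t by simp
      next
        fix t
        assume "t \<in> Arr C" "Cod C t = Dom C (p2 B B \<cdot> s)" "(p2 B B \<cdot> s) \<cdot> t \<sqsubseteq> n"
        then have t: "t \<in> Arr C" "Cod C t = Dom C s" "p2 B B \<cdot> (s \<cdot> t) \<sqsubseteq> n"
          using s by simp_all
        have "s \<cdot> t \<sqsubseteq> k"
        proof (rule neg)
          fix u
          assume u: "u \<in> Arr C" "Cod C u = Dom C (s \<cdot> t)" "(s \<cdot> t) \<cdot> u \<sqsubseteq> e"
          then have "p1 B B \<cdot> (s \<cdot> (t \<cdot> u)) = p2 B B \<cdot> (s \<cdot> (t \<cdot> u))"
            using e_iff [of "s \<cdot> t \<cdot> u"] s t by simp
          moreover have "p1 B B \<cdot> (s \<cdot> (t \<cdot> u)) \<sqsubseteq> m"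
            using m_in [of "t \<cdot> u"] s t u by simp
          moreover have "p2 B B \<cdot> (s \<cdot> (t \<cdot> u)) \<sqsubseteq> n"
            using through_precomp [OF t(3), of u] s t u mn by simp
          ultimately show "initial C (Dom C u)"
            using complements_disjoint [OF c, of "p2 B B \<cdot> (s \<cdot> (t \<cdot> u))"] s t u by simp
        qed (use s t in simp_all)
        then show "t \<sqsubseteq> k'"
          using k'_iff t by simp
      qed (use s k' in simp_all)
      then show ?thesis
        using k'_iff [of "Ide C (Dom C s)"] s by simp
    qed
    have "Ide C (Dom C (p1 B B)) \<sqsubseteq> k"
      by (rule complements_cover [OF c])
        (use * [OF c T(1)] * [OF complements_sym [OF c] T(2)] k in simp_all)
    then show "Ide C (Pr B B) \<sqsubseteq> k"
      by simp
  qed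
  then show ?thesis
    by (rule decidableI [OF B]) (use e e_iff in simp_all)
qed

text \<open>\<open>R\<close> arises by quantifying the graph of \<open>g\<close> along the product
  of \<open>e\<close> with the identity of \<open>Cod C g\<close>. The universal quantifier takes
  the place of an image: where \<open>e\<close> is surjective and \<open>g\<close> is constant on
  its fibres, \<open>R\<close> is the graph of the arrow induced by \<open>g\<close>.\<close>

lemma relation:
  assumes e: "e \<in> Arr C" and g: "g \<in> Arr C" "Dom C g = Dom C e"
  obtains R where "monic C R" "Cod C R = Pr (Cod C e) (Cod C g)"
    "\<And>d a. \<lbrakk>d \<in> Arr C; a \<in> Arr C; Dom C d = Dom C a; Cod C d = Cod C e; Cod C a = Cod C g\<rbrakk> \<Longrightarrow>
      pair d a \<sqsubseteq> R \<longleftrightarrow> (\<forall>x w. x \<in> Arr C \<longrightarrow> w \<in> Arr C \<longrightarrow> Dom C x = Dom C w \<longrightarrow> Cod C x = Dom C e \<longrightarrow>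
        Cod C w = Dom C d \<longrightarrow> e \<cdot> x = d \<cdot> w \<longrightarrow> g \<cdot> x = a \<cdot> w)"
proof -
  define X where "X = Dom C e"
  define D where "D = Cod C e"
  define A where "A = Cod C g"
  have [simp]: "X \<in> Obj C" "D \<in> Obj C" "A \<in> Obj C"
    and [simp]: "e \<in> Arr C" "g \<in> Arr C" "Dom C e = X" "Cod C e = D" "Dom C g = X" "Cod C g = A"
    using e g by (simp_all add: X_def D_def A_def)
  define h where "h = pair (e \<cdot> p1 X A) (p2 X A)"
  have [simp]: "h \<in> Arr C" "Dom C h = Pr X A" "Cod C h = Pr D A"
    by (simp_all add: h_def)
  have h_pair: "h \<cdot> s = pair (e \<cdot> (p1 X A \<cdot> s)) (p2 X A \<cdot> s)" if "s \<in> Arr C" "Cod C s = Pr X A" for s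
    using that by (simp add: h_def)
  define k where "k = pair (Ide C X) g"
  have [simp]: "k \<in> Arr C" "Dom C k = X" "Cod C k = Pr X A"
    by (simp_all add: k_def)
  have k: "monic C k"
    by (rule split_monic [of _ "p1 X A"]) (simp_all add: k_def)
  have k_iff: "s \<sqsubseteq> k \<longleftrightarrow> g \<cdot> (p1 X A \<cdot> s) = p2 X A \<cdot> s" if s: "s \<in> Arr C" "Cod C s = Pr X A" for s
  proof
    assume "s \<sqsubseteq> k"
    then obtain t where t: "t \<in> Arr C" "Dom C t = Dom C s" "Cod C t = X" "k \<cdot> t = s"
      by (rule throughE) simp
    then have "s = pair t (g \<cdot> t)"
      by (simp add: k_def)
    then show "g \<cdot> (p1 X A \<cdot> s) = p2 X A \<cdot> s"
      using t(1-3) by simp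
  next
    assume "g \<cdot> (p1 X A \<cdot> s) = p2 X A \<cdot> s"
    then have "k \<cdot> (p1 X A \<cdot> s) = s"
      using s pair_eta [of s X A] by (simp add: k_def)
    then show "s \<sqsubseteq> k"
      using through_Comp [of k "p1 X A \<cdot> s"] s by simp
  qed
  obtain R where R: "monic C R" "Cod C R = Cod C h"
    and R_iff: "\<And>f. \<lbrakk>f \<in> Arr C; Cod C f = Cod C h\<rbrakk> \<Longrightarrow> f \<sqsubseteq> R \<longleftrightarrow>
      (\<forall>s w. s \<in> Arr C \<longrightarrow> w \<in> Arr C \<longrightarrow> Dom C s = Dom C w \<longrightarrow> Cod C s = Dom C h \<longrightarrow> Cod C w = Dom C f \<longrightarrow>
        h \<cdot> s = f \<cdot> w \<longrightarrow> s \<sqsubseteq> k)"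
    by (rule universal_image [of h k]) (use k that in simp_all)
  show ?thesis
  proof (rule that [OF R(1)])
    fix d a
    assume "d \<in> Arr C" "a \<in> Arr C" "Dom C d = Dom C a" "Cod C d = Cod C e" "Cod C a = Cod C g"
    then have da: "d \<in> Arr C" "a \<in> Arr C" "Dom C d = Dom C a" "Cod C d = D" "Cod C a = A"
      by simp_all
    show "pair d a \<sqsubseteq> R \<longleftrightarrow> (\<forall>x w. x \<in> Arr C \<longrightarrow> w \<in> Arr C \<longrightarrow> Dom C x = Dom C w \<longrightarrow> Cod C x = Dom C e \<longrightarrow>
        Cod C w = Dom C d \<longrightarrow> e \<cdot> x = d \<cdot> w \<longrightarrow> g \<cdot> x = a \<cdot> w)" (is "_ \<longleftrightarrow> ?R")
    proof
      assume L: "pair d a \<sqsubseteq> R"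
      show ?R
      proof (intro allI impI)
        fix x w
        assume xw: "x \<in> Arr C" "w \<in> Arr C" "Dom C x = Dom C w" "Cod C x = Dom C e" "Cod C w = Dom C d"
          "e \<cdot> x = d \<cdot> w"
        have "pair x (a \<cdot> w) \<sqsubseteq> k"
          by (rule R_iff [of "pair d a", THEN iffD1, rule_format, of _ w])
            (use L da xw h_pair in simp_all)
        then show "g \<cdot> x = a \<cdot> w"
          using k_iff [of "pair x (a \<cdot> w)"] xw da by simp
      qed
    next
      assume r: ?R
      show "pair d a \<sqsubseteq> R"
      proof (rule R_iff [THEN iffD2], goal_cases)
        case 3
        show ?case
        proof (intro allI impI)
          fix s w
          assume "s \<in> Arr C" "w \<in> Arr C" "Dom C s = Dom C w" "Cod C s = Dom C h" "Cod C w = Dom C (pair d a)"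
            "h \<cdot> s = pair d a \<cdot> w"
          then have sw: "s \<in> Arr C" "w \<in> Arr C" "Dom C s = Dom C w" "Cod C s = Pr X A" "Cod C w = Dom C a"
            "pair (e \<cdot> (p1 X A \<cdot> s)) (p2 X A \<cdot> s) = pair (d \<cdot> w) (a \<cdot> w)"
            using da h_pair by simp_all
          then have "e \<cdot> (p1 X A \<cdot> s) = d \<cdot> w" "p2 X A \<cdot> s = a \<cdot> w"
            using pair_eq_iff [of "e \<cdot> (p1 X A \<cdot> s)" "p2 X A \<cdot> s" "d \<cdot> w" "a \<cdot> w"] da by simp_all
          with r sw da show "s \<sqsubseteq> k"
            using k_iff [of s] by simp
        qed
      qed (use da in simp_all)
    qed
  qed (use R in simp)
qed

section \<open>Gluing along complements, and the object 2\<close>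

lemma through_relation:
  assumes R: "R \<in> Arr C" "Cod C R = Pr (Cod C y) (Cod C z)" and yz: "y \<in> Arr C" "z \<in> Arr C" "Dom C y = Dom C z"
    and "pair y z \<sqsubseteq> R"
  shows "y \<sqsubseteq> p1 (Cod C y) (Cod C z) \<cdot> R"
proof -
  obtain u where u: "u \<in> Arr C" "Cod C u = Dom C R" "R \<cdot> u = pair y z"
    using assms(6) by (rule throughE)
  then have "(p1 (Cod C y) (Cod C z) \<cdot> R) \<cdot> u = y"
    using R yz by simp
  with through_Comp [of "p1 (Cod C y) (Cod C z) \<cdot> R" u] u R yz show ?thesis
    by simp
qed

text \<open>A mono that is everything is invertible. With the inverse \<open>\<sigma>\<close> of the
  first projection of \<open>R\<close>, the arrow \<open>h\<close> is the second projection after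
  \<open>\<sigma>\<close>.\<close>

lemma functional_relation:
  assumes YZ: "Y \<in> Obj C" "Z \<in> Obj C" and R: "R \<in> Arr C" "Cod C R = Pr Y Z"
    and r: "monic C (p1 Y Z \<cdot> R)" "Ide C Y \<sqsubseteq> p1 Y Z \<cdot> R"
  obtains h where "h \<in> Arr C" "Dom C h = Y" "Cod C h = Z"
    "\<And>y z. \<lbrakk>y \<in> Arr C; z \<in> Arr C; Dom C y = Dom C z; Cod C y = Y; Cod C z = Z; pair y z \<sqsubseteq> R\<rbrakk> \<Longrightarrow> h \<cdot> y = z"
proof -
  obtain \<sigma> where \<sigma>: "\<sigma> \<in> Arr C" "Dom C \<sigma> = Y" "Cod C \<sigma> = Dom C R" "\<sigma> \<cdot> (p1 Y Z \<cdot> R) = Ide C (Dom C R)"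
    by (rule monic_full_inverse [OF r(1)]) (use YZ R r(2) that in simp_all)
  show ?thesis
  proof (rule that [of "p2 Y Z \<cdot> (R \<cdot> \<sigma>)"])
    fix y z
    assume yz: "y \<in> Arr C" "z \<in> Arr C" "Dom C y = Dom C z" "Cod C y = Y" "Cod C z = Z" "pair y z \<sqsubseteq> R"
    from yz(6) obtain u where u: "u \<in> Arr C" "Dom C u = Dom C (pair y z)" "Cod C u = Dom C R" "R \<cdot> u = pair y z"
      by (rule throughE)
    have "\<sigma> \<cdot> y = u"
      using Comp_eq [OF \<sigma>(4), of u] \<sigma>(1-3) u yz(1-5) YZ R by simp
    then show "(p2 Y Z \<cdot> (R \<cdot> \<sigma>)) \<cdot> y = z"
      using \<sigma>(1-3) u yz(1-5) YZ R by simp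
  qed (use \<sigma> YZ R in simp_all)
qed

text \<open>The arrow is found through its graph \<open>R\<close>, the meet of two conditions:
  wherever \<open>y\<close> lies in \<open>m\<close> the value is prescribed by \<open>f\<close>,
  and wherever it lies in \<open>n\<close> by \<open>g\<close>. This makes lattice-theoretic
  complements into coproducts.\<close>

lemma copair:
  assumes c: "complements C Y m n" and f: "f \<in> Arr C" "Dom C f = Dom C m"
    and g: "g \<in> Arr C" "Dom C g = Dom C n" "Cod C g = Cod C f"
  obtains h where "h \<in> Arr C" "Dom C h = Y" "Cod C h = Cod C f" "h \<cdot> m = f" "h \<cdot> n = g"
proof -
  note mn = complements_monic [OF c]
  define Z where "Z = Cod C f"
  have obj [simp]: "Y \<in> Obj C" "Z \<in> Obj C"
    using Dom_Cod_obj(2) [of m] mn f by (simp_all add: Z_def)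
  have fZ: "Cod C f = Z" "Cod C g = Z"
    using g by (simp_all add: Z_def)
  obtain R1 where R1: "monic C R1" "Cod C R1 = Pr Y Z"
    and R1_iff: "\<And>y z. \<lbrakk>y \<in> Arr C; z \<in> Arr C; Dom C y = Dom C z; Cod C y = Y; Cod C z = Z\<rbrakk> \<Longrightarrow>
      pair y z \<sqsubseteq> R1 \<longleftrightarrow> (\<forall>x w. x \<in> Arr C \<longrightarrow> w \<in> Arr C \<longrightarrow> Dom C x = Dom C w \<longrightarrow> Cod C x = Dom C m \<longrightarrow>
        Cod C w = Dom C y \<longrightarrow> m \<cdot> x = y \<cdot> w \<longrightarrow> f \<cdot> x = z \<cdot> w)"
    by (rule relation [of m f]) (use mn f fZ that in simp_all)
  obtain R2 where R2: "monic C R2" "Cod C R2 = Pr Y Z"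
    and R2_iff: "\<And>y z. \<lbrakk>y \<in> Arr C; z \<in> Arr C; Dom C y = Dom C z; Cod C y = Y; Cod C z = Z\<rbrakk> \<Longrightarrow>
      pair y z \<sqsubseteq> R2 \<longleftrightarrow> (\<forall>x w. x \<in> Arr C \<longrightarrow> w \<in> Arr C \<longrightarrow> Dom C x = Dom C w \<longrightarrow> Cod C x = Dom C n \<longrightarrow>
        Cod C w = Dom C y \<longrightarrow> n \<cdot> x = y \<cdot> w \<longrightarrow> g \<cdot> x = z \<cdot> w)"
    by (rule relation [of n g]) (use mn g fZ that in simp_all)
  obtain R where R: "monic C R" "Cod C R = Pr Y Z"
    and R_iff: "\<And>w. \<lbrakk>w \<in> Arr C; Cod C w = Pr Y Z\<rbrakk> \<Longrightarrow> w \<sqsubseteq> R \<longleftrightarrow> w \<sqsubseteq> R1 \<and> w \<sqsubseteq> R2"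
    by (rule meet [of R1 R2]) (use R1 R2 that in simp_all)
  \<comment> \<open>Both halves at once, with \<open>a\<close> either \<open>m\<close> or
    \<open>n\<close>. The condition attached to \<open>a\<close> itself holds because
    \<open>a\<close> is monic; the other one is vacuous, since disjointness makes the domain
    concerned initial.\<close>
  have pairR: "pair a f' \<sqsubseteq> R"
    if c: "complements C Y a b" and ab: "a = m \<and> b = n \<and> f' = f \<or> a = n \<and> b = m \<and> f' = g" for a b f'
  proof -
    note ab' = complements_monic [OF c]
    have f': "f' \<in> Arr C" "Dom C f' = Dom C a" "Cod C f' = Z"
      using ab f g fZ by auto
    have own: "f' \<cdot> x = f' \<cdot> w"
      if "x \<in> Arr C" "w \<in> Arr C" "Dom C x = Dom C w" "Cod C x = Dom C a" "Cod C w = Dom C a" "a \<cdot> x = a \<cdot> w" for x w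
    proof -
      have "x = w"
        by (rule monicD [OF ab'(1)]) (use that in simp_all)
      then show ?thesis
        by simp
    qed
    have other: "g' \<cdot> x = f' \<cdot> w"
      if "x \<in> Arr C" "w \<in> Arr C" "Dom C x = Dom C w" "Cod C x = Dom C b" "Cod C w = Dom C a" "b \<cdot> x = a \<cdot> w"
        "g' \<in> Arr C" "Dom C g' = Dom C b" "Cod C g' = Z" for x w g'
    proof -
      have "a \<cdot> w \<sqsubseteq> a" "a \<cdot> w \<sqsubseteq> b"
        using through_Comp [of a w] through_Comp [of b x] that ab' by simp_all
      then have "initial C (Dom C w)"
        using complements_disjoint [OF c, of "a \<cdot> w"] that ab' by simp
      then show ?thesis
        by (rule initial_eq) (use that f' in simp_all)
    qed
    have "pair a f' \<sqsubseteq> R1 \<and> pair a f' \<sqsubseteq> R2"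
      using ab
    proof
      assume "a = m \<and> b = n \<and> f' = f"
      then have *: "m = a" "n = b" "f = f'"
        by simp_all
      have "pair a f' \<sqsubseteq> R1"
      proof (rule R1_iff [THEN iffD2], goal_cases)
        case 6
        show ?case
          unfolding * by (intro allI impI, rule own) (use ab'(2) in simp_all)
      qed (use ab' f' in simp_all)
      moreover
      have "pair a f' \<sqsubseteq> R2"
      proof (rule R2_iff [THEN iffD2], goal_cases)
        case 6
        show ?case
          unfolding * by (intro allI impI, rule other) (use ab'(2) g fZ * in simp_all)
      qed (use ab' f' in simp_all)
      ultimately show ?thesis ..
    next
      assume "a = n \<and> b = m \<and> f' = g"
      then have *: "n = a" "m = b" "g = f'"
        by simp_all
      have "pair a f' \<sqsubseteq> R2"
      proof (rule R2_iff [THEN iffD2], goal_cases)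
        case 6
        show ?case
          unfolding * by (intro allI impI, rule own) (use ab'(2) in simp_all)
      qed (use ab' f' in simp_all)
      moreover
      have "pair a f' \<sqsubseteq> R1"
      proof (rule R1_iff [THEN iffD2], goal_cases)
        case 6
        show ?case
          unfolding * by (intro allI impI, rule other) (use ab'(2) f fZ * in simp_all)
      qed (use ab' f' in simp_all)
      ultimately show ?thesis
        by simp
    qed
    then show ?thesis
      using R_iff [of "pair a f'"] ab' f' by simp
  qed
  define r where "r = p1 Y Z \<cdot> R"
  have r [simp]: "r \<in> Arr C" "Dom C r = Dom C R" "Cod C r = Y"
    using R by (simp_all add: r_def)
  \<comment> \<open>Two values \<open>z\<close> and \<open>z'\<close> over the same \<open>y\<close>
    are both prescribed on the parts of \<open>y\<close> in \<open>m\<close> and in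
    \<open>n\<close>, and these parts cover.\<close>
  have "monic C r"
  proof (rule monicI)
    fix a b
    assume ab: "a \<in> Arr C" "b \<in> Arr C" "Dom C a = Dom C b" "Cod C a = Dom C r" "Cod C b = Dom C r" "r \<cdot> a = r \<cdot> b"
    define y where "y = r \<cdot> a"
    define z where "z = p2 Y Z \<cdot> (R \<cdot> a)"
    define z' where "z' = p2 Y Z \<cdot> (R \<cdot> b)"
    have yz [simp]: "y \<in> Arr C" "Dom C y = Dom C b" "Cod C y = Y" "z \<in> Arr C" "Dom C z = Dom C b" "Cod C z = Z"
      "z' \<in> Arr C" "Dom C z' = Dom C b" "Cod C z' = Z"
      using ab R by (simp_all add: y_def z_def z'_def)
    have eqs: "R \<cdot> a = pair y z" "R \<cdot> b = pair y z'"
      using pair_eta [of "R \<cdot> a" Y Z] pair_eta [of "R \<cdot> b" Y Z] ab R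
      by (simp_all add: y_def z_def z'_def r_def)
    have "pair y z \<sqsubseteq> R" "pair y z' \<sqsubseteq> R"
      using through_Comp [of R a] through_Comp [of R b] ab R eqs by simp_all
    then have in1: "pair y z \<sqsubseteq> R1" "pair y z' \<sqsubseteq> R1" and in2: "pair y z \<sqsubseteq> R2" "pair y z' \<sqsubseteq> R2"
      using R_iff by simp_all
    have "z = z'"
    proof (rule equal_if_through_all)
      fix e
      assume e: "monic C e" "Cod C e = Dom C z"
        and e_iff: "\<And>w. \<lbrakk>w \<in> Arr C; Cod C w = Dom C z\<rbrakk> \<Longrightarrow> w \<sqsubseteq> e \<longleftrightarrow> z \<cdot> w = z' \<cdot> w"
      have "Ide C (Dom C y) \<sqsubseteq> e"
      proof (rule complements_cover [OF c])
        fix s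
        assume s: "s \<in> Arr C" "Cod C s = Dom C y" "y \<cdot> s \<sqsubseteq> m"
        from s(3) obtain t where t: "t \<in> Arr C" "Dom C t = Dom C s" "Cod C t = Dom C m" "m \<cdot> t = y \<cdot> s"
          by (rule throughE) (use s in simp)
        have "f \<cdot> t = z \<cdot> s" "f \<cdot> t = z' \<cdot> s"
          using R1_iff [of y z, THEN iffD1, rule_format, of t s]
            R1_iff [of y z', THEN iffD1, rule_format, of t s] in1 s t by simp_all
        then show "s \<sqsubseteq> e"
          using e_iff [of s] s by simp
      next
        fix s
        assume s: "s \<in> Arr C" "Cod C s = Dom C y" "y \<cdot> s \<sqsubseteq> n"
        from s(3) obtain t where t: "t \<in> Arr C" "Dom C t = Dom C s" "Cod C t = Dom C n" "n \<cdot> t = y \<cdot> s"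
          by (rule throughE) (use s in simp)
        have "g \<cdot> t = z \<cdot> s" "g \<cdot> t = z' \<cdot> s"
          using R2_iff [of y z, THEN iffD1, rule_format, of t s]
            R2_iff [of y z', THEN iffD1, rule_format, of t s] in2 s t by simp_all
        then show "s \<sqsubseteq> e"
          using e_iff [of s] s by simp
      qed (use e in simp_all)
      then show "Ide C (Dom C z) \<sqsubseteq> e"
        by simp
    qed simp_all
    then have "R \<cdot> a = R \<cdot> b"
      using eqs by simp
    then show "a = b"
      by - (rule monicD [OF R(1)], use ab in simp_all)
  qed simp
  moreover have "m \<sqsubseteq> r" "n \<sqsubseteq> r"
    using through_relation [of R m f] through_relation [of R n g] pairR [OF c] pairR [OF complements_sym [OF c]]
      R mn f g fZ by (simp_all add: r_def)
  then have "Ide C Y \<sqsubseteq> r"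
    using complements_top [OF c \<open>monic C r\<close>] by simp
  ultimately obtain h where h: "h \<in> Arr C" "Dom C h = Y" "Cod C h = Z"
    and h_eq: "\<And>y z. \<lbrakk>y \<in> Arr C; z \<in> Arr C; Dom C y = Dom C z; Cod C y = Y; Cod C z = Z; pair y z \<sqsubseteq> R\<rbrakk> \<Longrightarrow> h \<cdot> y = z"
    by - (rule functional_relation [of Y Z R], use R that r_def in simp_all)
  have "h \<cdot> m = f" "h \<cdot> n = g"
    using h_eq [of m f] h_eq [of n g] pairR [OF c] pairR [OF complements_sym [OF c]] mn f g fZ by simp_all
  with h that fZ show ?thesis
    by simp
qed

lemma complements_coproduct:
  assumes c: "complements C Y m n"
  shows "is_coproduct C (Dom C m) (Dom C n) Y m n"
  unfolding is_coproduct_def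
proof (intro conjI ballI)
  note mn = complements_monic [OF c]
  fix Z f g
  assume "Z \<in> Obj C" and f: "f \<in> Hom C (Dom C m) Z" and g: "g \<in> Hom C (Dom C n) Z"
  obtain h where h: "h \<in> Arr C" "Dom C h = Y" "Cod C h = Cod C f" "h \<cdot> m = f" "h \<cdot> n = g"
    by (rule copair [OF c, of f g]) (use f g that in simp_all)
  show "\<exists>!h. h \<in> Hom C Y Z \<and> h \<cdot> m = f \<and> h \<cdot> n = g"
  proof (rule ex1I)
    show "h \<in> Hom C Y Z \<and> h \<cdot> m = f \<and> h \<cdot> n = g"
      using h f by simp
    show "h' = h" if "h' \<in> Hom C Y Z \<and> h' \<cdot> m = f \<and> h' \<cdot> n = g" for h'
      by (rule complements_ext [OF c]) (use that h f in simp_all)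
  qed
qed (use complements_monic [OF c] in simp_all)

text \<open>The arrow \<open>\<omega>\<close> that is true on \<open>i\<close> and false on
  \<open>j\<close> shows disjointness. For the covering, copairing the factorizations through
  \<open>k\<close> gives a section of \<open>k\<close>.\<close>

lemma coproduct_complements:
  assumes T: "terminal C T" and B: "is_coproduct C T T B i j"
  shows "complements C B i j"
proof -
  have ij: "i \<in> Arr C" "Dom C i = T" "Cod C i = B" "j \<in> Arr C" "Dom C j = T" "Cod C j = B"
    using B by (simp_all add: is_coproduct_def)
  have obj: "T \<in> Obj C" "B \<in> Obj C"
    using terminal_obj [OF T] ij Dom_Cod_obj(2) [of i] by simp_all
  have ex1: "\<exists>!h. h \<in> Hom C B Z \<and> h \<cdot> i = f \<and> h \<cdot> j = g"
    if "f \<in> Arr C" "g \<in> Arr C" "Dom C f = T" "Dom C g = T" "Cod C f = Z" "Cod C g = Z" for f g Z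
    using B [unfolded is_coproduct_def, THEN conjunct2, THEN conjunct2, rule_format, of Z f g] that
      Dom_Cod_obj(2) [of f] by simp
  obtain z where z: "monic C z" "Cod C z = T" "initial C (Dom C z)"
    using zero_subobject [OF obj(1)] by blast
  obtain \<omega> where "\<omega> \<in> Hom C B Om" and eqs: "\<omega> \<cdot> i = tr T" "\<omega> \<cdot> j = chi z"
    using ex1_implies_ex [OF ex1 [of "tr T" "chi z" Om]] z obj by auto
  then have \<omega>: "\<omega> \<in> Arr C" "Dom C \<omega> = B" "Cod C \<omega> = Om"
    by simp_all
  show ?thesis
  proof (rule complementsI)
    show "monic C i" "monic C j"
      using monic_from_terminal [OF T] ij by simp_all
    show "Cod C i = B" "Cod C j = B"
      using ij by simp_all
  next
    fix w
    assume w: "w \<in> Arr C" "Cod C w = B" "w \<sqsubseteq> i" "w \<sqsubseteq> j"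
    obtain s where s: "s \<in> Arr C" "Dom C s = Dom C w" "Cod C s = T" "i \<cdot> s = w"
      using w(3) by (rule throughE) (use ij in simp)
    obtain t where t: "t \<in> Arr C" "Dom C t = Dom C w" "Cod C t = T" "j \<cdot> t = w"
      using w(4) by (rule throughE) (use ij in simp)
    have "\<omega> \<cdot> w = tr (Dom C w)"
      using Comp_eq [OF eqs(1), of s] s \<omega> ij by simp
    moreover have "\<omega> \<cdot> w = chi z \<cdot> t"
      using Comp_eq [OF eqs(2), of t] t \<omega> ij by simp
    ultimately have "t \<sqsubseteq> z"
      using chi_iff [of z t] z t by simp
    then show "initial C (Dom C w)"
      using through_initial_iff [of z t] z t by simp
  next
    fix k
    assume k: "monic C k" "Cod C k = B" "i \<sqsubseteq> k" "j \<sqsubseteq> k"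
    obtain i' where i': "i' \<in> Arr C" "Dom C i' = T" "Cod C i' = Dom C k" "k \<cdot> i' = i"
      using k(3) by (rule throughE) (use ij in simp)
    obtain j' where j': "j' \<in> Arr C" "Dom C j' = T" "Cod C j' = Dom C k" "k \<cdot> j' = j"
      using k(4) by (rule throughE) (use ij in simp)
    obtain h where "h \<in> Hom C B (Dom C k)" and eqs: "h \<cdot> i = i'" "h \<cdot> j = j'"
      using ex1_implies_ex [OF ex1 [of i' j' "Dom C k"]] i' j' by auto
    then have h: "h \<in> Arr C" "Dom C h = B" "Cod C h = Dom C k"
      by simp_all
    have "\<exists>!h. h \<in> Hom C B B \<and> h \<cdot> i = i \<and> h \<cdot> j = j"
      by (rule ex1) (use ij in simp_all)
    moreover have "k \<cdot> h \<in> Hom C B B \<and> (k \<cdot> h) \<cdot> i = i \<and> (k \<cdot> h) \<cdot> j = j"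
      using h k eqs i' j' ij by simp
    moreover have "Ide C B \<in> Hom C B B \<and> Ide C B \<cdot> i = i \<and> Ide C B \<cdot> j = j"
      using ij obj by simp
    ultimately have "k \<cdot> h = Ide C B"
      by blast
    then show "Ide C B \<sqsubseteq> k"
      using through_Comp [of k h] k h by simp
  qed
qed

section \<open>Points of decidable objects and maps to 2\<close>

lemma is_twoE:
  assumes "is_two C B"
  obtains i j where "complements C B i j" "terminal C (Dom C i)" "terminal C (Dom C j)"
proof -
  obtain T i j where "terminal C T" "is_coproduct C T T B i j"
    using assms unfolding is_two_def by blast
  with that coproduct_complements [of T B i j] show ?thesis
    by (simp add: is_coproduct_def)
qed

lemma decidable_two: "is_two C B \<Longrightarrow> decidable C B"
  by (erule is_twoE) (rule decidable_if_terminal_complements)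

text \<open>A point in both halves of \<open>2\<close> makes \<open>one\<close> initial, and then
  any two parallel points agree; no contradiction is available, as the topos may be
  degenerate.\<close>

lemma points_eq_if_two_disjoint:
  assumes "complements C B i j" "u \<in> Arr C" "Cod C u = B" "Dom C u = one" "u \<sqsubseteq> i" "u \<sqsubseteq> j"
    "x \<in> Arr C" "y \<in> Arr C" "Dom C x = one" "Dom C y = one" "Cod C x = Cod C y"
  shows "x = y"
proof -
  have "initial C one"
    using complements_disjoint [of B i j u] assms by simp
  then show ?thesis
    by (rule initial_eq) (use assms in simp_all)
qed

text \<open>The test map is the characteristic map of the single point \<open>x\<close>. That point
  is complemented as the equalizer of the identity and the constant arrow at \<open>x\<close>, so
  decidability of \<open>A\<close> suffices and the map can be glued.\<close>

lemma separated_by_two: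
  assumes A: "decidable C A" and B: "is_two C B"
    and x: "x \<in> Arr C" "Dom C x = one" "Cod C x = A" and y: "y \<in> Arr C" "Dom C y = one" "Cod C y = A"
    and eq: "\<And>\<chi>. \<lbrakk>\<chi> \<in> Arr C; Dom C \<chi> = A; Cod C \<chi> = B\<rbrakk> \<Longrightarrow> \<chi> \<cdot> x = \<chi> \<cdot> y"
  shows "x = y"
proof -
  note obj [simp] = decidable_obj [OF A]
  obtain i j where c: "complements C B i j" and T: "terminal C (Dom C i)" "terminal C (Dom C j)"
    using is_twoE [OF B] by blast
  note ij = complements_monic [OF c]
  obtain e v where ev: "complements C A e v"
    and e_iff: "\<And>w. \<lbrakk>w \<in> Arr C; Cod C w = A\<rbrakk> \<Longrightarrow> w \<sqsubseteq> e \<longleftrightarrow> Ide C A \<cdot> w = (x \<cdot> bang A) \<cdot> w"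
    by (rule complemented_equalizer [OF A, of "Ide C A" "x \<cdot> bang A" A]) (use x that in simp_all)
  note ev' = complements_monic [OF ev]
  have e_iff: "w \<sqsubseteq> e \<longleftrightarrow> w = x \<cdot> bang (Dom C w)" if "w \<in> Arr C" "Cod C w = A" for w
    using e_iff [OF that] that x by simp
  have bang_one: "bang one = Ide C one"
    by (rule one_Ide) simp_all
  obtain s where s: "s \<in> Arr C" "Dom C s = Dom C e" "Cod C s = Dom C i"
    using terminal_arrow [OF T(1), of "Dom C e"] ev' by auto
  obtain t where t: "t \<in> Arr C" "Dom C t = Dom C v" "Cod C t = Dom C j"
    using terminal_arrow [OF T(2), of "Dom C v"] ev' by auto
  obtain \<chi> where \<chi>: "\<chi> \<in> Arr C" "Dom C \<chi> = A" "Cod C \<chi> = B" "\<chi> \<cdot> e = i \<cdot> s" "\<chi> \<cdot> v = j \<cdot> t"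
    by (rule copair [OF ev, of "i \<cdot> s" "j \<cdot> t"]) (use ij s t that in simp_all)
  have "x \<sqsubseteq> e"
    using e_iff [of x] x bang_one by simp
  then obtain x' where x': "x' \<in> Arr C" "Dom C x' = one" "Cod C x' = Dom C e" "e \<cdot> x' = x"
    by (rule throughE) (use x in simp)
  then have "\<chi> \<cdot> x = i \<cdot> (s \<cdot> x')"
    using Comp_eq [OF \<chi>(4), of x'] \<chi>(1-3) ev' ij s by simp
  then have in_i: "\<chi> \<cdot> x \<sqsubseteq> i"
    using through_Comp [of i "s \<cdot> x'"] ij s x' by simp
  consider "y \<sqsubseteq> e" | "y \<sqsubseteq> v"
    using point_complements [OF ev y] by blast
  then show ?thesis
  proof cases
    case 1
    then show ?thesis
      using e_iff [of y] y x bang_one by simp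
  next
    case 2
    then obtain y' where y': "y' \<in> Arr C" "Dom C y' = one" "Cod C y' = Dom C v" "v \<cdot> y' = y"
      by (rule throughE) (use y in simp)
    then have "\<chi> \<cdot> y = j \<cdot> (t \<cdot> y')"
      using Comp_eq [OF \<chi>(5), of y'] \<chi>(1-3) ev' ij t by simp
    then have "\<chi> \<cdot> y \<sqsubseteq> j"
      using through_Comp [of j "t \<cdot> y'"] ij t y' by simp
    moreover have "\<chi> \<cdot> x = \<chi> \<cdot> y"
      by (rule eq) (use \<chi> in simp_all)
    ultimately show ?thesis
      using points_eq_if_two_disjoint [OF c, of "\<chi> \<cdot> x" x y] in_i \<chi>(1-3) x y by simp
  qed
qed

end

section \<open>Adjunctions from universal arrows\<close>

context functor_between
begin

lemma on_obj_obj [simp]: "X \<in> Obj C \<Longrightarrow> on_obj F X \<in> Obj D"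
  by (rule on_obj_closed)

lemma on_arr_arr [simp]:
  assumes "f \<in> Arr C"
  shows "on_arr F f \<in> Arr D" "Dom D (on_arr F f) = on_obj F (Dom C f)"
    "Cod D (on_arr F f) = on_obj F (Cod C f)"
  using on_arr_closed [of f "Dom C f" "Cod C f"] assms by simp_all

lemma on_arr_comp:
  "\<lbrakk>f \<in> Arr C; g \<in> Arr C; Cod C f = Dom C g\<rbrakk> \<Longrightarrow> on_arr F (g \<cdot>\<^bsub>C\<^esub> f) = on_arr F g \<cdot>\<^bsub>D\<^esub> on_arr F f"
  using on_arr_Comp [of f "Dom C f" "Dom C g" g "Cod C g"] by simp

end

text \<open>Functoriality, naturality and the triangle identities are equalities of arrows out of
  \<open>L X\<close>, so each follows from uniqueness after restriction along \<open>u X\<close>.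
  The given family itself becomes the unit and thus stays explicit.\<close>

lemma left_adjoint_from_universal_arrows:
  fixes C :: "('o, 'a) precategory" and D :: "('p, 'b) precategory"
  assumes "functor_between D C G"
    and L: "\<And>X. X \<in> Obj C \<Longrightarrow> L X \<in> Obj D"
    and u: "\<And>X. X \<in> Obj C \<Longrightarrow> u X \<in> Hom C X (on_obj G (L X))"
    and ex1: "\<And>X A f. \<lbrakk>X \<in> Obj C; A \<in> Obj D; f \<in> Hom C X (on_obj G A)\<rbrakk>
      \<Longrightarrow> \<exists>!h. h \<in> Hom D (L X) A \<and> on_arr G h \<cdot>\<^bsub>C\<^esub> u X = f"
  obtains F \<epsilon> where "adjunction C D F G u \<epsilon>" "\<And>X. on_obj F X = L X"
proof -
  interpret G: functor_between D C G
    by (rule assms)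
  define ext where "ext X A f = (THE h. h \<in> Hom D (L X) A \<and> on_arr G h \<cdot>\<^bsub>C\<^esub> u X = f)" for X A f
  have u' [simp]: "u X \<in> Arr C" "Dom C (u X) = X" "Cod C (u X) = on_obj G (L X)" if "X \<in> Obj C" for X
    using u [OF that] by simp_all
  note L [simp]
  have ext_props: "ext X A f \<in> Hom D (L X) A \<and> on_arr G (ext X A f) \<cdot>\<^bsub>C\<^esub> u X = f"
    if "X \<in> Obj C" "A \<in> Obj D" "f \<in> Hom C X (on_obj G A)" for X A f
    unfolding ext_def by (rule theI' [OF ex1 [OF that]])
  have ext [simp]: "ext X A f \<in> Arr D" "Dom D (ext X A f) = L X" "Cod D (ext X A f) = A"
    and ext_u: "on_arr G (ext X A f) \<cdot>\<^bsub>C\<^esub> u X = f"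
    if "X \<in> Obj C" "A \<in> Obj D" "f \<in> Arr C" "Dom C f = X" "Cod C f = on_obj G A" for X A f
    using ext_props [of X A f] that by simp_all
  have uniq: "h = k"
    if "X \<in> Obj C" "h \<in> Arr D" "k \<in> Arr D" "Dom D h = L X" "Dom D k = L X" "Cod D h = Cod D k"
      "on_arr G h \<cdot>\<^bsub>C\<^esub> u X = on_arr G k \<cdot>\<^bsub>C\<^esub> u X" for X h k
  proof -
    have "\<exists>!h'. h' \<in> Hom D (L X) (Cod D h) \<and> on_arr G h' \<cdot>\<^bsub>C\<^esub> u X = on_arr G h \<cdot>\<^bsub>C\<^esub> u X"
      by (rule ex1) (use that in simp_all)
    with that show ?thesis
      by auto
  qed
  define F :: "('o, 'a, 'p, 'b) prefunctor" where
    "F = \<lparr>on_obj = L, on_arr = \<lambda>f. ext (Dom C f) (L (Cod C f)) (u (Cod C f) \<cdot>\<^bsub>C\<^esub> f)\<rparr>"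
  have F_obj [simp]: "on_obj F X = L X" for X
    by (simp add: F_def)
  have F_arr [simp]: "on_arr F f \<in> Arr D" "Dom D (on_arr F f) = L (Dom C f)" "Cod D (on_arr F f) = L (Cod C f)"
    and F_u: "on_arr G (on_arr F f) \<cdot>\<^bsub>C\<^esub> u (Dom C f) = u (Cod C f) \<cdot>\<^bsub>C\<^esub> f" if "f \<in> Arr C" for f
    using that by (simp_all add: F_def ext_u)
  interpret F: functor_between C D F
  proof
    show "on_arr F (Ide C X) = Ide D (on_obj F X)" if "X \<in> Obj C" for X
      by (rule uniq [of X]) (use that F_u [of "Ide C X"] in \<open>simp_all add: G.on_arr_Ide\<close>)
    fix X Y Z f g
    assume "f \<in> Hom C X Y" "g \<in> Hom C Y Z"
    then have fg: "f \<in> Arr C" "g \<in> Arr C" "Dom C g = Cod C f"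
      by simp_all
    have "on_arr G (on_arr F g) \<cdot>\<^bsub>C\<^esub> (on_arr G (on_arr F f) \<cdot>\<^bsub>C\<^esub> u (Dom C f)) = u (Cod C g) \<cdot>\<^bsub>C\<^esub> (g \<cdot>\<^bsub>C\<^esub> f)"
      unfolding F_u [OF fg(1)]
      using G.target.Comp_eq [OF F_u [OF fg(2), unfolded fg(3)], of f] fg by simp
    then show "on_arr F (g \<cdot>\<^bsub>C\<^esub> f) = on_arr F g \<cdot>\<^bsub>D\<^esub> on_arr F f"
      by - (rule uniq [of "Dom C f"], use fg F_u [of "g \<cdot>\<^bsub>C\<^esub> f"] in \<open>simp_all add: G.on_arr_comp\<close>)
  qed simp_all
  define \<epsilon> where "\<epsilon> A = ext (on_obj G A) A (Ide C (on_obj G A))" for A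
  have \<epsilon> [simp]: "\<epsilon> A \<in> Arr D" "Dom D (\<epsilon> A) = L (on_obj G A)" "Cod D (\<epsilon> A) = A"
    and \<epsilon>_u: "on_arr G (\<epsilon> A) \<cdot>\<^bsub>C\<^esub> u (on_obj G A) = Ide C (on_obj G A)" if "A \<in> Obj D" for A
    using that by (simp_all add: \<epsilon>_def ext_u)
  have "adjunction C D F G u \<epsilon>"
  proof
    show "u Y \<cdot>\<^bsub>C\<^esub> f = on_arr G (on_arr F f) \<cdot>\<^bsub>C\<^esub> u X" if "f \<in> Hom C X Y" for f X Y
      using F_u [of f] that by simp
    show "g \<cdot>\<^bsub>D\<^esub> \<epsilon> A = \<epsilon> B \<cdot>\<^bsub>D\<^esub> on_arr F (on_arr G g)" if "g \<in> Hom D A B" for g A B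
    proof -
      have g: "g \<in> Arr D" "Dom D g = A" "Cod D g = B" "A \<in> Obj D" "B \<in> Obj D"
        using that by auto
      have "on_arr G (\<epsilon> B) \<cdot>\<^bsub>C\<^esub> (u (on_obj G B) \<cdot>\<^bsub>C\<^esub> on_arr G g) = on_arr G g"
        using G.target.Comp_eq [OF \<epsilon>_u [OF g(5)], of "on_arr G g"] g by simp
      then show ?thesis
        by - (rule uniq [of "on_obj G A"],
          use g \<epsilon>_u [of A] F_u [of "on_arr G g"] in \<open>simp_all add: G.on_arr_comp\<close>)
    qed
    show "\<epsilon> (on_obj F X) \<cdot>\<^bsub>D\<^esub> on_arr F (u X) = Ide D (on_obj F X)" if X: "X \<in> Obj C" for X
    proof -
      have "on_arr G (\<epsilon> (L X)) \<cdot>\<^bsub>C\<^esub> (u (on_obj G (L X)) \<cdot>\<^bsub>C\<^esub> u X) = u X"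
        using G.target.Comp_eq [OF \<epsilon>_u [of "L X"], of "u X"] X by simp
      then show ?thesis
        by - (rule uniq [of X], use X F_u [of "u X"] in \<open>simp_all add: G.on_arr_comp G.on_arr_Ide\<close>)
    qed
    show "on_arr G (\<epsilon> A) \<cdot>\<^bsub>C\<^esub> u (on_obj G A) = Ide C (on_obj G A)" if "A \<in> Obj D" for A
      using \<epsilon>_u [OF that] .
  qed simp_all
  then show ?thesis
    by (rule that) simp
qed

text \<open>The dual construction. The given family becomes the counit, so a property such as being
  monic can be read off from it directly.\<close>

lemma right_adjoint_from_universal_arrows:
  fixes C :: "('o, 'a) precategory" and D :: "('p, 'b) precategory"
  assumes "functor_between C D F"
    and R: "\<And>A. A \<in> Obj D \<Longrightarrow> R A \<in> Obj C"
    and e: "\<And>A. A \<in> Obj D \<Longrightarrow> e A \<in> Hom D (on_obj F (R A)) A"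
    and ex1: "\<And>A X g. \<lbrakk>A \<in> Obj D; X \<in> Obj C; g \<in> Hom D (on_obj F X) A\<rbrakk>
      \<Longrightarrow> \<exists>!h. h \<in> Hom C X (R A) \<and> e A \<cdot>\<^bsub>D\<^esub> on_arr F h = g"
  obtains G \<eta> where "adjunction C D F G \<eta> e" "\<And>A. on_obj G A = R A"
proof -
  interpret F: functor_between C D F
    by (rule assms)
  define lift where "lift A X g = (THE h. h \<in> Hom C X (R A) \<and> e A \<cdot>\<^bsub>D\<^esub> on_arr F h = g)" for A X g
  have e' [simp]: "e A \<in> Arr D" "Dom D (e A) = on_obj F (R A)" "Cod D (e A) = A" if "A \<in> Obj D" for A
    using e [OF that] by simp_all
  note R [simp]
  have lift_props: "lift A X g \<in> Hom C X (R A) \<and> e A \<cdot>\<^bsub>D\<^esub> on_arr F (lift A X g) = g"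
    if "A \<in> Obj D" "X \<in> Obj C" "g \<in> Hom D (on_obj F X) A" for A X g
    unfolding lift_def by (rule theI' [OF ex1 [OF that]])
  have lift [simp]: "lift A X g \<in> Arr C" "Dom C (lift A X g) = X" "Cod C (lift A X g) = R A"
    and e_lift: "e A \<cdot>\<^bsub>D\<^esub> on_arr F (lift A X g) = g"
    if "A \<in> Obj D" "X \<in> Obj C" "g \<in> Arr D" "Dom D g = on_obj F X" "Cod D g = A" for A X g
    using lift_props [of A X g] that by simp_all
  have uniq: "h = k"
    if "A \<in> Obj D" "h \<in> Arr C" "k \<in> Arr C" "Cod C h = R A" "Cod C k = R A" "Dom C h = Dom C k"
      "e A \<cdot>\<^bsub>D\<^esub> on_arr F h = e A \<cdot>\<^bsub>D\<^esub> on_arr F k" for A h k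
  proof -
    have "\<exists>!h'. h' \<in> Hom C (Dom C h) (R A) \<and> e A \<cdot>\<^bsub>D\<^esub> on_arr F h' = e A \<cdot>\<^bsub>D\<^esub> on_arr F h"
      by (rule ex1) (use that in simp_all)
    with that show ?thesis
      by auto
  qed
  define G :: "('p, 'b, 'o, 'a) prefunctor" where
    "G = \<lparr>on_obj = R, on_arr = \<lambda>g. lift (Cod D g) (R (Dom D g)) (g \<cdot>\<^bsub>D\<^esub> e (Dom D g))\<rparr>"
  have G_obj [simp]: "on_obj G A = R A" for A
    by (simp add: G_def)
  have G_arr [simp]: "on_arr G g \<in> Arr C" "Dom C (on_arr G g) = R (Dom D g)" "Cod C (on_arr G g) = R (Cod D g)"
    and e_G: "e (Cod D g) \<cdot>\<^bsub>D\<^esub> on_arr F (on_arr G g) = g \<cdot>\<^bsub>D\<^esub> e (Dom D g)" if "g \<in> Arr D" for g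
    using that by (simp_all add: G_def e_lift)
  interpret G: functor_between D C G
  proof
    show "on_arr G (Ide D A) = Ide C (on_obj G A)" if "A \<in> Obj D" for A
      by (rule uniq [of A]) (use that e_G [of "Ide D A"] in \<open>simp_all add: F.on_arr_Ide\<close>)
    fix X Y Z f g
    assume "f \<in> Hom D X Y" "g \<in> Hom D Y Z"
    then have fg: "f \<in> Arr D" "g \<in> Arr D" "Dom D g = Cod D f"
      by simp_all
    have "e (Cod D g) \<cdot>\<^bsub>D\<^esub> (on_arr F (on_arr G g) \<cdot>\<^bsub>D\<^esub> on_arr F (on_arr G f))
      = g \<cdot>\<^bsub>D\<^esub> (f \<cdot>\<^bsub>D\<^esub> e (Dom D f))"
      unfolding e_G [OF fg(1), symmetric]
      using F.target.Comp_eq [OF e_G [OF fg(2), unfolded fg(3)], of "on_arr F (on_arr G f)"] fg by simp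
    then show "on_arr G (g \<cdot>\<^bsub>D\<^esub> f) = on_arr G g \<cdot>\<^bsub>C\<^esub> on_arr G f"
      by - (rule uniq [of "Cod D g"], use fg e_G [of "g \<cdot>\<^bsub>D\<^esub> f"] in \<open>simp_all add: F.on_arr_comp\<close>)
  qed simp_all
  define \<eta> where "\<eta> X = lift (on_obj F X) X (Ide D (on_obj F X))" for X
  have \<eta> [simp]: "\<eta> X \<in> Arr C" "Dom C (\<eta> X) = X" "Cod C (\<eta> X) = R (on_obj F X)"
    and e_\<eta>: "e (on_obj F X) \<cdot>\<^bsub>D\<^esub> on_arr F (\<eta> X) = Ide D (on_obj F X)" if "X \<in> Obj C" for X
    using that by (simp_all add: \<eta>_def e_lift)
  have "adjunction C D F G \<eta> e"
  proof
    show "g \<cdot>\<^bsub>D\<^esub> e A = e B \<cdot>\<^bsub>D\<^esub> on_arr F (on_arr G g)" if "g \<in> Hom D A B" for g A B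
      using e_G [of g] that by simp
    show "\<eta> Y \<cdot>\<^bsub>C\<^esub> f = on_arr G (on_arr F f) \<cdot>\<^bsub>C\<^esub> \<eta> X" if "f \<in> Hom C X Y" for f X Y
    proof -
      have f: "f \<in> Arr C" "Dom C f = X" "Cod C f = Y" "X \<in> Obj C" "Y \<in> Obj C"
        using that by auto
      have "e (on_obj F Y) \<cdot>\<^bsub>D\<^esub> (on_arr F (\<eta> Y) \<cdot>\<^bsub>D\<^esub> on_arr F f) = on_arr F f"
        using F.target.Comp_eq [OF e_\<eta> [OF f(5)], of "on_arr F f"] f by simp
      moreover have "e (on_obj F Y) \<cdot>\<^bsub>D\<^esub> (on_arr F (on_arr G (on_arr F f)) \<cdot>\<^bsub>D\<^esub> on_arr F (\<eta> X)) = on_arr F f"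
        using F.target.Comp_eq [OF e_G [of "on_arr F f"], of "on_arr F (\<eta> X)"] e_\<eta> [of X] f by simp
      ultimately show ?thesis
        by - (rule uniq [of "on_obj F Y"], use f in \<open>simp_all add: F.on_arr_comp\<close>)
    qed
    show "on_arr G (e A) \<cdot>\<^bsub>C\<^esub> \<eta> (on_obj G A) = Ide C (on_obj G A)" if A: "A \<in> Obj D" for A
    proof -
      have "e A \<cdot>\<^bsub>D\<^esub> (on_arr F (on_arr G (e A)) \<cdot>\<^bsub>D\<^esub> on_arr F (\<eta> (R A))) = e A"
        using F.target.Comp_eq [OF e_G [of "e A"], of "on_arr F (\<eta> (R A))"] e_\<eta> [of "R A"] A by simp
      then show ?thesis
        by - (rule uniq [of A], use A in \<open>simp_all add: F.on_arr_comp F.on_arr_Ide\<close>)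
    qed
    show "e (on_obj F X) \<cdot>\<^bsub>D\<^esub> on_arr F (\<eta> X) = Ide D (on_obj F X)" if "X \<in> Obj C" for X
      using e_\<eta> [OF that] .
  qed simp_all
  then show ?thesis
    by (rule that) simp
qed

section \<open>Universal properties of unit and counit\<close>

context adjunction
begin

lemma unit_arr [simp]:
  assumes "X \<in> Obj C"
  shows "\<eta> X \<in> Arr C" "Dom C (\<eta> X) = X" "Cod C (\<eta> X) = on_obj G (on_obj F X)"
  using unit_closed [OF assms] by simp_all

lemma counit_arr [simp]:
  assumes "A \<in> Obj D"
  shows "\<epsilon> A \<in> Arr D" "Dom D (\<epsilon> A) = on_obj F (on_obj G A)" "Cod D (\<epsilon> A) = A"
  using counit_closed [OF assms] by simp_all

lemma unit_universal:
  assumes X: "X \<in> Obj C" "A \<in> Obj D" and f: "f \<in> Hom C X (on_obj G A)"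
  shows "\<exists>!h. h \<in> Hom D (on_obj F X) A \<and> on_arr G h \<cdot>\<^bsub>C\<^esub> \<eta> X = f"
proof (rule ex1I [of _ "\<epsilon> A \<cdot>\<^bsub>D\<^esub> on_arr F f"])
  show "\<epsilon> A \<cdot>\<^bsub>D\<^esub> on_arr F f \<in> Hom D (on_obj F X) A \<and> on_arr G (\<epsilon> A \<cdot>\<^bsub>D\<^esub> on_arr F f) \<cdot>\<^bsub>C\<^esub> \<eta> X = f"
    using unit_natural [OF f] triangle_right [OF X(2)] X f
      left.source.Comp_eq [of "on_arr G (\<epsilon> A)" "\<eta> (on_obj G A)" _ f]
    by (simp add: right.on_arr_comp)
next
  fix h
  assume "h \<in> Hom D (on_obj F X) A \<and> on_arr G h \<cdot>\<^bsub>C\<^esub> \<eta> X = f"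
  then have h: "h \<in> Arr D" "Dom D h = on_obj F X" "Cod D h = A" "on_arr G h \<cdot>\<^bsub>C\<^esub> \<eta> X = f"
    by simp_all
  have "on_arr F f = on_arr F (on_arr G h) \<cdot>\<^bsub>D\<^esub> on_arr F (\<eta> X)"
    unfolding h(4) [symmetric] using h(1-3) X by (simp add: left.on_arr_comp)
  then have "\<epsilon> A \<cdot>\<^bsub>D\<^esub> on_arr F f = h \<cdot>\<^bsub>D\<^esub> (\<epsilon> (on_obj F X) \<cdot>\<^bsub>D\<^esub> on_arr F (\<eta> X))"
    using left.target.Comp_eq [OF counit_natural [of h "on_obj F X" A, symmetric], of "on_arr F (\<eta> X)"] h(1-3) X
    by simp
  then show "h = \<epsilon> A \<cdot>\<^bsub>D\<^esub> on_arr F f"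
    using triangle_left [OF X(1)] h by simp
qed

lemma counit_factor:
  assumes X: "X \<in> Obj C" "A \<in> Obj D" and g: "g \<in> Hom D (on_obj F X) A"
  obtains h where "h \<in> Hom C X (on_obj G A)" "\<epsilon> A \<cdot>\<^bsub>D\<^esub> on_arr F h = g"
proof (rule that)
  show "on_arr G g \<cdot>\<^bsub>C\<^esub> \<eta> X \<in> Hom C X (on_obj G A)"
    using X g by simp
  show "\<epsilon> A \<cdot>\<^bsub>D\<^esub> on_arr F (on_arr G g \<cdot>\<^bsub>C\<^esub> \<eta> X) = g"
    using left.target.Comp_eq [OF counit_natural [OF g, symmetric], of "on_arr F (\<eta> X)"] triangle_left [OF X(1)] X g
    by (simp add: left.on_arr_comp)
qed

end

section \<open>From precohesion to (DQO) and (DSO)\<close>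

lemma Dec_simps [simp]:
  "X \<in> Obj (Dec C) \<longleftrightarrow> decidable C X"
  "f \<in> Arr (Dec C) \<longleftrightarrow> f \<in> Arr C \<and> decidable C (Dom C f) \<and> decidable C (Cod C f)"
  "Dom (Dec C) = Dom C" "Cod (Dec C) = Cod C" "Ide (Dec C) = Ide C" "Comp (Dec C) = Comp C"
  by (auto simp: Dec_def full_subcategory_def decidable_def)

lemma Dec_Hom [simp]:
  "f \<in> Hom (Dec C) X Y \<longleftrightarrow> f \<in> Arr C \<and> Dom C f = X \<and> Cod C f = Y \<and> decidable C X \<and> decidable C Y"
  by (auto simp: Hom_def)

context nullstellensatz_topos
begin

section \<open>Reflections and coreflections into decidable objects\<close>

lemma Dec_category: "category (Dec C)"
  by unfold_locales (auto simp: decidable_obj)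

lemma inclusion_functor: "functor_between (Dec C) C inclusion"
  by (rule functor_between.intro [OF Dec_category category_axioms])
    (unfold_locales, auto simp: inclusion_def decidable_obj)

lemma inclusion_fully_faithful: "fully_faithful (Dec C) C inclusion"
  unfolding fully_faithful_def inclusion_def bij_betw_def by auto

text \<open>Factorizations are unique because \<open>d\<close> is monic, so existence is
  enough.\<close>

definition coreflection :: "'a \<Rightarrow> 'b \<Rightarrow> bool" where
  "coreflection X d \<longleftrightarrow> monic C d \<and> Cod C d = X \<and> decidable C (Dom C d) \<and>
    (\<forall>g. g \<in> Arr C \<longrightarrow> Cod C g = X \<longrightarrow> decidable C (Dom C g) \<longrightarrow> g \<sqsubseteq> d)"

definition reflection :: "'a \<Rightarrow> 'b \<Rightarrow> bool" where
  "reflection X r \<longleftrightarrow> r \<in> Arr C \<and> Dom C r = X \<and> decidable C (Cod C r) \<and>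
    (\<forall>g. g \<in> Arr C \<longrightarrow> Dom C g = X \<longrightarrow> decidable C (Cod C g) \<longrightarrow>
      (\<exists>!h. h \<in> Hom C (Cod C r) (Cod C g) \<and> h \<cdot> r = g))"

lemma reflection_factor:
  assumes "reflection X r" "g \<in> Arr C" "Dom C g = X" "decidable C (Cod C g)"
  obtains h where "h \<in> Arr C" "Dom C h = Cod C r" "Cod C h = Cod C g" "h \<cdot> r = g"
  using assms unfolding reflection_def by (metis Hom_iff)

lemma reflection_unique:
  assumes "reflection X r" "h \<in> Arr C" "k \<in> Arr C" "Dom C h = Cod C r" "Dom C k = Cod C r" "Cod C h = Cod C k"
    "decidable C (Cod C h)" "h \<cdot> r = k \<cdot> r"
  shows "h = k"
proof -
  have r: "r \<in> Arr C" "Dom C r = X"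
    using assms(1) by (simp_all add: reflection_def)
  have "\<exists>!h'. h' \<in> Hom C (Cod C r) (Cod C (h \<cdot> r)) \<and> h' \<cdot> r = h \<cdot> r"
    using assms(1) [unfolded reflection_def, THEN conjunct2, THEN conjunct2, THEN conjunct2, rule_format, of "h \<cdot> r"]
      r assms(2-7) by simp
  then show ?thesis
    using assms r by auto
qed

text \<open>The coreflection of \<^term>\<open>Om\<close> is \<open>2\<close>: its only points are true and false.\<close>

lemma two_ex:
  assumes d: "coreflection Om d"
  shows "\<exists>B. is_two C B"
proof -
  have d': "monic C d" "Cod C d = Om" "decidable C (Dom C d)"
    and fac: "\<And>g. \<lbrakk>g \<in> Arr C; Cod C g = Om; decidable C (Dom C g)\<rbrakk> \<Longrightarrow> g \<sqsubseteq> d"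
    using d by (simp_all add: coreflection_def)
  define D where "D = Dom C d"
  have D: "Dom C d = D" "D \<in> Obj C" "decidable C D"
    using d' by (simp_all add: D_def)
  \<comment> \<open>The classifier \<open>chi z\<close> of the empty subobject of \<open>one\<close>
    is the truth value false.\<close>
  obtain z where z: "monic C z" "Cod C z = one" "initial C (Dom C z)"
    using zero_subobject [OF one_obj] by blast
  have "truth \<sqsubseteq> d"
    by (rule fac) (simp_all add: decidable_one)
  then obtain t where t: "t \<in> Arr C" "Dom C t = one" "Cod C t = D" "d \<cdot> t = truth"
    by (rule throughE) (use D in simp)
  have "chi z \<sqsubseteq> d"
    by (rule fac) (use z in \<open>simp_all add: decidable_one\<close>)
  then obtain f where f: "f \<in> Arr C" "Dom C f = one" "Cod C f = D" "d \<cdot> f = chi z"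
    by (rule throughE) (use D z in simp)
  have bang_one: "bang one = Ide C one"
    by (rule one_Ide) simp_all
  \<comment> \<open>The equalizer of the identity and the constant arrow at \<open>t\<close> is the
    point \<open>t\<close> itself, and it comes with a complement \<open>v\<close>. It remains to
    identify \<open>v\<close> with \<open>f\<close>.\<close>
  obtain e v where ev: "complements C D e v"
    and e_iff: "\<And>w. \<lbrakk>w \<in> Arr C; Cod C w = D\<rbrakk> \<Longrightarrow> w \<sqsubseteq> e \<longleftrightarrow> Ide C D \<cdot> w = (t \<cdot> bang D) \<cdot> w"
    by (rule complemented_equalizer [OF D(3), of "Ide C D" "t \<cdot> bang D" D]) (use D t that in simp_all)
  note ev' = complements_monic [OF ev]
  have e_iff: "w \<sqsubseteq> e \<longleftrightarrow> w = t \<cdot> bang (Dom C w)" if "w \<in> Arr C" "Cod C w = D" for w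
    using e_iff [OF that] that t D by simp
  have "t \<sqsubseteq> e"
    using e_iff [of t] t bang_one by simp
  have "e = t \<cdot> bang (Dom C e)"
    using e_iff [of e] ev' through_refl [of e] by simp
  then have "e \<sqsubseteq> t"
    using through_Comp [of t "bang (Dom C e)"] t ev' by simp
  have mono: "monic C t" "monic C f"
    using monic_from_terminal [OF one_terminal] t f by simp_all
  have tv: "complements C D t v"
    by (rule complements_cong [OF ev]) (use mono t \<open>t \<sqsubseteq> e\<close> \<open>e \<sqsubseteq> t\<close> in simp_all)
  \<comment> \<open>A truth value in \<open>v\<close> is nowhere true: if it is true at
    \<open>w\<close>, then \<open>w\<close> yields an element of both \<open>t\<close> and
    \<open>v\<close>, so its domain is initial. This is the defining behaviour of false.\<close>
  have points: "v \<cdot> y = f" if y: "y \<in> Arr C" "Dom C y = one" "Cod C y = Dom C v" for y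
  proof -
    have "d \<cdot> (v \<cdot> y) = d \<cdot> f"
      unfolding f(4)
    proof (rule Om_ext)
      fix w
      assume "w \<in> Arr C" "Cod C w = Dom C (d \<cdot> (v \<cdot> y))"
      then have w: "w \<in> Arr C" "Cod C w = one"
        using y ev' d' D by simp_all
      show "(d \<cdot> (v \<cdot> y)) \<cdot> w = tr (Dom C w) \<longleftrightarrow> chi z \<cdot> w = tr (Dom C w)"
      proof
        assume "(d \<cdot> (v \<cdot> y)) \<cdot> w = tr (Dom C w)"
        then have "d \<cdot> (v \<cdot> (y \<cdot> w)) = d \<cdot> (t \<cdot> bang (Dom C w))"
          using Comp_eq [OF t(4), of "bang (Dom C w)"] w y ev' d' D t by (simp add: tr_def)
        then have eq: "v \<cdot> (y \<cdot> w) = t \<cdot> bang (Dom C w)"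
          by - (rule monicD [OF d'(1)], use w y ev' d' D t in simp_all)
        have "v \<cdot> (y \<cdot> w) \<sqsubseteq> v"
          by (rule through_Comp) (use w y ev' in simp_all)
        moreover have "t \<cdot> bang (Dom C w) \<sqsubseteq> t"
          by (rule through_Comp) (use w t in simp_all)
        ultimately have "initial C (Dom C w)"
          using complements_disjoint [OF tv, of "t \<cdot> bang (Dom C w)"] eq w t by simp
        then show "chi z \<cdot> w = tr (Dom C w)"
          using chi_iff [of z w] through_initial_iff [of z w] z w by simp
      next
        assume "chi z \<cdot> w = tr (Dom C w)"
        then have "initial C (Dom C w)"
          using chi_iff [of z w] through_initial_iff [of z w] z w by simp
        then show "(d \<cdot> (v \<cdot> y)) \<cdot> w = tr (Dom C w)"
          by (rule initial_eq) (use w y ev' d' D in simp_all)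
      qed
    qed (use y ev' d' D z in simp_all)
    then show ?thesis
      by - (rule monicD [OF d'(1)], use y ev' D f in simp_all)
  qed
  have "v = f \<cdot> bang (Dom C v)"
    by (rule decidable_eqI [OF D(3)]) (use points ev' f bang_one in simp_all)
  then have "v \<sqsubseteq> f"
    using through_Comp [of f "bang (Dom C v)"] f ev' by simp
  moreover have "f \<sqsubseteq> v"
    using point_complements [OF tv f(1-3)]
  proof
    \<comment> \<open>True equals false only in the degenerate topos, where the factorization exists
      because \<open>one\<close> is initial.\<close>
    assume "f \<sqsubseteq> t"
    then have "f = t"
      using through_terminal_eq [of f t t] through_refl [of t] t f one_terminal by simp
    then have "chi z \<cdot> Ide C one = tr one"
      using f(4) t(4) z by (simp add: tr_one)
    then have "initial C one"
      using chi_iff [of z "Ide C one"] through_initial_iff [of z "Ide C one"] z by simp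
    then show ?thesis
      by - (rule initial_through, use f ev' in simp_all)
  qed
  ultimately have "complements C D t f"
    using complements_sym [OF complements_cong [OF complements_sym [OF tv], of f]] mono f by simp
  then have "is_coproduct C one one D t f"
    using complements_coproduct [of D t f] t f by simp
  then show ?thesis
    using one_terminal unfolding is_two_def by blast
qed

text \<open>A decidable subobject \<open>e\<close> with all points factors through the coreflection
  by some \<open>u\<close>. Points lift along \<open>u\<close>, and this makes \<open>u\<close> epic
  against decidable codomains; balancedness is therefore applied in \<open>Dec C\<close> and not in
  \<open>C\<close>.\<close>

lemma DSO_if_coreflections:
  assumes D: "elementary_topos (Dec C)" and cor: "\<And>X. X \<in> Obj C \<Longrightarrow> \<exists>d. coreflection X d"
  shows "DSO C"
  unfolding DSO_def
proof
  interpret D: elementary_topos "Dec C"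
    by (rule D)
  fix X
  assume "X \<in> Obj C"
  then obtain d where d: "monic C d" "Cod C d = X" "decidable C (Dom C d)"
    and fac: "\<And>g. \<lbrakk>g \<in> Arr C; Cod C g = X; decidable C (Dom C g)\<rbrakk> \<Longrightarrow> g \<sqsubseteq> d"
    using cor unfolding coreflection_def by blast
  have "decidable_subobject_of_points C X d"
    unfolding decidable_subobject_of_points_def
  proof (intro conjI allI impI)
    fix x
    assume "is_point C X x"
    then show "x \<sqsubseteq> d"
      by (rule is_pointE) (use fac decidable_terminal in simp)
  qed (use d in \<open>simp_all add: subobject_iff\<close>)
  moreover have "same_subobject C e d" if e: "decidable_subobject_of_points C X e" for e
  proof -
    have e: "monic C e" "Cod C e = X" "decidable C (Dom C e)"
      and pts: "\<And>x. \<lbrakk>x \<in> Arr C; Dom C x = one; Cod C x = X\<rbrakk> \<Longrightarrow> x \<sqsubseteq> e"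
      using e is_pointI unfolding decidable_subobject_of_points_def subobject_iff by simp_all
    have "e \<sqsubseteq> d"
      using fac e by simp
    then obtain u where u: "u \<in> Arr C" "Dom C u = Dom C e" "Cod C u = Dom C d" "d \<cdot> u = e"
      by (rule throughE)
    have "monic (Dec C) u"
    proof (rule D.monicI)
      fix f g
      assume "f \<in> Arr (Dec C)" "g \<in> Arr (Dec C)" "Dom (Dec C) f = Dom (Dec C) g"
        "Cod (Dec C) f = Dom (Dec C) u" "Cod (Dec C) g = Dom (Dec C) u" "u \<cdot>\<^bsub>Dec C\<^esub> f = u \<cdot>\<^bsub>Dec C\<^esub> g"
      then have fg: "f \<in> Arr C" "g \<in> Arr C" "Dom C f = Dom C g" "Cod C f = Dom C e" "Cod C g = Dom C e"
        "u \<cdot> f = u \<cdot> g"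
        using u by simp_all
      have "e \<cdot> f = e \<cdot> g"
        using Comp_eq [OF u(4), of f] Comp_eq [OF u(4), of g] fg u(1-3) d(1) by simp
      then show "f = g"
        by - (rule monicD [OF e(1)], use fg in simp_all)
    qed (use u d e in simp)
    moreover have "epic (Dec C) u"
    proof (rule D.epicI)
      fix f g
      assume "f \<in> Arr (Dec C)" "g \<in> Arr (Dec C)" "Cod (Dec C) f = Cod (Dec C) g"
        "Dom (Dec C) f = Cod (Dec C) u" "Dom (Dec C) g = Cod (Dec C) u" "f \<cdot>\<^bsub>Dec C\<^esub> u = g \<cdot>\<^bsub>Dec C\<^esub> u"
      then have fg: "f \<in> Arr C" "g \<in> Arr C" "Cod C f = Cod C g" "Dom C f = Dom C d" "Dom C g = Dom C d"
        "decidable C (Cod C g)" and eq: "f \<cdot> u = g \<cdot> u"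
        using u by simp_all
      show "f = g"
      proof (rule decidable_eqI [OF fg(6)])
        fix s
        assume s: "s \<in> Arr C" "Dom C s = one" "Cod C s = Dom C f"
        have "d \<cdot> s \<sqsubseteq> e"
          by (rule pts) (use s fg d in simp_all)
        then obtain y where y: "y \<in> Arr C" "Dom C y = one" "Cod C y = Dom C e" "e \<cdot> y = d \<cdot> s"
          by (rule throughE) (use s fg d in simp)
        have "u \<cdot> y = s"
          by (rule monicD [OF d(1)]) (use Comp_eq [OF u(4), of y] y u(1-3) s fg d in simp_all)
        then show "f \<cdot> s = g \<cdot> s"
          using Comp_eq [OF eq, of y] y u(1-3) fg by simp
      qed (use fg in simp_all)
    qed (use u d e in simp)
    ultimately have "isomorphism (Dec C) u"
      by (rule D.balanced)
    then obtain v where v: "v \<in> Arr C" "Dom C v = Dom C d" "Cod C v = Dom C e" "u \<cdot> v = Ide C (Dom C d)"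
      using u unfolding isomorphism_def by auto
    have "d = e \<cdot> v"
      using Comp_eq [OF u(4), of v] u(1-3) v d by simp
    then have "d \<sqsubseteq> e"
      using through_Comp [of e v] v e by simp
    with \<open>e \<sqsubseteq> d\<close> show ?thesis
      by (simp add: same_subobject_def)
  qed
  ultimately show "\<exists>d. decidable_subobject_of_points C X d \<and>
     (\<forall>e. decidable_subobject_of_points C X e \<longrightarrow> same_subobject C e d)"
    by blast
qed

lemma reflection_epic:
  assumes r: "reflection X r"
  shows "epic C r"
proof (rule epicI)
  have r': "r \<in> Arr C" "Dom C r = X" "decidable C (Cod C r)"
    using r by (simp_all add: reflection_def)
  fix f g
  assume fg: "f \<in> Arr C" "g \<in> Arr C" "Cod C f = Cod C g" "Dom C f = Cod C r" "Dom C g = Cod C r"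
    "f \<cdot> r = g \<cdot> r"
  show "f = g"
  proof (rule equal_if_through_all)
    fix e
    assume e: "monic C e" "Cod C e = Dom C f"
      and e_iff: "\<And>w. \<lbrakk>w \<in> Arr C; Cod C w = Dom C f\<rbrakk> \<Longrightarrow> w \<sqsubseteq> e \<longleftrightarrow> f \<cdot> w = g \<cdot> w"
    have "r \<sqsubseteq> e"
      using e_iff [of r] r' fg by simp
    then obtain r0 where r0: "r0 \<in> Arr C" "Dom C r0 = X" "Cod C r0 = Dom C e" "e \<cdot> r0 = r"
      by (rule throughE) (use r' in simp)
    have "decidable C (Dom C e)"
      by (rule decidable_subobject [OF e(1)]) (use e fg r' in simp)
    then obtain h where h: "h \<in> Arr C" "Dom C h = Cod C r" "Cod C h = Dom C e" "h \<cdot> r = r0"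
      using reflection_factor [OF r, of r0] r0 by auto
    have "e \<cdot> h = Ide C (Cod C r)"
      by (rule reflection_unique [OF r]) (use h e r0 r' fg in simp_all)
    then show "Ide C (Dom C f) \<sqsubseteq> e"
      using through_Comp [of e h] e h fg by simp
  qed (use fg in simp_all)
qed (use r in \<open>simp add: reflection_def\<close>)

text \<open>The comparison \<open>i\<close> with another decidable quotient \<open>q\<close> is epic
  because \<open>q\<close> is. It is injective on points because every map from the reflection to
  \<open>2\<close> factors through \<open>i\<close>, and such maps separate points. Balancedness of
  \<open>C\<close> finishes.\<close>

lemma DQO_if_reflections:
  assumes B: "is_two C B" and ref: "\<And>X. X \<in> Obj C \<Longrightarrow> \<exists>r. reflection X r"
  shows "DQO C"
  unfolding DQO_def
proof
  fix X
  assume "X \<in> Obj C"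
  then obtain r where r: "reflection X r"
    using ref by blast
  then have r': "r \<in> Arr C" "Dom C r = X" "decidable C (Cod C r)"
    by (simp_all add: reflection_def)
  note epic = reflection_epic [OF r]
  have "\<exists>!h. h \<in> Hom C (Cod C r) B \<and> h \<cdot> r = g" if "g \<in> Hom C X B" for g
    using r [unfolded reflection_def, THEN conjunct2, THEN conjunct2, THEN conjunct2, rule_format, of g]
      decidable_two [OF B] that by simp
  then have "decidable_quotient C X r"
    using B epic r' unfolding decidable_quotient_def by blast
  moreover have "\<exists>i\<in>Hom C (Cod C r) (Cod C q). isomorphism C i \<and> i \<cdot> r = q"
    if q: "decidable_quotient C X q" for q
  proof -
    obtain B' where q': "epic C q" "Dom C q = X" "decidable C (Cod C q)" and B': "is_two C B'"
      and fac: "\<And>g. g \<in> Hom C X B' \<Longrightarrow> \<exists>!h. h \<in> Hom C (Cod C q) B' \<and> h \<cdot> q = g"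
      using q unfolding decidable_quotient_def by blast
    obtain i where i: "i \<in> Arr C" "Dom C i = Cod C r" "Cod C i = Cod C q" "i \<cdot> r = q"
      using reflection_factor [OF r, of q] q' by auto
    have "epic C i"
    proof (rule epicI)
      fix f g
      assume fg: "f \<in> Arr C" "g \<in> Arr C" "Cod C f = Cod C g" "Dom C f = Cod C i" "Dom C g = Cod C i"
        "f \<cdot> i = g \<cdot> i"
      have "f \<cdot> q = g \<cdot> q"
        unfolding i(4) [symmetric] using Comp_eq [OF fg(6), of r] fg(1-5) i(1-3) r' by simp
      then show "f = g"
        by - (rule epicD [OF q'(1)], use fg i in simp_all)
    qed (rule i)
    moreover have "monic C i"
    proof (rule monic_if_injective_on_points)
      fix x y
      assume xy: "x \<in> Arr C" "y \<in> Arr C" "Dom C x = one" "Dom C y = one" "Cod C x = Dom C i" "Cod C y = Dom C i"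
        "i \<cdot> x = i \<cdot> y"
      show "x = y"
      proof (rule separated_by_two [OF r'(3) B'])
        fix \<chi>
        assume \<chi>: "\<chi> \<in> Arr C" "Dom C \<chi> = Cod C r" "Cod C \<chi> = B'"
        obtain k where "k \<in> Hom C (Cod C q) B'" and kq: "k \<cdot> q = \<chi> \<cdot> r"
          using fac [of "\<chi> \<cdot> r"] \<chi> r' by auto
        then have k: "k \<in> Arr C" "Dom C k = Cod C q" "Cod C k = B'"
          by simp_all
        have "k \<cdot> i = \<chi>"
          by (rule epicD [OF epic]) (use kq k \<chi> i r' in simp_all)
        then show "\<chi> \<cdot> x = \<chi> \<cdot> y"
          using Comp_eq [of k i \<chi> x] Comp_eq [of k i \<chi> y] k i(1-3) xy by simp
      qed (use xy i in simp_all)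
    qed (use i r' in simp_all)
    ultimately show ?thesis
      using balanced [of i] i by (intro bexI [of _ i]) simp_all
  qed
  ultimately show "\<exists>p. decidable_quotient C X p \<and>
     (\<forall>q. decidable_quotient C X q \<longrightarrow>
        (\<exists>i\<in>Hom C (Cod C p) (Cod C q). isomorphism C i \<and> i \<cdot> p = q))"
    by blast
qed

text \<open>The unit of the left adjoint is a reflection and the monic counit of the right adjoint a
  coreflection. (DQO) also asks for an object \<open>2\<close>, which the coreflection of
  \<open>Om\<close> provides.\<close>

lemma DQO_DSO_if_precohesive:
  assumes "precohesive_over_Dec C"
  shows "DQO C \<and> DSO C"
proof -
  obtain fl fp \<eta> \<epsilon> \<eta>' \<epsilon>' where D: "elementary_topos (Dec C)"
    and "adjunction C (Dec C) fl inclusion \<eta> \<epsilon>" "adjunction (Dec C) C inclusion fp \<eta>' \<epsilon>'"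
    and counit: "\<And>X. X \<in> Obj C \<Longrightarrow> monic C (\<epsilon>' X)"
    using assms unfolding precohesive_over_Dec_def precohesive_via_def by blast
  interpret A: adjunction C "Dec C" fl inclusion \<eta> \<epsilon>
    by fact
  interpret A': adjunction "Dec C" C inclusion fp \<eta>' \<epsilon>'
    by fact
  have incl [simp]: "on_obj inclusion Y = Y" "on_arr inclusion h = h" for Y :: 'a and h :: 'b
    by (simp_all add: inclusion_def)
  have refl: "\<exists>r. reflection X r" if X: "X \<in> Obj C" for X
  proof
    have fX: "decidable C (on_obj fl X)"
      using A.left.on_obj_obj [OF X] by simp
    show "reflection X (\<eta> X)"
      unfolding reflection_def
    proof (intro conjI allI impI)
      fix g
      assume g: "g \<in> Arr C" "Dom C g = X" "decidable C (Cod C g)"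
      have "\<exists>!h. h \<in> Hom (Dec C) (on_obj fl X) (Cod C g) \<and> on_arr inclusion h \<cdot> \<eta> X = g"
        using A.unit_universal [of X "Cod C g" g] g X by simp
      then show "\<exists>!h. h \<in> Hom C (Cod C (\<eta> X)) (Cod C g) \<and> h \<cdot> \<eta> X = g"
        using A.unit_arr [OF X] fX g by simp
    qed (use A.unit_arr [OF X] fX in simp_all)
  qed
  have cor: "\<exists>d. coreflection X d" if X: "X \<in> Obj C" for X
  proof
    have fX: "decidable C (on_obj fp X)"
      using A'.right.on_obj_obj [OF X] by simp
    show "coreflection X (\<epsilon>' X)"
      unfolding coreflection_def
    proof (intro conjI allI impI)
      fix g
      assume g: "g \<in> Arr C" "Cod C g = X" "decidable C (Dom C g)"
      obtain h where "h \<in> Hom (Dec C) (Dom C g) (on_obj fp X)" "\<epsilon>' X \<cdot> on_arr inclusion h = g"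
        by (rule A'.counit_factor [of "Dom C g" X g]) (use g X that in auto)
      then show "g \<sqsubseteq> \<epsilon>' X"
        using through_Comp [of "\<epsilon>' X" h] A'.counit_arr [OF X] by simp
    qed (use A'.counit_arr [OF X] fX counit [OF X] in simp_all)
  qed
  obtain d B where "coreflection Om d" "is_two C B"
    using cor [OF Om_obj] two_ex by blast
  then show ?thesis
    using DQO_if_reflections refl DSO_if_coreflections [OF D] cor by blast
qed

end

section \<open>Consequences of (DQO) and (DSO)\<close>

locale mclarty_topos = nullstellensatz_topos +
  assumes DQO: "DQO C" and DSO: "DSO C"
begin

text \<open>Both \<open>U\<close> and the identity are decidable subobjects containing all points,
  and the uniqueness in (DSO) identifies them.\<close>

lemma full_if_contains_points:
  assumes A: "decidable C (Cod C U)" and U: "monic C U"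
    and pts: "\<And>x. \<lbrakk>x \<in> Arr C; Dom C x = one; Cod C x = Cod C U\<rbrakk> \<Longrightarrow> x \<sqsubseteq> U"
  shows "Ide C (Cod C U) \<sqsubseteq> U"
proof -
  define A where "A = Cod C U"
  have A': "Cod C U = A" "A \<in> Obj C" "decidable C A"
    using A U by (simp_all add: A_def)
  obtain d where d: "decidable_subobject_of_points C A d"
    and uniq: "\<And>e. decidable_subobject_of_points C A e \<Longrightarrow> same_subobject C e d"
    using DSO A' unfolding DSO_def by blast
  have "decidable_subobject_of_points C A (Ide C A)"
    unfolding decidable_subobject_of_points_def
  proof (intro conjI allI impI)
    fix x
    assume "is_point C A x"
    then show "x \<sqsubseteq> Ide C A"
      using A' through_Comp [of "Ide C A" x] by (auto elim!: is_pointE)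
  qed (use A' monic_Ide in \<open>simp_all add: subobject_iff\<close>)
  then have "Ide C A \<sqsubseteq> d"
    using uniq unfolding same_subobject_def by blast
  moreover have "decidable_subobject_of_points C A U"
    unfolding decidable_subobject_of_points_def
  proof (intro conjI allI impI)
    fix x
    assume "is_point C A x"
    then obtain T u where x: "terminal C T" "x \<in> Arr C" "Dom C x = T" "Cod C x = A"
      and u: "u \<in> Arr C" "Dom C u = T" "Cod C u = one"
      by (rule is_pointE)
    obtain v where v: "v \<in> Arr C" "Dom C v = one" "Cod C v = T"
      using terminal_arrow [OF x(1) one_obj] by blast
    \<comment> \<open>A point may start at any terminal object \<open>T\<close>; the mutually
      inverse arrows \<open>u\<close> and \<open>v\<close> reduce it to a point from
      \<open>one\<close>.\<close>
    have "v \<cdot> u = Ide C T"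
      by (rule terminal_eq [OF x(1)]) (use u v terminal_obj [OF x(1)] in simp_all)
    then have "x = (x \<cdot> v) \<cdot> u"
      using x u v by simp
    moreover have "x \<cdot> v \<sqsubseteq> U"
      using pts x v A' by simp
    ultimately show "x \<sqsubseteq> U"
      using through_precomp [of "x \<cdot> v" U u] U u v x by simp
  qed (use A' U decidable_subobject [of U] in \<open>simp_all add: subobject_iff\<close>)
  then have "d \<sqsubseteq> U"
    using uniq unfolding same_subobject_def by blast
  moreover have "d \<in> Arr C"
    using d by (simp add: decidable_subobject_of_points_def subobject_iff)
  ultimately show ?thesis
    using through_trans [of "Ide C A" d U] U A' by simp
qed

text \<open>To see that \<open>U\<close> and its pseudo-complement cover, points suffice by
  \<open>full_if_contains_points\<close>; by two-valuedness each point lies in \<open>U\<close> or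
  avoids it.\<close>

lemma complemented_if_decidable:
  assumes U: "monic C U" "decidable C (Cod C U)"
  shows "complemented C U"
proof (rule complemented_negI [OF U(1) refl])
  fix k
  assume k: "monic C k" "Cod C k = Cod C U" "U \<sqsubseteq> k"
    and neg: "\<And>w. \<lbrakk>w \<in> Arr C; Cod C w = Cod C U;
      \<And>u. \<lbrakk>u \<in> Arr C; Cod C u = Dom C w; w \<cdot> u \<sqsubseteq> U\<rbrakk> \<Longrightarrow> initial C (Dom C u)\<rbrakk> \<Longrightarrow> w \<sqsubseteq> k"
  have "x \<sqsubseteq> k" if x: "x \<in> Arr C" "Dom C x = one" "Cod C x = Cod C U" for x
  proof -
    obtain r where r: "monic C r" "Cod C r = one"
      and r_iff: "\<And>w. \<lbrakk>w \<in> Arr C; Cod C w = one\<rbrakk> \<Longrightarrow> w \<sqsubseteq> r \<longleftrightarrow> x \<cdot> w \<sqsubseteq> U"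
      by (rule preimage [of x U, unfolded x(2)]) (use x U that in simp_all)
    show ?thesis
    proof (rule truth_value_cases [OF r])
      assume i: "initial C (Dom C r)"
      show ?thesis
      proof (rule neg [OF x(1,3)])
        fix u
        assume u: "u \<in> Arr C" "Cod C u = Dom C x" "x \<cdot> u \<sqsubseteq> U"
        then show "initial C (Dom C u)"
          using r_iff [of u] through_initial_iff [of r u] i r x by simp
      qed
    next
      assume "Ide C one \<sqsubseteq> r"
      then have "x \<sqsubseteq> U"
        using r_iff [of "Ide C one"] x by simp
      then show ?thesis
        using through_trans [of x U k] k U by simp
    qed
  qed
  then show "Ide C (Cod C U) \<sqsubseteq> k"
    using full_if_contains_points [of k] k U by simp
qed

section \<open>The decidable object of points\<close>

definition pts where
  "pts X = (SOME d. decidable_subobject_of_points C X d)"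

lemma pts_props:
  assumes "X \<in> Obj C"
  shows "decidable_subobject_of_points C X (pts X)"
  unfolding pts_def by (rule someI_ex) (use DSO assms in \<open>auto simp: DSO_def\<close>)

lemma pts_arr [simp]:
  assumes "X \<in> Obj C"
  shows "monic C (pts X)" "pts X \<in> Arr C" "Cod C (pts X) = X" "decidable C (Dom C (pts X))"
  using pts_props [OF assms] monic_arr
  by (auto simp: decidable_subobject_of_points_def subobject_iff)

lemma point_through_pts: "\<lbrakk>x \<in> Arr C; Dom C x = one; Cod C x = X\<rbrakk> \<Longrightarrow> x \<sqsubseteq> pts X"
  using pts_props [of X] is_pointI [of x X] Dom_Cod_obj(2) [of x]
  unfolding decidable_subobject_of_points_def by auto

lemma point_factor_pts:
  assumes "x \<in> Arr C" "Dom C x = one" "Cod C x = X"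
  obtains y where "y \<in> Arr C" "Dom C y = one" "Cod C y = Dom C (pts X)" "x = pts X \<cdot> y"
  using point_through_pts [OF assms] assms by (auto elim!: throughE)

text \<open>The preimage of \<open>m\<close> along \<open>g\<close> is a subobject of a decidable
  object, hence everything once it contains the points.\<close>

lemma through_if_points_through:
  assumes g: "g \<in> Arr C" "decidable C (Dom C g)" and m: "monic C m" "Cod C g = Cod C m"
    and pts: "\<And>x. \<lbrakk>x \<in> Arr C; Dom C x = one; Cod C x = Dom C g\<rbrakk> \<Longrightarrow> g \<cdot> x \<sqsubseteq> m"
  shows "g \<sqsubseteq> m"
proof -
  obtain k where k: "monic C k" "Cod C k = Dom C g"
    and k_iff: "\<And>w. \<lbrakk>w \<in> Arr C; Cod C w = Dom C g\<rbrakk> \<Longrightarrow> w \<sqsubseteq> k \<longleftrightarrow> g \<cdot> w \<sqsubseteq> m"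
    by (rule preimage [OF g(1) m], rule that)
  have "Ide C (Dom C g) \<sqsubseteq> k"
    using full_if_contains_points [of k] k k_iff pts g by simp
  then show ?thesis
    using k_iff [of "Ide C (Dom C g)"] g by simp
qed

lemma pts_coreflection:
  assumes "X \<in> Obj C"
  shows "coreflection X (pts X)"
  unfolding coreflection_def
proof (intro conjI allI impI)
  fix g
  assume g: "g \<in> Arr C" "Cod C g = X" "decidable C (Dom C g)"
  show "g \<sqsubseteq> pts X"
    by (rule through_if_points_through, use g assms in simp_all, rule point_through_pts) (use g in simp_all)
qed (use assms in simp_all)

text \<open>If \<open>d\<close> has no lift, the part of \<open>Dom C e\<close> over
  \<open>d\<close> has no points and is empty by (NS). Then \<open>e\<close> lands in the complement
  of \<open>d\<close>, and as an epi it makes that complement everything, so \<open>d\<close> meets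
  its own complement.\<close>

lemma epic_point_lift:
  assumes e: "epic C e" "decidable C (Cod C e)" and d: "d \<in> Arr C" "Dom C d = one" "Cod C d = Cod C e"
  obtains x where "x \<in> Arr C" "Dom C x = one" "Cod C x = Dom C e" "e \<cdot> x = d"
proof (rule ccontr)
  assume "\<not> thesis"
  then have no: False if "x \<in> Arr C" "Dom C x = one" "Cod C x = Dom C e" "e \<cdot> x = d" for x
    using that \<open>\<And>x. \<lbrakk>x \<in> Arr C; Dom C x = one; Cod C x = Dom C e; e \<cdot> x = d\<rbrakk> \<Longrightarrow> thesis\<close> by blast
  define D where "D = Cod C e"
  have D: "Cod C e = D" "D \<in> Obj C" "decidable C D"
    using e by (simp_all add: D_def)
  have "monic C d"
    by (rule monic_from_terminal [OF one_terminal d(1,2)])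
  then obtain v where c: "complements C D d v"
    using complemented_if_decidable [of d] d D by (auto simp: complemented_def)
  note dv = complements_monic [OF c]
  obtain k where k: "monic C k" "Cod C k = Dom C e"
    and k_iff: "\<And>w. \<lbrakk>w \<in> Arr C; Cod C w = Dom C e\<rbrakk> \<Longrightarrow> w \<sqsubseteq> k \<longleftrightarrow> e \<cdot> w \<sqsubseteq> v"
    by (rule preimage [of e v]) (use e D dv that in simp_all)
  have "Ide C (Dom C e) \<sqsubseteq> k"
  proof (rule complements_cover [OF c])
    fix s
    assume s: "s \<in> Arr C" "Cod C s = Dom C e" "e \<cdot> s \<sqsubseteq> d"
    have "initial C (Dom C s)"
    proof (rule ccontr)
      assume "\<not> initial C (Dom C s)"
      then obtain y where y: "y \<in> Arr C" "Dom C y = one" "Cod C y = Dom C s"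
        using point_ex [of "Dom C s"] s by auto
      have "e \<cdot> (s \<cdot> y) \<sqsubseteq> d"
        using through_precomp [OF s(3), of y] d s y e by simp
      moreover have "d \<sqsubseteq> d"
        using through_refl d by simp
      ultimately have "e \<cdot> (s \<cdot> y) = d"
        by (rule through_terminal_eq) (use one_terminal d s y e in simp_all)
      with no [of "s \<cdot> y"] s y show False
        by simp
    qed
    then show "s \<sqsubseteq> k"
      by (rule initial_through) (use s k in simp_all)
  qed (use e D k k_iff in simp_all)
  then have "e \<sqsubseteq> v"
    using k_iff [of "Ide C (Dom C e)"] e by simp
  then have "Ide C D \<sqsubseteq> v"
    using epic_through_monic [of e v] e dv D by simp
  then have "d \<sqsubseteq> v"
    using through_all [of d v] d dv D by simp
  then have "initial C one"
    using complements_disjoint [OF c, of d] through_refl [of d] d D by simp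
  \<comment> \<open>This leaves the degenerate topos, where any arrow out of \<open>one\<close> is a
    lift.\<close>
  moreover obtain u where "u \<in> Arr C" "Dom C u = one" "Cod C u = Dom C e"
    using initial_arrow [OF \<open>initial C one\<close>, of "Dom C e"] e by auto
  ultimately show False
    using no [of u] initial_eq [of one "e \<cdot> u" d] d e by simp
qed

text \<open>In the relation of all \<open>(d, a)\<close> such that every \<open>x\<close> over
  \<open>d\<close> has value \<open>a\<close>, surjectivity on points makes the value unique, and
  \<open>resp\<close> puts \<open>(d, g \<cdot> x)\<close> into it. Both conditions on the first
  projection need only be checked on points, because \<open>D\<close> and \<open>A\<close> are
  decidable.\<close>

lemma factor_points:
  assumes e: "e \<in> Arr C" "decidable C (Cod C e)" and g: "g \<in> Arr C" "Dom C g = Dom C e" "decidable C (Cod C g)"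
    and surj: "\<And>d. \<lbrakk>d \<in> Arr C; Dom C d = one; Cod C d = Cod C e\<rbrakk> \<Longrightarrow>
      \<exists>x. x \<in> Arr C \<and> Dom C x = one \<and> Cod C x = Dom C e \<and> e \<cdot> x = d"
    and resp: "\<And>x y. \<lbrakk>x \<in> Arr C; y \<in> Arr C; Dom C x = one; Dom C y = one; Cod C x = Dom C e; Cod C y = Dom C e;
      e \<cdot> x = e \<cdot> y\<rbrakk> \<Longrightarrow> g \<cdot> x = g \<cdot> y"
  obtains h where "h \<in> Arr C" "Dom C h = Cod C e" "Cod C h = Cod C g" "h \<cdot> e = g"
proof -
  define D where "D = Cod C e"
  define A where "A = Cod C g"
  have D: "Cod C e = D" "D \<in> Obj C" "decidable C D" and A: "Cod C g = A" "A \<in> Obj C" "decidable C A"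
    using e g by (simp_all add: D_def A_def)
  obtain R where R: "monic C R" "Cod C R = Pr D A"
    and R_iff: "\<And>d a. \<lbrakk>d \<in> Arr C; a \<in> Arr C; Dom C d = Dom C a; Cod C d = D; Cod C a = A\<rbrakk> \<Longrightarrow>
      pair d a \<sqsubseteq> R \<longleftrightarrow> (\<forall>x w. x \<in> Arr C \<longrightarrow> w \<in> Arr C \<longrightarrow> Dom C x = Dom C w \<longrightarrow> Cod C x = Dom C e \<longrightarrow>
        Cod C w = Dom C d \<longrightarrow> e \<cdot> x = d \<cdot> w \<longrightarrow> g \<cdot> x = a \<cdot> w)"
    by (rule relation [OF e(1) g(1,2), unfolded D(1) A(1)], rule that)
  \<comment> \<open>The hypothesis speaks of points, whereas \<open>relation\<close> quantifies over
    all generalized elements; decidability of \<open>A\<close> bridges the gap.\<close>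
  have resp': "g \<cdot> x = g \<cdot> y"
    if xy: "x \<in> Arr C" "y \<in> Arr C" "Dom C x = Dom C y" "Cod C x = Dom C e" "Cod C y = Dom C e" "e \<cdot> x = e \<cdot> y" for x y
  proof (rule decidable_eqI [OF A(3)])
    fix z
    assume z: "z \<in> Arr C" "Dom C z = one" "Cod C z = Dom C (g \<cdot> x)"
    have "g \<cdot> (x \<cdot> z) = g \<cdot> (y \<cdot> z)"
      by (rule resp) (use Comp_eq [OF xy(6), of z] xy z e g in simp_all)
    then show "(g \<cdot> x) \<cdot> z = (g \<cdot> y) \<cdot> z"
      using xy z g by simp
  qed (use xy g A in simp_all)
  have dec_R: "decidable C (Dom C R)"
    using decidable_subobject [OF R(1)] decidable_Pr [OF D(3) A(3)] R by simp
  have "monic C (p1 D A \<cdot> R)"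
  proof (rule monic_if_injective_on_points)
    fix a b
    assume "a \<in> Arr C" "b \<in> Arr C" "Dom C a = one" "Dom C b = one" "Cod C a = Dom C (p1 D A \<cdot> R)"
      "Cod C b = Dom C (p1 D A \<cdot> R)" "(p1 D A \<cdot> R) \<cdot> a = (p1 D A \<cdot> R) \<cdot> b"
    then have ab: "a \<in> Arr C" "b \<in> Arr C" "Dom C a = one" "Dom C b = one" "Cod C a = Dom C R" "Cod C b = Dom C R"
      and eq: "p1 D A \<cdot> (R \<cdot> a) = p1 D A \<cdot> (R \<cdot> b)"
      using R D A by simp_all
    define d where "d = p1 D A \<cdot> (R \<cdot> a)"
    define z where "z = p2 D A \<cdot> (R \<cdot> a)"
    define z' where "z' = p2 D A \<cdot> (R \<cdot> b)"
    have dz: "d \<in> Arr C" "Dom C d = one" "Cod C d = D" "z \<in> Arr C" "Dom C z = one" "Cod C z = A"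
      "z' \<in> Arr C" "Dom C z' = one" "Cod C z' = A"
      using ab R D A by (simp_all add: d_def z_def z'_def)
    have Rab: "R \<cdot> a = pair d z" "R \<cdot> b = pair d z'"
      using pair_eta [of "R \<cdot> a" D A] pair_eta [of "R \<cdot> b" D A] ab R D A eq
      by (simp_all add: d_def z_def z'_def)
    then have "pair d z \<sqsubseteq> R" "pair d z' \<sqsubseteq> R"
      using through_Comp [of R a] through_Comp [of R b] ab R by simp_all
    moreover obtain x where x: "x \<in> Arr C" "Dom C x = one" "Cod C x = Dom C e" "e \<cdot> x = d"
      using surj [of d] dz D by auto
    ultimately have "g \<cdot> x = z" "g \<cdot> x = z'"
      using R_iff [of d z, THEN iffD1, rule_format, of x "Ide C one"]
        R_iff [of d z', THEN iffD1, rule_format, of x "Ide C one"] dz by simp_all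
    then have "R \<cdot> a = R \<cdot> b"
      using Rab by simp
    then show "a = b"
      by - (rule monicD [OF R(1)], use ab in simp_all)
  qed (use R D A dec_R in simp_all)
  moreover have "Ide C (Cod C (p1 D A \<cdot> R)) \<sqsubseteq> p1 D A \<cdot> R"
  proof (rule full_if_contains_points)
    fix d
    assume "d \<in> Arr C" "Dom C d = one" "Cod C d = Cod C (p1 D A \<cdot> R)"
    then have d: "d \<in> Arr C" "Dom C d = one" "Cod C d = D"
      using R D A by simp_all
    obtain x where x: "x \<in> Arr C" "Dom C x = one" "Cod C x = Dom C e" "e \<cdot> x = d"
      using surj [of d] d D by auto
    have "pair d (g \<cdot> x) \<sqsubseteq> R"
    proof (rule R_iff [THEN iffD2], goal_cases)
      case 6
      show ?case
      proof (intro allI impI)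
        fix y w
        assume yw: "y \<in> Arr C" "w \<in> Arr C" "Dom C y = Dom C w" "Cod C y = Dom C e" "Cod C w = Dom C d" "e \<cdot> y = d \<cdot> w"
        have "g \<cdot> y = g \<cdot> (x \<cdot> w)"
          by (rule resp') (use yw x d Comp_eq [OF x(4), of w] e in simp_all)
        then show "g \<cdot> y = (g \<cdot> x) \<cdot> w"
          using yw x d g by simp
      qed
    qed (use d x g A in simp_all)
    then show "d \<sqsubseteq> p1 D A \<cdot> R"
      using through_relation [of R d "g \<cdot> x"] R d x g A by simp
  qed (use calculation R D A in simp_all)
  ultimately obtain h where h: "h \<in> Arr C" "Dom C h = D" "Cod C h = A"
    and h_eq: "\<And>y z. \<lbrakk>y \<in> Arr C; z \<in> Arr C; Dom C y = Dom C z; Cod C y = D; Cod C z = A; pair y z \<sqsubseteq> R\<rbrakk> \<Longrightarrow> h \<cdot> y = z"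
    by - (rule functional_relation [of D A R], use R D A that in simp_all)
  have "pair e g \<sqsubseteq> R"
  proof (rule R_iff [THEN iffD2], goal_cases)
    case 6
    show ?case
      by (intro allI impI, rule resp') simp_all
  qed (use e g D A in simp_all)
  then have "h \<cdot> e = g"
    using h_eq [of e g] e g D A by simp
  with h that D A show ?thesis
    by simp
qed

section \<open>The decidable quotient as a reflection\<close>

definition quo where
  "quo X = (SOME p. decidable_quotient C X p)"

lemma quo_props:
  assumes "X \<in> Obj C"
  shows "decidable_quotient C X (quo X)"
  unfolding quo_def by (rule someI_ex) (use DQO assms in \<open>auto simp: DQO_def\<close>)

lemma quo_arr [simp]:
  assumes "X \<in> Obj C"
  shows "epic C (quo X)" "quo X \<in> Arr C" "Dom C (quo X) = X" "decidable C (Cod C (quo X))"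
    "Cod C (quo X) \<in> Obj C"
  using quo_props [OF assms] epic_arr [of "quo X"] decidable_obj unfolding decidable_quotient_def by blast+

lemma quo_reflection:
  assumes X: "X \<in> Obj C"
  shows "reflection X (quo X)"
  unfolding reflection_def
proof (intro conjI allI impI)
  fix g
  assume g: "g \<in> Arr C" "Dom C g = X" "decidable C (Cod C g)"
  obtain B where B: "is_two C B"
    and fac: "\<And>f. f \<in> Hom C X B \<Longrightarrow> \<exists>!h. h \<in> Hom C (Cod C (quo X)) B \<and> h \<cdot> quo X = f"
    using quo_props [OF X] unfolding decidable_quotient_def by blast
  have surj: "\<exists>x. x \<in> Arr C \<and> Dom C x = one \<and> Cod C x = Dom C (quo X) \<and> quo X \<cdot> x = d"
    if d: "d \<in> Arr C" "Dom C d = one" "Cod C d = Cod C (quo X)" for d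
    using epic_point_lift [of "quo X" d] X d by auto
  \<comment> \<open>For each map \<open>\<chi>\<close> to \<open>2\<close> the composite
    \<open>\<chi> \<cdot> g\<close> factors through \<open>quo X\<close>, so it cannot distinguish
    \<open>x\<close> from \<open>y\<close>; such maps separate points of
    \<open>Cod C g\<close>.\<close>
  have resp: "g \<cdot> x = g \<cdot> y"
    if xy: "x \<in> Arr C" "y \<in> Arr C" "Dom C x = one" "Dom C y = one" "Cod C x = Dom C (quo X)" "Cod C y = Dom C (quo X)"
      "quo X \<cdot> x = quo X \<cdot> y" for x y
  proof (rule separated_by_two [OF g(3) B])
    fix \<chi>
    assume \<chi>: "\<chi> \<in> Arr C" "Dom C \<chi> = Cod C g" "Cod C \<chi> = B"
    obtain k where "k \<in> Hom C (Cod C (quo X)) B" and eq: "k \<cdot> quo X = \<chi> \<cdot> g"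
      using fac [of "\<chi> \<cdot> g"] \<chi> g by auto
    then have k: "k \<in> Arr C" "Dom C k = Cod C (quo X)" "Cod C k = B"
      by simp_all
    have "\<chi> \<cdot> (g \<cdot> x) = k \<cdot> (quo X \<cdot> x)"
      using Comp_eq [OF eq, of x] k xy(1-6) X g \<chi> by simp
    also have "\<dots> = \<chi> \<cdot> (g \<cdot> y)"
      unfolding xy(7) using Comp_eq [OF eq, of y] k xy(1-6) X g \<chi> by simp
    finally show "\<chi> \<cdot> (g \<cdot> x) = \<chi> \<cdot> (g \<cdot> y)" .
  qed (use xy X g in simp_all)
  obtain h where h: "h \<in> Arr C" "Dom C h = Cod C (quo X)" "Cod C h = Cod C g" "h \<cdot> quo X = g"
  proof (rule factor_points [of "quo X" g], goal_cases)
    case (6 d)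
    show ?case
      by (rule surj) (rule 6)+
  next
    case (7 x y)
    show ?case
      by (rule resp) (rule 7)+
  next
    case (8 h)
    show ?case
      by (rule that) (rule 8)+
  qed (use X g in simp_all)
  show "\<exists>!h. h \<in> Hom C (Cod C (quo X)) (Cod C g) \<and> h \<cdot> quo X = g"
  proof (rule ex1I)
    show "h \<in> Hom C (Cod C (quo X)) (Cod C g) \<and> h \<cdot> quo X = g"
      using h by simp
    show "h' = h" if "h' \<in> Hom C (Cod C (quo X)) (Cod C g) \<and> h' \<cdot> quo X = g" for h'
      by (rule epicD [of "quo X"]) (use that h X in simp_all)
  qed
qed (use X in simp_all)

lemma quo_point_lift:
  assumes "X \<in> Obj C" "d \<in> Arr C" "Dom C d = one" "Cod C d = Cod C (quo X)"
  obtains x where "x \<in> Arr C" "Dom C x = one" "Cod C x = X" "quo X \<cdot> x = d"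
  using epic_point_lift [of "quo X" d] assms by auto

lemma two_exists: "\<exists>B. is_two C B"
  using quo_props [OF one_obj] unfolding decidable_quotient_def by blast

section \<open>The topos of decidable objects\<close>

lemma Dec_product:
  assumes P: "is_product C X Y P p q" and XY: "decidable C X" "decidable C Y"
  shows "is_product (Dec C) X Y P p q"
proof -
  interpret D: category "Dec C"
    by (rule Dec_category)
  note pq = is_productD [OF P] and dec = decidable_product [OF P XY]
  show ?thesis
  proof (rule D.is_productI, goal_cases)
    case (7 f g)
    then have fg: "f \<in> Arr C" "g \<in> Arr C" "Dom C f = Dom C g" "Cod C f = X" "Cod C g = Y" "decidable C (Dom C g)"
      by simp_all
    obtain h where "h \<in> Arr C" "Dom C h = Dom C f" "Cod C h = P" "p \<cdot> h = f" "q \<cdot> h = g"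
      by (rule is_product_pair [OF P fg(1-5)], rule that)
    then show ?case
      using fg dec by (intro exI [of _ h]) simp
  next
    case (8 f g)
    then show ?case
      by - (rule is_product_eq [OF P], simp_all)
  qed (use pq XY dec in simp_all)
qed

text \<open>Since \<open>one\<close> is decidable, points are among the test arrows in
  \<open>Dec C\<close>.\<close>

lemma Dec_monic:
  assumes "monic (Dec C) m"
  shows "monic C m"
proof (rule monic_if_injective_on_points)
  interpret D: category "Dec C"
    by (rule Dec_category)
  have m: "m \<in> Arr C" "decidable C (Dom C m)"
    using D.monic_arr [OF assms] by simp_all
  show "m \<in> Arr C" "decidable C (Dom C m)"
    using m by simp_all
  fix x y
  assume "x \<in> Arr C" "y \<in> Arr C" "Dom C x = one" "Dom C y = one" "Cod C x = Dom C m" "Cod C y = Dom C m"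
    "m \<cdot> x = m \<cdot> y"
  then show "x = y"
    using m decidable_one by - (rule D.monicD [OF assms], simp_all)
qed

text \<open>Test objects in \<open>Dec C\<close> are decidable, so factoring through
  \<open>i\<close> or \<open>m\<close> is a question about points; conversely \<open>one\<close> is
  itself such a test object.\<close>

lemma Dec_pullback_iff:
  assumes c: "complements C B i j" and T: "terminal C (Dom C i)"
    and m: "monic C m" "decidable C (Dom C m)" "decidable C (Cod C m)"
    and \<chi>: "\<chi> \<in> Arr C" "Dom C \<chi> = Cod C m" "Cod C \<chi> = B" and B: "decidable C B"
  shows "(\<exists>u\<in>Hom (Dec C) (Dom C m) (Dom C i). is_pullback (Dec C) \<chi> i m u) \<longleftrightarrow>
    (\<forall>x. x \<in> Arr C \<longrightarrow> Dom C x = one \<longrightarrow> Cod C x = Cod C m \<longrightarrow> (\<chi> \<cdot> x \<sqsubseteq> i \<longleftrightarrow> x \<sqsubseteq> m))"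
    (is "?L \<longleftrightarrow> ?R")
proof
  note ij = complements_monic [OF c] and decT = decidable_terminal [OF T]
  show ?R if L: ?L
  proof (intro allI impI)
    obtain u where u: "u \<in> Arr C" "Dom C u = Dom C m" "Cod C u = Dom C i" and pb: "is_pullback (Dec C) \<chi> i m u"
      using L by auto
    have eq: "\<chi> \<cdot> m = i \<cdot> u"
      using pb by (simp add: is_pullback_def)
    fix x
    assume x: "x \<in> Arr C" "Dom C x = one" "Cod C x = Cod C m"
    show "\<chi> \<cdot> x \<sqsubseteq> i \<longleftrightarrow> x \<sqsubseteq> m"
    proof
      assume "\<chi> \<cdot> x \<sqsubseteq> i"
      then obtain b where b: "b \<in> Arr C" "Dom C b = one" "Cod C b = Dom C i" "\<chi> \<cdot> x = i \<cdot> b"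
        by (rule throughE) (use x \<chi> in simp)
      then have "\<exists>!h. h \<in> Hom (Dec C) one (Dom C m) \<and> m \<cdot> h = x \<and> u \<cdot> h = b"
        using pb x \<chi> m decidable_one decT unfolding is_pullback_def by simp
      then show "x \<sqsubseteq> m"
        using x by (auto simp: through_iff)
    next
      assume "x \<sqsubseteq> m"
      then obtain h where h: "h \<in> Arr C" "Dom C h = one" "Cod C h = Dom C m" "m \<cdot> h = x"
        by (rule throughE) (use x in simp)
      then have "\<chi> \<cdot> x = i \<cdot> (u \<cdot> h)"
        using Comp_eq [OF eq, of h] \<chi> m u ij by simp
      then show "\<chi> \<cdot> x \<sqsubseteq> i"
        using through_Comp [of i "u \<cdot> h"] u h ij by simp
    qed
  qed
  show ?L if R: ?R
  proof -
    obtain u where u: "u \<in> Arr C" "Dom C u = Dom C m" "Cod C u = Dom C i"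
      using terminal_arrow [OF T, of "Dom C m"] m by auto
    have "\<chi> \<cdot> m \<sqsubseteq> i"
    proof (rule through_if_points_through)
      fix x
      assume "x \<in> Arr C" "Dom C x = one" "Cod C x = Dom C (\<chi> \<cdot> m)"
      then have x: "x \<in> Arr C" "Dom C x = one" "Cod C x = Dom C m"
        using \<chi> m by simp_all
      then show "(\<chi> \<cdot> m) \<cdot> x \<sqsubseteq> i"
        using R [rule_format, of "m \<cdot> x"] through_Comp [of m x] \<chi> m by simp
    qed (use \<chi> m ij in simp_all)
    moreover have "i \<cdot> u \<sqsubseteq> i"
      using through_Comp [of i u] u ij by simp
    ultimately have eq: "\<chi> \<cdot> m = i \<cdot> u"
      by (rule through_terminal_eq) (use T \<chi> m u ij in simp_all)
    have "is_pullback (Dec C) \<chi> i m u"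
      unfolding is_pullback_def
    proof (intro conjI ballI impI)
      fix Z a b
      assume "Z \<in> Obj (Dec C)" "a \<in> Hom (Dec C) Z (Dom (Dec C) \<chi>)" "b \<in> Hom (Dec C) Z (Dom (Dec C) i)"
        "\<chi> \<cdot>\<^bsub>Dec C\<^esub> a = i \<cdot>\<^bsub>Dec C\<^esub> b"
      then have Z: "decidable C Z" and a: "a \<in> Arr C" "Dom C a = Z" "Cod C a = Cod C m"
        and b: "b \<in> Arr C" "Dom C b = Z" "Cod C b = Dom C i" and ab: "\<chi> \<cdot> a = i \<cdot> b"
        using \<chi> by simp_all
      have "a \<sqsubseteq> m"
      proof (rule through_if_points_through)
        fix x
        assume x: "x \<in> Arr C" "Dom C x = one" "Cod C x = Dom C a"
        have "\<chi> \<cdot> (a \<cdot> x) \<sqsubseteq> i"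
          using Comp_eq [OF ab, of x] through_Comp [of i "b \<cdot> x"] x a b \<chi> ij by simp
        then show "a \<cdot> x \<sqsubseteq> m"
          using R [rule_format, of "a \<cdot> x"] x a by simp
      qed (use a Z m in simp_all)
      then obtain h where h: "h \<in> Arr C" "Dom C h = Z" "Cod C h = Dom C m" "m \<cdot> h = a"
        by (rule throughE) (use a in simp)
      show "\<exists>!h. h \<in> Hom (Dec C) Z (Dom (Dec C) m) \<and> m \<cdot>\<^bsub>Dec C\<^esub> h = a \<and> u \<cdot>\<^bsub>Dec C\<^esub> h = b"
      proof (rule ex1I [of _ h])
        have "u \<cdot> h = b"
          by (rule terminal_eq [OF T]) (use u h b in simp_all)
        then show "h \<in> Hom (Dec C) Z (Dom (Dec C) m) \<and> m \<cdot>\<^bsub>Dec C\<^esub> h = a \<and> u \<cdot>\<^bsub>Dec C\<^esub> h = b"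
          using h Z m by simp
        show "h' = h" if "h' \<in> Hom (Dec C) Z (Dom (Dec C) m) \<and> m \<cdot>\<^bsub>Dec C\<^esub> h' = a \<and> u \<cdot>\<^bsub>Dec C\<^esub> h' = b" for h'
          by (rule monicD [OF m(1)]) (use that h in simp_all)
      qed
    qed (use \<chi> B m u ij decT eq in simp_all)
    then show ?thesis
      using u m decT by (intro bexI [of _ u]) simp_all
  qed
qed

text \<open>The characteristic arrow is glued from \<open>i\<close> on \<open>m\<close> and
  \<open>j\<close> on the complement of \<open>m\<close>. It is unique because each of its values at
  points lies in \<open>i\<close> or in \<open>j\<close>, and which of the two is decided by
  \<open>m\<close>.\<close>

lemma Dec_subobject_classifier:
  assumes c: "complements C B i j" and T: "terminal C (Dom C i)" "terminal C (Dom C j)"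
  shows "is_subobject_classifier (Dec C) (Dom C i) B i"
  unfolding is_subobject_classifier_def
proof (intro conjI allI impI)
  note ij = complements_monic [OF c] and decT = decidable_terminal [OF T(1)]
  have B: "decidable C B"
    by (rule decidable_if_terminal_complements [OF c T])
  show "terminal (Dec C) (Dom C i)"
    using T(1) decT decidable_obj by (simp add: terminal_def)
  show "i \<in> Hom (Dec C) (Dom C i) B"
    using ij decT B by simp
  fix m
  assume m': "monic (Dec C) m"
  interpret D: category "Dec C"
    by (rule Dec_category)
  have m: "monic C m" "decidable C (Dom C m)" "decidable C (Cod C m)"
    using Dec_monic [OF m'] D.monic_arr [OF m'] by simp_all
  define A where "A = Cod C m"
  have A: "Cod C m = A" "decidable C A"
    using m by (simp_all add: A_def)
  obtain v where v: "complements C A m v"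
    using complemented_if_decidable [OF m(1,3)] A by (auto simp: complemented_def)
  note mv = complements_monic [OF v]
  obtain s where s: "s \<in> Arr C" "Dom C s = Dom C m" "Cod C s = Dom C i"
    using terminal_arrow [OF T(1), of "Dom C m"] m by auto
  obtain t where t: "t \<in> Arr C" "Dom C t = Dom C v" "Cod C t = Dom C j"
    using terminal_arrow [OF T(2), of "Dom C v"] mv by auto
  obtain \<chi> where \<chi>: "\<chi> \<in> Arr C" "Dom C \<chi> = A" "Cod C \<chi> = B" "\<chi> \<cdot> m = i \<cdot> s" "\<chi> \<cdot> v = j \<cdot> t"
    by (rule copair [OF v, of "i \<cdot> s" "j \<cdot> t"]) (use ij s t that in simp_all)
  have iff: "\<forall>x. x \<in> Arr C \<longrightarrow> Dom C x = one \<longrightarrow> Cod C x = Cod C m \<longrightarrow> (\<chi> \<cdot> x \<sqsubseteq> i \<longleftrightarrow> x \<sqsubseteq> m)"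
  proof (intro allI impI iffI)
    fix x
    assume x: "x \<in> Arr C" "Dom C x = one" "Cod C x = Cod C m" "x \<sqsubseteq> m"
    from x(4) obtain y where y: "y \<in> Arr C" "Dom C y = one" "Cod C y = Dom C m" "m \<cdot> y = x"
      by (rule throughE) (use x in simp)
    then have "\<chi> \<cdot> x = i \<cdot> (s \<cdot> y)"
      using Comp_eq [OF \<chi>(4), of y] \<chi>(1-3) s ij m A by simp
    then show "\<chi> \<cdot> x \<sqsubseteq> i"
      using through_Comp [of i "s \<cdot> y"] s y ij by simp
  next
    fix x
    assume x: "x \<in> Arr C" "Dom C x = one" "Cod C x = Cod C m" "\<chi> \<cdot> x \<sqsubseteq> i"
    consider "x \<sqsubseteq> m" | "x \<sqsubseteq> v"
      using point_complements [OF v, of x] x A by auto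
    then show "x \<sqsubseteq> m"
    proof cases
      \<comment> \<open>A value in both \<open>i\<close> and \<open>j\<close> forces the degenerate
        topos, where every point factors through \<open>m\<close>.\<close>
      case 2
      then obtain y where y: "y \<in> Arr C" "Dom C y = one" "Cod C y = Dom C v" "v \<cdot> y = x"
        by (rule throughE) (use x in simp)
      then have "\<chi> \<cdot> x = j \<cdot> (t \<cdot> y)"
        using Comp_eq [OF \<chi>(5), of y] \<chi>(1-3) t ij mv by simp
      then have "\<chi> \<cdot> x \<sqsubseteq> j"
        using through_Comp [of j "t \<cdot> y"] t y ij by simp
      then have "initial C one"
        using complements_disjoint [OF c, of "\<chi> \<cdot> x"] x \<chi>(1-3) A by simp
      then show ?thesis
        by - (rule initial_through, use x m in simp_all)
    qed
  qed
  show "\<exists>!\<chi>. \<chi> \<in> Hom (Dec C) (Cod (Dec C) m) B \<and>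
    (\<exists>u\<in>Hom (Dec C) (Dom (Dec C) m) (Dom C i). is_pullback (Dec C) \<chi> i m u)"
  proof (rule ex1I [of _ \<chi>])
    show "\<chi> \<in> Hom (Dec C) (Cod (Dec C) m) B \<and>
      (\<exists>u\<in>Hom (Dec C) (Dom (Dec C) m) (Dom C i). is_pullback (Dec C) \<chi> i m u)"
      using Dec_pullback_iff [OF c T(1) m, of \<chi>] iff \<chi> A B by simp
  next
    fix \<chi>'
    assume \<chi>': "\<chi>' \<in> Hom (Dec C) (Cod (Dec C) m) B \<and>
      (\<exists>u\<in>Hom (Dec C) (Dom (Dec C) m) (Dom C i). is_pullback (Dec C) \<chi>' i m u)"
    then have h: "\<chi>' \<in> Arr C" "Dom C \<chi>' = A" "Cod C \<chi>' = B"
      using A by simp_all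
    have iff': "\<forall>x. x \<in> Arr C \<longrightarrow> Dom C x = one \<longrightarrow> Cod C x = Cod C m \<longrightarrow> (\<chi>' \<cdot> x \<sqsubseteq> i \<longleftrightarrow> x \<sqsubseteq> m)"
      using Dec_pullback_iff [OF c T(1) m, of \<chi>'] \<chi>' h A B by simp
    show "\<chi>' = \<chi>"
    proof (rule decidable_eqI [OF B])
      fix x
      assume "x \<in> Arr C" "Dom C x = one" "Cod C x = Dom C \<chi>'"
      then have x: "x \<in> Arr C" "Dom C x = one" "Cod C x = A"
        using h by simp_all
      consider "\<chi> \<cdot> x \<sqsubseteq> i" "\<chi>' \<cdot> x \<sqsubseteq> i" | "\<chi> \<cdot> x \<sqsubseteq> j" "\<chi>' \<cdot> x \<sqsubseteq> j"
        using iff iff' point_complements [OF c, of "\<chi> \<cdot> x"] point_complements [OF c, of "\<chi>' \<cdot> x"] x h \<chi>(1-3) A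
        by auto
      then show "\<chi>' \<cdot> x = \<chi> \<cdot> x"
      proof cases
        case 1
        show ?thesis
          by (rule through_terminal_eq [OF 1(2,1) _ T(1)]) (use x h \<chi>(1-3) in simp)
      next
        case 2
        show ?thesis
          by (rule through_terminal_eq [OF 2(2,1) _ T(2)]) (use x h \<chi>(1-3) in simp)
      qed
    qed (use h \<chi> in simp_all)
  qed
qed

text \<open>The exponential is the coreflection of the exponential \<open>W0\<close> formed in
  \<open>C\<close>: transposes from decidable objects factor through it.\<close>

lemma Dec_exponential:
  assumes Y: "decidable C Y" and Z: "decidable C Z"
  shows "\<exists>W P p q ev. is_exponential (Dec C) Y Z W P p q ev"
proof -
  interpret D: category "Dec C"
    by (rule Dec_category)
  note obj [simp] = decidable_obj [OF Y] decidable_obj [OF Z]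
  obtain W0 ev where W0: "W0 \<in> Obj C" and ev: "ev \<in> Arr C" "Dom C ev = Pr W0 Y" "Cod C ev = Z"
    and cur: "\<And>X f. \<lbrakk>X \<in> Obj C; f \<in> Arr C; Dom C f = Pr X Y; Cod C f = Z\<rbrakk> \<Longrightarrow>
      \<exists>h. h \<in> Arr C \<and> Dom C h = X \<and> Cod C h = W0 \<and>
        (\<forall>x y. x \<in> Arr C \<longrightarrow> y \<in> Arr C \<longrightarrow> Dom C x = Dom C y \<longrightarrow> Cod C x = X \<longrightarrow> Cod C y = Y \<longrightarrow>
          ev \<cdot> pair (h \<cdot> x) y = f \<cdot> pair x y)"
    and ext: "\<And>g h. \<lbrakk>g \<in> Arr C; h \<in> Arr C; Dom C g = Dom C h; Cod C g = W0; Cod C h = W0;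
      \<And>x y. \<lbrakk>x \<in> Arr C; y \<in> Arr C; Dom C x = Dom C y; Cod C x = Dom C g; Cod C y = Y\<rbrakk>
        \<Longrightarrow> ev \<cdot> pair (g \<cdot> x) y = ev \<cdot> pair (h \<cdot> x) y\<rbrakk> \<Longrightarrow> g = h"
    using exponential [OF obj] by blast
  define c where "c = pts W0"
  define W where "W = Dom C c"
  have c: "monic C c" "c \<in> Arr C" "Dom C c = W" "Cod C c = W0" "decidable C W" "W \<in> Obj C"
    using W0 decidable_obj by (simp_all add: c_def W_def)
  define ev' where "ev' = ev \<cdot> pair (c \<cdot> p1 W Y) (p2 W Y)"
  have ev': "ev' \<in> Arr C" "Dom C ev' = Pr W Y" "Cod C ev' = Z"
    using ev c W0 by (simp_all add: ev'_def)
  have ev'_pair: "ev' \<cdot> pair x y = ev \<cdot> pair (c \<cdot> x) y"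
    if "x \<in> Arr C" "y \<in> Arr C" "Dom C x = Dom C y" "Cod C x = W" "Cod C y = Y" for x y
    using that ev c W0 by (simp add: ev'_def)
  have "is_exponential (Dec C) Y Z W (Pr W Y) (p1 W Y) (p2 W Y) ev'"
    unfolding is_exponential_def
  proof (intro conjI allI impI ballI)
    show "is_product (Dec C) W Y (Pr W Y) (p1 W Y) (p2 W Y)"
      using Dec_product [OF Pr_is_product] c Y by simp
    show "ev' \<in> Hom (Dec C) (Pr W Y) Z"
      using ev' c Y Z decidable_Pr by simp
    fix X Q a b f
    assume Q: "is_product (Dec C) X Y Q a b" and f': "f \<in> Hom (Dec C) Q Z"
    have ab: "a \<in> Arr C" "Dom C a = Q" "Cod C a = X" "b \<in> Arr C" "Dom C b = Q" "Cod C b = Y"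
      and X: "decidable C X" and decQ: "decidable C Q"
      using D.is_productD [OF Q] by auto
    have f: "f \<in> Arr C" "Dom C f = Q" "Cod C f = Z"
      using f' by simp_all
    have obj' [simp]: "X \<in> Obj C" "Q \<in> Obj C"
      using decidable_obj X decQ by simp_all
    have decP: "decidable C (Pr X Y)"
      using decidable_Pr X Y by simp
    \<comment> \<open>The product \<open>Q\<close> is a product only among decidable objects;
      \<open>u\<close> compares it with \<open>Pr X Y\<close>, which is decidable and so may serve
      as a test object.\<close>
    obtain u where "u \<in> Arr (Dec C)" "Dom (Dec C) u = Dom (Dec C) (p1 X Y)" "Cod (Dec C) u = Q"
      "a \<cdot>\<^bsub>Dec C\<^esub> u = p1 X Y" "b \<cdot>\<^bsub>Dec C\<^esub> u = p2 X Y"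
      by (rule D.is_product_pair [OF Q, of "p1 X Y" "p2 X Y"]) (use X Y decP in auto)
    then have u: "u \<in> Arr C" "Dom C u = Pr X Y" "Cod C u = Q" "a \<cdot> u = p1 X Y" "b \<cdot> u = p2 X Y"
      by simp_all
    have au: "a \<cdot> (u \<cdot> w) = p1 X Y \<cdot> w" "b \<cdot> (u \<cdot> w) = p2 X Y \<cdot> w" if "w \<in> Arr C" "Cod C w = Pr X Y" for w
      using Comp_eq [OF u(4), of w] Comp_eq [OF u(5), of w] that u(1-3) ab by simp_all
    have u_ab: "u \<cdot> pair a b = Ide C Q"
      using D.is_product_eq [OF Q, of "u \<cdot> pair a b" "Ide C Q"] au [of "pair a b"] u(1-3) ab decQ by simp
    obtain h0 where h0: "h0 \<in> Arr C" "Dom C h0 = X" "Cod C h0 = W0"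
      "\<And>x y. \<lbrakk>x \<in> Arr C; y \<in> Arr C; Dom C x = Dom C y; Cod C x = X; Cod C y = Y\<rbrakk> \<Longrightarrow>
        ev \<cdot> pair (h0 \<cdot> x) y = (f \<cdot> u) \<cdot> pair x y"
      using cur [of X "f \<cdot> u"] f u(1-3) by auto
    have "h0 \<sqsubseteq> c"
      using pts_coreflection [OF W0] h0(1-3) X unfolding coreflection_def c_def by simp
    then obtain h where h: "h \<in> Arr C" "Dom C h = X" "Cod C h = W" "c \<cdot> h = h0"
      by (rule throughE) (use h0(2) c in simp)
    show "\<exists>!h. h \<in> Hom (Dec C) X W \<and> (\<exists>k\<in>Hom (Dec C) Q (Pr W Y).
      p1 W Y \<cdot>\<^bsub>Dec C\<^esub> k = h \<cdot>\<^bsub>Dec C\<^esub> a \<and> p2 W Y \<cdot>\<^bsub>Dec C\<^esub> k = b \<and> ev' \<cdot>\<^bsub>Dec C\<^esub> k = f)"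
    proof (rule ex1I [of _ h])
      have "ev' \<cdot> pair (h \<cdot> a) b = ev \<cdot> pair (h0 \<cdot> a) b"
        using ev'_pair [of "h \<cdot> a" b] Comp_eq [OF h(4), of a] h(1-3) ab c by simp
      also have "\<dots> = f"
        using h0(4) [of a b] u_ab ab f u(1-3) by simp
      finally have "ev' \<cdot> pair (h \<cdot> a) b = f" .
      then show "h \<in> Hom (Dec C) X W \<and> (\<exists>k\<in>Hom (Dec C) Q (Pr W Y).
        p1 W Y \<cdot>\<^bsub>Dec C\<^esub> k = h \<cdot>\<^bsub>Dec C\<^esub> a \<and> p2 W Y \<cdot>\<^bsub>Dec C\<^esub> k = b \<and> ev' \<cdot>\<^bsub>Dec C\<^esub> k = f)"
        using h(1-3) ab c X Y decQ decidable_Pr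
        by (intro conjI bexI [of _ "pair (h \<cdot> a) b"]) simp_all
    next
      fix h'
      assume "h' \<in> Hom (Dec C) X W \<and> (\<exists>k\<in>Hom (Dec C) Q (Pr W Y).
        p1 W Y \<cdot>\<^bsub>Dec C\<^esub> k = h' \<cdot>\<^bsub>Dec C\<^esub> a \<and> p2 W Y \<cdot>\<^bsub>Dec C\<^esub> k = b \<and> ev' \<cdot>\<^bsub>Dec C\<^esub> k = f)"
      then obtain k where h': "h' \<in> Arr C" "Dom C h' = X" "Cod C h' = W"
        and k: "k \<in> Arr C" "Dom C k = Q" "Cod C k = Pr W Y" "p1 W Y \<cdot> k = h' \<cdot> a" "p2 W Y \<cdot> k = b" "ev' \<cdot> k = f"
        by auto
      have k_eq: "k = pair (h' \<cdot> a) b"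
        using pair_eta [of k W Y] k c by simp
      have "c \<cdot> h' = h0"
      proof (rule ext)
        fix x y
        assume "x \<in> Arr C" "y \<in> Arr C" "Dom C x = Dom C y" "Cod C x = Dom C (c \<cdot> h')" "Cod C y = Y"
        then have xy: "x \<in> Arr C" "y \<in> Arr C" "Dom C x = Dom C y" "Cod C x = X" "Cod C y = Y"
          using h' c by simp_all
        define w where "w = u \<cdot> pair x y"
        have w: "w \<in> Arr C" "Dom C w = Dom C y" "Cod C w = Q" "a \<cdot> w = x" "b \<cdot> w = y"
          using xy u(1-3) au [of "pair x y"] by (simp_all add: w_def)
        have "ev \<cdot> pair ((c \<cdot> h') \<cdot> x) y = ev' \<cdot> (k \<cdot> w)"
          using ev'_pair [of "h' \<cdot> x" y] w(1-3) Comp_eq [of h' a "h' \<cdot> a" w] xy h' c ab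
          by (simp add: k_eq w(4,5))
        also have "\<dots> = f \<cdot> (u \<cdot> pair x y)"
          using Comp_eq [OF k(6), of w] k(1-3) w(1-3) ev' by (simp add: w_def)
        also have "\<dots> = ev \<cdot> pair (h0 \<cdot> x) y"
          using h0(4) [OF xy] xy f u(1-3) by simp
        finally show "ev \<cdot> pair ((c \<cdot> h') \<cdot> x) y = ev \<cdot> pair (h0 \<cdot> x) y" .
      qed (use h' c h0 in simp_all)
      then show "h' = h"
        by - (rule monicD [OF c(1)], use h h' c in simp_all)
    qed
  qed
  then show ?thesis
    by blast
qed

text \<open>Finite limits are those of \<open>C\<close>, by closure under subobjects and products.
  The exponentials have to be coreflected, and the classifier becomes \<open>2\<close>.\<close>

lemma Dec_topos: "elementary_topos (Dec C)"
proof (rule elementary_topos.intro [OF Dec_category], unfold_locales)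
  have "terminal (Dec C) one"
    using one_terminal decidable_one decidable_obj by (simp add: terminal_def)
  then show "\<exists>T. terminal (Dec C) T"
    by blast
  show "\<exists>P p q. is_product (Dec C) X Y P p q" if "X \<in> Obj (Dec C)" "Y \<in> Obj (Dec C)" for X Y
    using Dec_product [OF Pr_is_product] that decidable_obj by simp blast
  show "\<exists>W P p q ev. is_exponential (Dec C) Y Z W P p q ev" if "Y \<in> Obj (Dec C)" "Z \<in> Obj (Dec C)" for Y Z
    using Dec_exponential that by simp
  obtain B i j where "complements C B i j" "terminal C (Dom C i)" "terminal C (Dom C j)"
    using two_exists is_twoE by metis
  then show "\<exists>T \<Omega> t. is_subobject_classifier (Dec C) T \<Omega> t"
    using Dec_subobject_classifier by blast
  fix f g X Y
  assume "f \<in> Hom (Dec C) X Y" "g \<in> Hom (Dec C) X Y"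
  then have fg: "f \<in> Arr C" "g \<in> Arr C" "Dom C f = X" "Dom C g = X" "Cod C f = Y" "Cod C g = Y"
    "decidable C X" "decidable C Y"
    by simp_all
  obtain e where e: "monic C e" "Cod C e = X"
    and e_iff: "\<And>w. \<lbrakk>w \<in> Arr C; Cod C w = X\<rbrakk> \<Longrightarrow> w \<sqsubseteq> e \<longleftrightarrow> f \<cdot> w = g \<cdot> w"
    by (rule equalizer [of f g]) (use fg that in simp_all)
  have dec: "decidable C (Dom C e)"
    using decidable_subobject [OF e(1)] e fg by simp
  have "is_equalizer (Dec C) f g e"
    unfolding is_equalizer_def
  proof (intro conjI ballI impI)
    show "f \<cdot>\<^bsub>Dec C\<^esub> e = g \<cdot>\<^bsub>Dec C\<^esub> e"
      using e_iff [of e] e through_refl [of e] by simp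
    fix Z k
    assume "Z \<in> Obj (Dec C)" "k \<in> Hom (Dec C) Z (Dom (Dec C) f)" "f \<cdot>\<^bsub>Dec C\<^esub> k = g \<cdot>\<^bsub>Dec C\<^esub> k"
    then have k: "k \<in> Arr C" "Dom C k = Z" "Cod C k = X" "k \<sqsubseteq> e" "decidable C Z"
      using e_iff [of k] fg by simp_all
    from k(4) obtain h where h: "h \<in> Arr C" "Dom C h = Z" "Cod C h = Dom C e" "e \<cdot> h = k"
      by (rule throughE) (use k in simp)
    show "\<exists>!h. h \<in> Hom (Dec C) Z (Dom (Dec C) e) \<and> e \<cdot>\<^bsub>Dec C\<^esub> h = k"
    proof (rule ex1I [of _ h])
      show "h \<in> Hom (Dec C) Z (Dom (Dec C) e) \<and> e \<cdot>\<^bsub>Dec C\<^esub> h = k"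
        using h k dec by simp
      show "h' = h" if "h' \<in> Hom (Dec C) Z (Dom (Dec C) e) \<and> e \<cdot>\<^bsub>Dec C\<^esub> h' = k" for h'
        by (rule monicD [OF e(1)]) (use that h in simp_all)
    qed
  qed (use e fg dec in simp_all)
  then show "\<exists>e. is_equalizer (Dec C) f g e"
    by blast
qed

end

section \<open>Codiscrete objects\<close>

context nullstellensatz_topos
begin

text \<open>This is double negation. At a point the two negations cancel, because subobjects of
  \<open>one\<close> are empty or full; conversely a nonempty part of \<open>w\<close> that avoids
  \<open>m\<close> would have a point lying in \<open>m\<close>.\<close>

lemma closure:
  assumes m: "monic C m"
  obtains c where "monic C c" "Cod C c = Cod C m"
    "\<And>w. \<lbrakk>w \<in> Arr C; Cod C w = Cod C m\<rbrakk> \<Longrightarrow> w \<sqsubseteq> c \<longleftrightarrow>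
      (\<forall>x. x \<in> Arr C \<longrightarrow> Dom C x = one \<longrightarrow> Cod C x = Dom C w \<longrightarrow> w \<cdot> x \<sqsubseteq> m)"
proof -
  obtain v where v: "monic C v" "Cod C v = Cod C m"
    and v_iff: "\<And>w. \<lbrakk>w \<in> Arr C; Cod C w = Cod C m\<rbrakk> \<Longrightarrow> w \<sqsubseteq> v \<longleftrightarrow>
      (\<forall>u. u \<in> Arr C \<longrightarrow> Cod C u = Dom C w \<longrightarrow> w \<cdot> u \<sqsubseteq> m \<longrightarrow> initial C (Dom C u))"
    by (rule negation [OF m], rule that)
  obtain c where c: "monic C c" "Cod C c = Cod C v"
    and c_iff: "\<And>w. \<lbrakk>w \<in> Arr C; Cod C w = Cod C v\<rbrakk> \<Longrightarrow> w \<sqsubseteq> c \<longleftrightarrow>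
      (\<forall>u. u \<in> Arr C \<longrightarrow> Cod C u = Dom C w \<longrightarrow> w \<cdot> u \<sqsubseteq> v \<longrightarrow> initial C (Dom C u))"
    by (rule negation [OF v(1)], rule that)
  show ?thesis
  proof (rule that [OF c(1)])
    fix w
    assume w: "w \<in> Arr C" "Cod C w = Cod C m"
    show "w \<sqsubseteq> c \<longleftrightarrow> (\<forall>x. x \<in> Arr C \<longrightarrow> Dom C x = one \<longrightarrow> Cod C x = Dom C w \<longrightarrow> w \<cdot> x \<sqsubseteq> m)" (is "_ \<longleftrightarrow> ?R")
    proof
      assume wc: "w \<sqsubseteq> c"
      show ?R
      proof (intro allI impI)
        fix x
        assume x: "x \<in> Arr C" "Dom C x = one" "Cod C x = Dom C w"
        obtain r where r: "monic C r" "Cod C r = Dom C (w \<cdot> x)"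
          and r_iff: "\<And>u. \<lbrakk>u \<in> Arr C; Cod C u = Dom C (w \<cdot> x)\<rbrakk> \<Longrightarrow> u \<sqsubseteq> r \<longleftrightarrow> (w \<cdot> x) \<cdot> u \<sqsubseteq> m"
          by (rule preimage [of "w \<cdot> x" m]) (use w x m that in simp_all)
        have r': "Cod C r = one"
          using r w x by simp
        show "w \<cdot> x \<sqsubseteq> m"
        proof (rule truth_value_cases [OF r(1) r'])
          assume i: "initial C (Dom C r)"
          have "w \<cdot> x \<sqsubseteq> v"
          proof (rule v_iff [THEN iffD2], goal_cases)
            case 3
            show ?case
            proof (intro allI impI)
              fix u
              assume u: "u \<in> Arr C" "Cod C u = Dom C (w \<cdot> x)" "(w \<cdot> x) \<cdot> u \<sqsubseteq> m"
              then have "u \<sqsubseteq> r"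
                using r_iff by blast
              then show "initial C (Dom C u)"
                using through_initial_iff [of r u] i r u by simp
            qed
          qed (use w x in simp_all)
          then have "initial C one"
            using c_iff [of w, THEN iffD1, rule_format, of x] wc w x v by simp
          then show ?thesis
            by - (rule initial_through, use w x m in simp_all)
        next
          assume "Ide C one \<sqsubseteq> r"
          then show ?thesis
            using r_iff [of "Ide C one"] w x by simp
        qed
      qed
    next
      assume R: ?R
      show "w \<sqsubseteq> c"
      proof (rule c_iff [THEN iffD2], goal_cases)
        case 3
        show ?case
        proof (intro allI impI, rule ccontr)
          fix u
          assume u: "u \<in> Arr C" "Cod C u = Dom C w" "w \<cdot> u \<sqsubseteq> v" "\<not> initial C (Dom C u)"
          then obtain y where y: "y \<in> Arr C" "Dom C y = one" "Cod C y = Dom C u"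
            using point_ex [of "Dom C u"] by auto
          have "w \<cdot> (u \<cdot> y) \<sqsubseteq> m"
            using R [rule_format, of "u \<cdot> y"] u y by simp
          then have "initial C (Dom C y)"
            using v_iff [of "w \<cdot> u", THEN iffD1, rule_format, of y] u y w by simp
          then show False
            using degenerate [of "Dom C u"] u y by simp
        qed
      qed (use w v in simp_all)
    qed
  qed (use c v in simp)
qed

text \<open>\<^term>\<open>\<Omega>\<close> below is the object of those truth values that are determined by their points, that is,
  by the classical truth values.\<close>

lemma point_determined_truth_values:
  obtains \<Omega> o' where "\<Omega> \<in> Obj C" "o' \<in> Arr C" "Dom C o' = \<Omega>" "Cod C o' = Om"
    "\<And>m. monic C m \<Longrightarrow> \<exists>\<phi>. \<phi> \<in> Arr C \<and> Dom C \<phi> = Cod C m \<and> Cod C \<phi> = \<Omega> \<and>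
      (\<forall>y. y \<in> Arr C \<longrightarrow> Dom C y = one \<longrightarrow> Cod C y = Cod C m \<longrightarrow> (o' \<cdot> (\<phi> \<cdot> y) = truth \<longleftrightarrow> y \<sqsubseteq> m))"
    "\<And>a b. \<lbrakk>a \<in> Arr C; b \<in> Arr C; Dom C a = Dom C b; Cod C a = \<Omega>; Cod C b = \<Omega>;
      \<forall>y. y \<in> Arr C \<longrightarrow> Dom C y = one \<longrightarrow> Cod C y = Dom C a \<longrightarrow>
        (o' \<cdot> (a \<cdot> y) = truth \<longleftrightarrow> o' \<cdot> (b \<cdot> y) = truth)\<rbrakk> \<Longrightarrow> a = b"
proof -
  have mt: "monic C truth"
    by (rule monic_from_terminal [OF one_terminal]) simp_all
  obtain c where c: "monic C c" "Cod C c = Cod C truth"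
    and c_iff: "\<And>w. \<lbrakk>w \<in> Arr C; Cod C w = Cod C truth\<rbrakk> \<Longrightarrow> w \<sqsubseteq> c \<longleftrightarrow>
      (\<forall>x. x \<in> Arr C \<longrightarrow> Dom C x = one \<longrightarrow> Cod C x = Dom C w \<longrightarrow> w \<cdot> x \<sqsubseteq> truth)"
    by (rule closure [OF mt], rule that)
  have point_truth: "x \<sqsubseteq> truth \<longleftrightarrow> x = truth" if "x \<in> Arr C" "Dom C x = one" "Cod C x = Om" for x
    using through_terminal_eq [of x truth truth] through_refl [of truth] that one_terminal by auto
  \<comment> \<open>\<open>cl\<close> is double negation as an operator on truth values: the
    classifier of the closure of \<open>truth\<close>.\<close>
  define cl where "cl = chi c"
  have cl: "cl \<in> Arr C" "Dom C cl = Om" "Cod C cl = Om"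
    using c by (simp_all add: cl_def)
  have cl_iff: "cl \<cdot> \<phi> = tr (Dom C \<phi>) \<longleftrightarrow> (\<forall>x. x \<in> Arr C \<longrightarrow> Dom C x = one \<longrightarrow> Cod C x = Dom C \<phi> \<longrightarrow> \<phi> \<cdot> x = truth)"
    if \<phi>: "\<phi> \<in> Arr C" "Cod C \<phi> = Om" for \<phi>
  proof -
    have "cl \<cdot> \<phi> = tr (Dom C \<phi>) \<longleftrightarrow> \<phi> \<sqsubseteq> c"
      unfolding cl_def by (rule chi_iff) (use c \<phi> in simp_all)
    also have "\<dots> \<longleftrightarrow> (\<forall>x. x \<in> Arr C \<longrightarrow> Dom C x = one \<longrightarrow> Cod C x = Dom C \<phi> \<longrightarrow> \<phi> \<cdot> x \<sqsubseteq> truth)"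
      by (rule c_iff) (use \<phi> in simp_all)
    also have "\<dots> \<longleftrightarrow> (\<forall>x. x \<in> Arr C \<longrightarrow> Dom C x = one \<longrightarrow> Cod C x = Dom C \<phi> \<longrightarrow> \<phi> \<cdot> x = truth)"
      using point_truth \<phi> by simp
    finally show ?thesis .
  qed
  have cl_point: "cl \<cdot> y = truth \<longleftrightarrow> y = truth" if y: "y \<in> Arr C" "Dom C y = one" "Cod C y = Om" for y
  proof -
    have "(\<forall>x. x \<in> Arr C \<longrightarrow> Dom C x = one \<longrightarrow> Cod C x = one \<longrightarrow> y \<cdot> x = truth) \<longleftrightarrow> y = truth" (is "?all \<longleftrightarrow> _")
    proof
      assume ?all
      then have "y \<cdot> Ide C one = truth"
        by simp
      then show "y = truth"
        using y by simp
    next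
      assume "y = truth"
      then have "y \<cdot> x = truth" if "x \<in> Arr C" "Dom C x = one" "Cod C x = one" for x
        using one_Ide [OF that] y by simp
      then show ?all
        by blast
    qed
    then show ?thesis
      using cl_iff [of y] y by (simp add: tr_one)
  qed
  \<comment> \<open>The fixed points of \<open>cl\<close> form the classifier of closed
    subobjects.\<close>
  obtain o' where o': "monic C o'" "Cod C o' = Om"
    and o_iff: "\<And>w. \<lbrakk>w \<in> Arr C; Cod C w = Om\<rbrakk> \<Longrightarrow> w \<sqsubseteq> o' \<longleftrightarrow> cl \<cdot> w = Ide C Om \<cdot> w"
    by (rule equalizer [of cl "Ide C Om"]) (use cl that in simp_all)
  \<comment> \<open>After \<open>cl\<close> only the points at which an arrow is true are
    remembered.\<close>
  have ext: "cl \<cdot> \<phi> = cl \<cdot> \<psi>"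
    if h: "\<phi> \<in> Arr C" "Cod C \<phi> = Om" "\<psi> \<in> Arr C" "Cod C \<psi> = Om" "Dom C \<phi> = Dom C \<psi>"
      and eq: "\<And>x. \<lbrakk>x \<in> Arr C; Dom C x = one; Cod C x = Dom C \<phi>\<rbrakk> \<Longrightarrow> \<phi> \<cdot> x = truth \<longleftrightarrow> \<psi> \<cdot> x = truth" for \<phi> \<psi>
  proof (rule Om_ext)
    fix w
    assume "w \<in> Arr C" "Cod C w = Dom C (cl \<cdot> \<phi>)"
    then have w: "w \<in> Arr C" "Cod C w = Dom C \<phi>"
      using h cl by simp_all
    have "\<phi> \<cdot> (w \<cdot> x) = truth \<longleftrightarrow> \<psi> \<cdot> (w \<cdot> x) = truth" if "x \<in> Arr C" "Dom C x = one" "Cod C x = Dom C w" for x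
      by (rule eq) (use that w in simp_all)
    then show "(cl \<cdot> \<phi>) \<cdot> w = tr (Dom C w) \<longleftrightarrow> (cl \<cdot> \<psi>) \<cdot> w = tr (Dom C w)"
      using cl_iff [of "\<phi> \<cdot> w"] cl_iff [of "\<psi> \<cdot> w"] w h cl by simp
  qed (use h cl in simp_all)
  show ?thesis
  proof (rule that [OF _ _ refl o'(2)])
    fix m
    assume m: "monic C m"
    \<comment> \<open>\<open>\<phi>\<close> classifies the closure of \<open>m\<close>, which has
      the same points as \<open>m\<close> but is determined by them.\<close>
    define \<phi> where "\<phi> = cl \<cdot> chi m"
    have \<phi>: "\<phi> \<in> Arr C" "Dom C \<phi> = Cod C m" "Cod C \<phi> = Om"
      using m cl by (simp_all add: \<phi>_def)
    have pt: "\<phi> \<cdot> y = truth \<longleftrightarrow> chi m \<cdot> y = truth" if "y \<in> Arr C" "Dom C y = one" "Cod C y = Cod C m" for y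
      using cl_point [of "chi m \<cdot> y"] that m cl by (simp add: \<phi>_def)
    have "cl \<cdot> \<phi> = cl \<cdot> chi m"
      by (rule ext) (use pt \<phi> m in simp_all)
    then have "\<phi> \<sqsubseteq> o'"
      using o_iff [of \<phi>] \<phi> by (simp add: \<phi>_def)
    then obtain \<psi> where \<psi>: "\<psi> \<in> Arr C" "Dom C \<psi> = Cod C m" "Cod C \<psi> = Dom C o'" "o' \<cdot> \<psi> = \<phi>"
      by (rule throughE) (use \<phi> in simp)
    have "o' \<cdot> (\<psi> \<cdot> y) = truth \<longleftrightarrow> y \<sqsubseteq> m" if y: "y \<in> Arr C" "Dom C y = one" "Cod C y = Cod C m" for y
      using Comp_eq [OF \<psi>(4), of y] pt [OF y] chi_iff [OF m, of y] y \<psi>(1-3) o' by (simp add: tr_one)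
    then show "\<exists>\<psi>. \<psi> \<in> Arr C \<and> Dom C \<psi> = Cod C m \<and> Cod C \<psi> = Dom C o' \<and>
      (\<forall>y. y \<in> Arr C \<longrightarrow> Dom C y = one \<longrightarrow> Cod C y = Cod C m \<longrightarrow> (o' \<cdot> (\<psi> \<cdot> y) = truth \<longleftrightarrow> y \<sqsubseteq> m))"
      using \<psi>(1-3) by blast
  next
    fix a b
    assume ab: "a \<in> Arr C" "b \<in> Arr C" "Dom C a = Dom C b" "Cod C a = Dom C o'" "Cod C b = Dom C o'"
      and eq: "\<forall>y. y \<in> Arr C \<longrightarrow> Dom C y = one \<longrightarrow> Cod C y = Dom C a \<longrightarrow>
        (o' \<cdot> (a \<cdot> y) = truth \<longleftrightarrow> o' \<cdot> (b \<cdot> y) = truth)"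
    have "cl \<cdot> (o' \<cdot> a) = cl \<cdot> (o' \<cdot> b)"
      by (rule ext) (use ab o' eq in simp_all)
    moreover have "cl \<cdot> (o' \<cdot> a) = o' \<cdot> a" "cl \<cdot> (o' \<cdot> b) = o' \<cdot> b"
      using o_iff [of "o' \<cdot> a"] o_iff [of "o' \<cdot> b"] through_Comp [of o' a] through_Comp [of o' b] ab o' by simp_all
    ultimately have "o' \<cdot> a = o' \<cdot> b"
      by simp
    then show "a = b"
      by - (rule monicD [OF o'(1)], use ab in simp_all)
  qed (use o' in simp_all)
qed

text \<open>The exponential of \<open>\<Omega>\<close> by \<open>A\<close> inherits determination by
  points: an arrow from \<open>X\<close> into it is known from the relation it induces between
  points of \<open>X\<close> and points of \<open>A\<close>, and any subobject of the product
  prescribes such a relation.\<close>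

lemma point_determined_power_object:
  assumes A: "A \<in> Obj C"
  obtains Q ev where "Q \<in> Obj C" "ev \<in> Arr C" "Dom C ev = Pr Q A" "Cod C ev = Om"
    "\<And>X m. \<lbrakk>X \<in> Obj C; monic C m; Cod C m = Pr X A\<rbrakk> \<Longrightarrow> \<exists>h. h \<in> Arr C \<and> Dom C h = X \<and> Cod C h = Q \<and>
      (\<forall>x y. x \<in> Arr C \<longrightarrow> y \<in> Arr C \<longrightarrow> Dom C x = one \<longrightarrow> Dom C y = one \<longrightarrow> Cod C x = X \<longrightarrow> Cod C y = A \<longrightarrow>
        (ev \<cdot> pair (h \<cdot> x) y = truth \<longleftrightarrow> pair x y \<sqsubseteq> m))"
    "\<And>a b. \<lbrakk>a \<in> Arr C; b \<in> Arr C; Dom C a = Dom C b; Cod C a = Q; Cod C b = Q;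
      \<forall>x y. x \<in> Arr C \<longrightarrow> y \<in> Arr C \<longrightarrow> Dom C x = one \<longrightarrow> Dom C y = one \<longrightarrow> Cod C x = Dom C a \<longrightarrow> Cod C y = A \<longrightarrow>
        (ev \<cdot> pair (a \<cdot> x) y = truth \<longleftrightarrow> ev \<cdot> pair (b \<cdot> x) y = truth)\<rbrakk> \<Longrightarrow> a = b"
proof -
  obtain \<Omega> o' where \<Omega>: "\<Omega> \<in> Obj C" and o': "o' \<in> Arr C" "Dom C o' = \<Omega>" "Cod C o' = Om"
    and cls: "\<And>m. monic C m \<Longrightarrow> \<exists>\<phi>. \<phi> \<in> Arr C \<and> Dom C \<phi> = Cod C m \<and> Cod C \<phi> = \<Omega> \<and>
      (\<forall>y. y \<in> Arr C \<longrightarrow> Dom C y = one \<longrightarrow> Cod C y = Cod C m \<longrightarrow> (o' \<cdot> (\<phi> \<cdot> y) = truth \<longleftrightarrow> y \<sqsubseteq> m))"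
    and eqI: "\<And>a b. \<lbrakk>a \<in> Arr C; b \<in> Arr C; Dom C a = Dom C b; Cod C a = \<Omega>; Cod C b = \<Omega>;
      \<forall>y. y \<in> Arr C \<longrightarrow> Dom C y = one \<longrightarrow> Cod C y = Dom C a \<longrightarrow>
        (o' \<cdot> (a \<cdot> y) = truth \<longleftrightarrow> o' \<cdot> (b \<cdot> y) = truth)\<rbrakk> \<Longrightarrow> a = b"
    by (rule point_determined_truth_values, rule that)
  obtain Q ev where Q: "Q \<in> Obj C" and ev: "ev \<in> Arr C" "Dom C ev = Pr Q A" "Cod C ev = \<Omega>"
    and cur: "\<And>X f. \<lbrakk>X \<in> Obj C; f \<in> Arr C; Dom C f = Pr X A; Cod C f = \<Omega>\<rbrakk> \<Longrightarrow>
      \<exists>h. h \<in> Arr C \<and> Dom C h = X \<and> Cod C h = Q \<and>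
        (\<forall>x y. x \<in> Arr C \<longrightarrow> y \<in> Arr C \<longrightarrow> Dom C x = Dom C y \<longrightarrow> Cod C x = X \<longrightarrow> Cod C y = A \<longrightarrow>
          ev \<cdot> pair (h \<cdot> x) y = f \<cdot> pair x y)"
    and ext: "\<And>g h. \<lbrakk>g \<in> Arr C; h \<in> Arr C; Dom C g = Dom C h; Cod C g = Q; Cod C h = Q;
      \<And>x y. \<lbrakk>x \<in> Arr C; y \<in> Arr C; Dom C x = Dom C y; Cod C x = Dom C g; Cod C y = A\<rbrakk>
        \<Longrightarrow> ev \<cdot> pair (g \<cdot> x) y = ev \<cdot> pair (h \<cdot> x) y\<rbrakk> \<Longrightarrow> g = h"
    using exponential [OF A \<Omega>] by blast
  show ?thesis
  proof (rule that [of Q "o' \<cdot> ev"])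
    fix X m
    assume m: "X \<in> Obj C" "monic C m" "Cod C m = Pr X A"
    obtain \<phi> where \<phi>: "\<phi> \<in> Arr C" "Dom C \<phi> = Pr X A" "Cod C \<phi> = \<Omega>"
      and \<phi>_iff: "\<And>y. \<lbrakk>y \<in> Arr C; Dom C y = one; Cod C y = Pr X A\<rbrakk> \<Longrightarrow> o' \<cdot> (\<phi> \<cdot> y) = truth \<longleftrightarrow> y \<sqsubseteq> m"
      using cls [OF m(2)] m(3) by auto
    obtain h where h: "h \<in> Arr C" "Dom C h = X" "Cod C h = Q"
      and h_eq: "\<And>x y. \<lbrakk>x \<in> Arr C; y \<in> Arr C; Dom C x = Dom C y; Cod C x = X; Cod C y = A\<rbrakk> \<Longrightarrow>
        ev \<cdot> pair (h \<cdot> x) y = \<phi> \<cdot> pair x y"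
      using cur [OF m(1) \<phi>] by auto
    have "(o' \<cdot> ev) \<cdot> pair (h \<cdot> x) y = truth \<longleftrightarrow> pair x y \<sqsubseteq> m"
      if xy: "x \<in> Arr C" "y \<in> Arr C" "Dom C x = one" "Dom C y = one" "Cod C x = X" "Cod C y = A" for x y
      using h_eq [of x y] \<phi>_iff [of "pair x y"] xy h \<phi> ev o' by simp
    with h show "\<exists>h. h \<in> Arr C \<and> Dom C h = X \<and> Cod C h = Q \<and>
      (\<forall>x y. x \<in> Arr C \<longrightarrow> y \<in> Arr C \<longrightarrow> Dom C x = one \<longrightarrow> Dom C y = one \<longrightarrow> Cod C x = X \<longrightarrow> Cod C y = A \<longrightarrow>
        ((o' \<cdot> ev) \<cdot> pair (h \<cdot> x) y = truth \<longleftrightarrow> pair x y \<sqsubseteq> m))"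
      by blast
  next
    fix a b
    assume ab: "a \<in> Arr C" "b \<in> Arr C" "Dom C a = Dom C b" "Cod C a = Q" "Cod C b = Q"
      and eq: "\<forall>x y. x \<in> Arr C \<longrightarrow> y \<in> Arr C \<longrightarrow> Dom C x = one \<longrightarrow> Dom C y = one \<longrightarrow> Cod C x = Dom C a \<longrightarrow> Cod C y = A \<longrightarrow>
        ((o' \<cdot> ev) \<cdot> pair (a \<cdot> x) y = truth \<longleftrightarrow> (o' \<cdot> ev) \<cdot> pair (b \<cdot> x) y = truth)"
    show "a = b"
    proof (rule ext)
      fix x y
      assume xy: "x \<in> Arr C" "y \<in> Arr C" "Dom C x = Dom C y" "Cod C x = Dom C a" "Cod C y = A"
      show "ev \<cdot> pair (a \<cdot> x) y = ev \<cdot> pair (b \<cdot> x) y"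
      proof (rule eqI)
        show "\<forall>z. z \<in> Arr C \<longrightarrow> Dom C z = one \<longrightarrow> Cod C z = Dom C (ev \<cdot> pair (a \<cdot> x) y) \<longrightarrow>
          (o' \<cdot> ((ev \<cdot> pair (a \<cdot> x) y) \<cdot> z) = truth \<longleftrightarrow> o' \<cdot> ((ev \<cdot> pair (b \<cdot> x) y) \<cdot> z) = truth)"
        proof (intro allI impI)
          fix z
          assume "z \<in> Arr C" "Dom C z = one" "Cod C z = Dom C (ev \<cdot> pair (a \<cdot> x) y)"
          then have z: "z \<in> Arr C" "Dom C z = one" "Cod C z = Dom C y"
            using xy ab ev by simp_all
          show "o' \<cdot> ((ev \<cdot> pair (a \<cdot> x) y) \<cdot> z) = truth \<longleftrightarrow> o' \<cdot> ((ev \<cdot> pair (b \<cdot> x) y) \<cdot> z) = truth"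
            using eq [rule_format, of "x \<cdot> z" "y \<cdot> z"] z xy ab ev o' by simp
        qed
      qed (use xy ab ev in simp_all)
    qed (rule ab)+
  qed (use Q ev o' in simp_all)
qed

end

context mclarty_topos
begin

text \<open>The codiscrete object on \<^term>\<open>A\<close> is the closure of the object of singletons in the
  point-determined power object of \<^term>\<open>A\<close>.\<close>

lemma codiscrete:
  assumes A: "decidable C A"
  obtains K \<epsilon> where "K \<in> Obj C" "\<epsilon> \<in> Arr C" "Dom C \<epsilon> = Dom C (pts K)" "Cod C \<epsilon> = A"
    "\<And>X g. \<lbrakk>X \<in> Obj C; g \<in> Arr C; Dom C g = Dom C (pts X); Cod C g = A\<rbrakk> \<Longrightarrow>
      \<exists>!h. h \<in> Hom C X K \<and> (\<exists>t. t \<in> Hom C (Dom C (pts X)) (Dom C (pts K)) \<and>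
        pts K \<cdot> t = h \<cdot> pts X \<and> \<epsilon> \<cdot> t = g)"
proof -
  have A' [simp]: "A \<in> Obj C"
    by (rule decidable_obj [OF A])
  obtain Q ev where Q: "Q \<in> Obj C" and ev: "ev \<in> Arr C" "Dom C ev = Pr Q A" "Cod C ev = Om"
    and cls: "\<And>X m. \<lbrakk>X \<in> Obj C; monic C m; Cod C m = Pr X A\<rbrakk> \<Longrightarrow> \<exists>h. h \<in> Arr C \<and> Dom C h = X \<and> Cod C h = Q \<and>
      (\<forall>x y. x \<in> Arr C \<longrightarrow> y \<in> Arr C \<longrightarrow> Dom C x = one \<longrightarrow> Dom C y = one \<longrightarrow> Cod C x = X \<longrightarrow> Cod C y = A \<longrightarrow>
        (ev \<cdot> pair (h \<cdot> x) y = truth \<longleftrightarrow> pair x y \<sqsubseteq> m))"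
    and eqI: "\<And>a b. \<lbrakk>a \<in> Arr C; b \<in> Arr C; Dom C a = Dom C b; Cod C a = Q; Cod C b = Q;
      \<forall>x y. x \<in> Arr C \<longrightarrow> y \<in> Arr C \<longrightarrow> Dom C x = one \<longrightarrow> Dom C y = one \<longrightarrow> Cod C x = Dom C a \<longrightarrow> Cod C y = A \<longrightarrow>
        (ev \<cdot> pair (a \<cdot> x) y = truth \<longleftrightarrow> ev \<cdot> pair (b \<cdot> x) y = truth)\<rbrakk> \<Longrightarrow> a = b"
    by (rule point_determined_power_object [OF A'], rule that)
  have eqI_points: "a = b"
    if ab: "a \<in> Arr C" "b \<in> Arr C" "Dom C a = Dom C b" "Cod C a = Q" "Cod C b = Q"
      and eq: "\<And>x. \<lbrakk>x \<in> Arr C; Dom C x = one; Cod C x = Dom C a\<rbrakk> \<Longrightarrow> a \<cdot> x = b \<cdot> x" for a b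
    by (rule eqI [OF ab]) (use eq in simp)
  have graph_iff: "pair (p \<cdot> x) y \<sqsubseteq> pair p g \<longleftrightarrow> y = g \<cdot> x"
    if p: "monic C p" and g: "g \<in> Arr C" "Dom C g = Dom C p"
      and xy: "x \<in> Arr C" "y \<in> Arr C" "Dom C x = Dom C y" "Cod C x = Dom C p" "Cod C y = Cod C g" for p g x y
  proof
    assume "pair (p \<cdot> x) y \<sqsubseteq> pair p g"
    then obtain t where t: "t \<in> Arr C" "Dom C t = Dom C y" "Cod C t = Dom C p" "pair p g \<cdot> t = pair (p \<cdot> x) y"
      by (rule throughE) (use p g xy in simp)
    then have "pair (p \<cdot> t) (g \<cdot> t) = pair (p \<cdot> x) y"
      using p g by simp
    then have "p \<cdot> t = p \<cdot> x" "g \<cdot> t = y"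
      using pair_eq_iff [of "p \<cdot> t" "g \<cdot> t" "p \<cdot> x" y] t p g xy by simp_all
    moreover have "t = x"
      by (rule monicD [OF p]) (use calculation t xy in simp_all)
    ultimately show "y = g \<cdot> x"
      by simp
  next
    assume "y = g \<cdot> x"
    then show "pair (p \<cdot> x) y \<sqsubseteq> pair p g"
      using through_Comp [of "pair p g" x] p g xy by simp
  qed
  have graph_monic: "monic C (pair p g)" if p: "monic C p" and g: "g \<in> Arr C" "Dom C g = Dom C p" for p g
  proof (rule monicI)
    fix a b
    assume ab: "a \<in> Arr C" "b \<in> Arr C" "Dom C a = Dom C b" "Cod C a = Dom C (pair p g)"
      "Cod C b = Dom C (pair p g)" "pair p g \<cdot> a = pair p g \<cdot> b"
    then have "p \<cdot> a = p \<cdot> b"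
      using pair_eq_iff [of "p \<cdot> a" "g \<cdot> a" "p \<cdot> b" "g \<cdot> b"] p g by simp
    then show "a = b"
      by - (rule monicD [OF p], use ab p g in simp_all)
  qed (use p g in simp)
  \<comment> \<open>\<open>s\<close> is the singleton map, named by the diagonal of
    \<open>A\<close>.\<close>
  obtain s where s: "s \<in> Arr C" "Dom C s = A" "Cod C s = Q"
    and s_eq: "\<And>x y. \<lbrakk>x \<in> Arr C; y \<in> Arr C; Dom C x = one; Dom C y = one; Cod C x = A; Cod C y = A\<rbrakk> \<Longrightarrow>
        ev \<cdot> pair (s \<cdot> x) y = truth \<longleftrightarrow> pair x y \<sqsubseteq> pair (Ide C A) (Ide C A)"
    using cls [of A "pair (Ide C A) (Ide C A)"] graph_monic [of "Ide C A" "Ide C A"] monic_Ide [OF A'] by auto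
  have s_iff: "ev \<cdot> pair (s \<cdot> x) y = truth \<longleftrightarrow> y = x"
    if "x \<in> Arr C" "y \<in> Arr C" "Dom C x = one" "Dom C y = one" "Cod C x = A" "Cod C y = A" for x y
    using s_eq [OF that] graph_iff [of "Ide C A" "Ide C A" x y] monic_Ide [OF A'] that by simp
  have ms: "monic C s"
  proof (rule monic_if_injective_on_points)
    fix x y
    assume xy: "x \<in> Arr C" "y \<in> Arr C" "Dom C x = one" "Dom C y = one" "Cod C x = Dom C s" "Cod C y = Dom C s"
      "s \<cdot> x = s \<cdot> y"
    then have "ev \<cdot> pair (s \<cdot> y) y = truth"
      using s_iff [of y y] s by simp
    then show "x = y"
      using s_iff [of x y] xy s by simp
  qed (use s A in simp_all)
  \<comment> \<open>Arrows into \<open>K\<close>, the domain of \<open>c\<close>, are those arrows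
    into \<open>Q\<close> whose value at each point is a singleton, that is, functions from the
    points of the source to those of \<open>A\<close>.\<close>
  obtain c where c: "monic C c" "Cod C c = Cod C s"
    and c_iff: "\<And>w. \<lbrakk>w \<in> Arr C; Cod C w = Cod C s\<rbrakk> \<Longrightarrow> w \<sqsubseteq> c \<longleftrightarrow>
      (\<forall>x. x \<in> Arr C \<longrightarrow> Dom C x = one \<longrightarrow> Cod C x = Dom C w \<longrightarrow> w \<cdot> x \<sqsubseteq> s)"
    by (rule closure [OF ms], rule that)
  define K where "K = Dom C c"
  define d where "d = pts K"
  have K: "Dom C c = K" "K \<in> Obj C"
    using c by (simp_all add: K_def)
  have d: "monic C d" "d \<in> Arr C" "Cod C d = K" "decidable C (Dom C d)"
    using K by (simp_all add: d_def)
  \<comment> \<open>Passing to the decidable object of points undoes the closure, and this yields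
    \<open>\<epsilon>\<close>.\<close>
  have "c \<cdot> d \<sqsubseteq> s"
  proof (rule through_if_points_through)
    fix x
    assume x: "x \<in> Arr C" "Dom C x = one" "Cod C x = Dom C (c \<cdot> d)"
    then show "(c \<cdot> d) \<cdot> x \<sqsubseteq> s"
      using c_iff [of c, THEN iffD1, rule_format, of "d \<cdot> x"] through_refl [of c] c K d by simp
  qed (use c K d s ms in simp_all)
  then obtain \<epsilon> where \<epsilon>: "\<epsilon> \<in> Arr C" "Dom C \<epsilon> = Dom C d" "Cod C \<epsilon> = A" "s \<cdot> \<epsilon> = c \<cdot> d"
    by (rule throughE) (use s c K d in simp)
  show ?thesis
  proof (rule that [of K \<epsilon>])
    show "Dom C \<epsilon> = Dom C (pts K)"
      using \<epsilon> by (simp add: d_def)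
    fix X g
    assume X: "X \<in> Obj C" and g: "g \<in> Arr C" "Dom C g = Dom C (pts X)" "Cod C g = A"
    define p where "p = pts X"
    have p: "monic C p" "p \<in> Arr C" "Cod C p = X" "decidable C (Dom C p)" "Dom C g = Dom C p"
      using X g by (simp_all add: p_def)
    have point_p: "\<exists>x'. x' \<in> Arr C \<and> Dom C x' = one \<and> Cod C x' = Dom C p \<and> x = p \<cdot> x'"
      if x: "x \<in> Arr C" "Dom C x = one" "Cod C x = X" for x
      using point_factor_pts [OF x] unfolding p_def by blast
    \<comment> \<open>\<open>u\<close> names the graph of \<open>g\<close>, seen as a relation
      between \<open>X\<close> and \<open>A\<close>; every point of \<open>X\<close> comes from
      \<open>p\<close>, so the value at it is a singleton.\<close>
    obtain u where u: "u \<in> Arr C" "Dom C u = X" "Cod C u = Q"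
      and u_eq: "\<And>x y. \<lbrakk>x \<in> Arr C; y \<in> Arr C; Dom C x = one; Dom C y = one; Cod C x = X; Cod C y = A\<rbrakk> \<Longrightarrow>
        ev \<cdot> pair (u \<cdot> x) y = truth \<longleftrightarrow> pair x y \<sqsubseteq> pair p g"
      using cls [of X "pair p g"] graph_monic [of p g] X p g by auto
    have up: "u \<cdot> p = s \<cdot> g"
    proof (rule eqI)
      show "\<forall>x y. x \<in> Arr C \<longrightarrow> y \<in> Arr C \<longrightarrow> Dom C x = one \<longrightarrow> Dom C y = one \<longrightarrow> Cod C x = Dom C (u \<cdot> p) \<longrightarrow>
        Cod C y = A \<longrightarrow> (ev \<cdot> pair ((u \<cdot> p) \<cdot> x) y = truth \<longleftrightarrow> ev \<cdot> pair ((s \<cdot> g) \<cdot> x) y = truth)"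
      proof (intro allI impI)
        fix x y
        assume xy: "x \<in> Arr C" "y \<in> Arr C" "Dom C x = one" "Dom C y = one" "Cod C x = Dom C (u \<cdot> p)" "Cod C y = A"
        then show "ev \<cdot> pair ((u \<cdot> p) \<cdot> x) y = truth \<longleftrightarrow> ev \<cdot> pair ((s \<cdot> g) \<cdot> x) y = truth"
          using u_eq [of "p \<cdot> x" y] graph_iff [of p g x y] s_iff [of "g \<cdot> x" y] p g s u by simp
      qed
    qed (use u p g s in simp_all)
    have "u \<sqsubseteq> c"
    proof (rule c_iff [THEN iffD2], goal_cases)
      case 3
      show ?case
      proof (intro allI impI)
        fix x
        assume x: "x \<in> Arr C" "Dom C x = one" "Cod C x = Dom C u"
        then obtain x' where x': "x' \<in> Arr C" "Dom C x' = one" "Cod C x' = Dom C p" "x = p \<cdot> x'"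
          using point_p [of x] u by auto
        then have "u \<cdot> x = s \<cdot> (g \<cdot> x')"
          using Comp_eq [OF up, of x'] u p s g by simp
        then show "u \<cdot> x \<sqsubseteq> s"
          using through_Comp [of s "g \<cdot> x'"] s g x' p by simp
      qed
    qed (use u s in simp_all)
    then obtain h where h: "h \<in> Arr C" "Dom C h = X" "Cod C h = K" "c \<cdot> h = u"
      by (rule throughE) (use u K in simp)
    have chp: "c \<cdot> (h \<cdot> p) = s \<cdot> g"
      using Comp_eq [OF h(4), of p] h(1-3) p c K up by simp
    have "h \<cdot> p \<sqsubseteq> d"
      using pts_coreflection [OF K(2)] h p unfolding coreflection_def d_def by simp
    then obtain t where t: "t \<in> Arr C" "Dom C t = Dom C p" "Cod C t = Dom C d" "d \<cdot> t = h \<cdot> p"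
      by (rule throughE) (use h p in simp)
    have "s \<cdot> (\<epsilon> \<cdot> t) = s \<cdot> g"
      using Comp_eq [OF \<epsilon>(4), of t] \<epsilon>(1-3) t s c K d chp by simp
    then have \<epsilon>t: "\<epsilon> \<cdot> t = g"
      by - (rule monicD [OF ms], use \<epsilon> t s g p in simp_all)
    show "\<exists>!h. h \<in> Hom C X K \<and> (\<exists>t. t \<in> Hom C (Dom C (pts X)) (Dom C (pts K)) \<and>
        pts K \<cdot> t = h \<cdot> pts X \<and> \<epsilon> \<cdot> t = g)"
    proof (rule ex1I [of _ h])
      show "h \<in> Hom C X K \<and> (\<exists>t. t \<in> Hom C (Dom C (pts X)) (Dom C (pts K)) \<and>
        pts K \<cdot> t = h \<cdot> pts X \<and> \<epsilon> \<cdot> t = g)"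
        using h t \<epsilon>t by (intro conjI exI [of _ t]) (simp_all add: p_def d_def)
      fix h'
      assume "h' \<in> Hom C X K \<and> (\<exists>t. t \<in> Hom C (Dom C (pts X)) (Dom C (pts K)) \<and>
        pts K \<cdot> t = h' \<cdot> pts X \<and> \<epsilon> \<cdot> t = g)"
      then obtain t' where h': "h' \<in> Arr C" "Dom C h' = X" "Cod C h' = K"
        and t': "t' \<in> Arr C" "Dom C t' = Dom C p" "Cod C t' = Dom C d" "d \<cdot> t' = h' \<cdot> p" "\<epsilon> \<cdot> t' = g"
        by (auto simp: p_def d_def)
      have "c \<cdot> (h' \<cdot> p) = s \<cdot> (\<epsilon> \<cdot> t')"
        unfolding t'(4) [symmetric] using Comp_eq [OF \<epsilon>(4), of t'] \<epsilon>(1-3) t'(1-3) s c K d by simp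
      then have chp': "(c \<cdot> h') \<cdot> p = (c \<cdot> h) \<cdot> p"
        using chp t'(5) h(1-3) h' p c K by simp
      \<comment> \<open>All points of \<open>X\<close> come from \<open>p\<close>, and arrows into
        \<open>Q\<close> are determined by their points.\<close>
      have "c \<cdot> h' = c \<cdot> h"
      proof (rule eqI_points)
        fix x
        assume x: "x \<in> Arr C" "Dom C x = one" "Cod C x = Dom C (c \<cdot> h')"
        then obtain x' where x': "x' \<in> Arr C" "Cod C x' = Dom C p" "x = p \<cdot> x'"
          using point_p [of x] h' c K by auto
        have "((c \<cdot> h') \<cdot> p) \<cdot> x' = ((c \<cdot> h) \<cdot> p) \<cdot> x'"
          by (simp only: chp')
        then show "(c \<cdot> h') \<cdot> x = (c \<cdot> h) \<cdot> x"
          using x' h(1-3) h' c K p by simp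
      qed (use h(1-3) h' c K s in simp_all)
      then show "h' = h"
        by - (rule monicD [OF c(1)], use h(1-3) h' c K in simp_all)
    qed
  qed (use K \<epsilon> in simp_all)
qed

section \<open>Preservation of products, and conclusion\<close>

text \<open>The map \<open>e\<close> from \<open>P\<close> to the product of the two quotients is
  surjective on points and identifies no more points than \<open>quo P\<close> does. So
  \<open>quo P\<close> factors through \<open>e\<close>, and the factor \<open>h\<close> is inverse
  to the comparison arrow with components \<open>p'\<close> and \<open>q'\<close>.\<close>

lemma quo_product:
  assumes P: "is_product C X Y P p q"
    and p': "p' \<in> Arr C" "Dom C p' = Cod C (quo P)" "Cod C p' = Cod C (quo X)" "p' \<cdot> quo P = quo X \<cdot> p"
    and q': "q' \<in> Arr C" "Dom C q' = Cod C (quo P)" "Cod C q' = Cod C (quo Y)" "q' \<cdot> quo P = quo Y \<cdot> q"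
  shows "is_product (Dec C) (Cod C (quo X)) (Cod C (quo Y)) (Cod C (quo P)) p' q'"
proof -
  note pq = is_productD [OF P]
  have obj [simp]: "X \<in> Obj C" "Y \<in> Obj C" "P \<in> Obj C"
    using pq Dom_Cod_obj [of p] Dom_Cod_obj [of q] by simp_all
  define X' where "X' = Cod C (quo X)"
  define Y' where "Y' = Cod C (quo Y)"
  define P' where "P' = Cod C (quo P)"
  have qX: "quo X \<in> Arr C" "Dom C (quo X) = X" "Cod C (quo X) = X'" "decidable C X'" "X' \<in> Obj C"
    and qY: "quo Y \<in> Arr C" "Dom C (quo Y) = Y" "Cod C (quo Y) = Y'" "decidable C Y'" "Y' \<in> Obj C"
    and qP: "quo P \<in> Arr C" "Dom C (quo P) = P" "Cod C (quo P) = P'" "decidable C P'" "P' \<in> Obj C"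
    by (simp_all add: X'_def Y'_def P'_def)
  note p' = p' [unfolded qP(3) qX(3)] and q' = q' [unfolded qP(3) qY(3)]
  define e where "e = pair (quo X \<cdot> p) (quo Y \<cdot> q)"
  have e: "e \<in> Arr C" "Dom C e = P" "Cod C e = Pr X' Y'"
    using pq qX qY by (simp_all add: e_def)
  have e_comp: "e \<cdot> x = pair (quo X \<cdot> (p \<cdot> x)) (quo Y \<cdot> (q \<cdot> x))" if "x \<in> Arr C" "Cod C x = P" for x
    using that pq qX qY by (simp add: e_def)
  have dec: "decidable C (Pr X' Y')"
    by (rule decidable_Pr [OF qX(4) qY(4)])
  have surj: "\<exists>x. x \<in> Arr C \<and> Dom C x = one \<and> Cod C x = Dom C e \<and> e \<cdot> x = d"
    if "d \<in> Arr C" "Dom C d = one" "Cod C d = Cod C e" for d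
  proof -
    have d: "d \<in> Arr C" "Dom C d = one" "Cod C d = Pr X' Y'"
      using that e by simp_all
    obtain a where a: "a \<in> Arr C" "Dom C a = one" "Cod C a = X" "quo X \<cdot> a = p1 X' Y' \<cdot> d"
      by (rule quo_point_lift [of X "p1 X' Y' \<cdot> d"]) (use d qX qY that in simp_all)
    obtain b where b: "b \<in> Arr C" "Dom C b = one" "Cod C b = Y" "quo Y \<cdot> b = p2 X' Y' \<cdot> d"
      by (rule quo_point_lift [of Y "p2 X' Y' \<cdot> d"]) (use d qX qY that in simp_all)
    obtain x where x: "x \<in> Arr C" "Dom C x = Dom C a" "Cod C x = P" "p \<cdot> x = a" "q \<cdot> x = b"
      by (rule is_product_pair [OF P, of a b]) (use a b that in simp_all)
    have "e \<cdot> x = d"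
      using e_comp [of x] x a b pair_eta [of d X' Y'] d qX qY by simp
    then show ?thesis
      using x a e by auto
  qed
  have resp: "quo P \<cdot> x = quo P \<cdot> y"
    if xy: "x \<in> Arr C" "y \<in> Arr C" "Dom C x = one" "Dom C y = one" "Cod C x = P" "Cod C y = P" "e \<cdot> x = e \<cdot> y" for x y
  proof -
    have eqs: "quo X \<cdot> (p \<cdot> x) = quo X \<cdot> (p \<cdot> y)" "quo Y \<cdot> (q \<cdot> x) = quo Y \<cdot> (q \<cdot> y)"
      using xy e_comp pair_eq_iff [of "quo X \<cdot> (p \<cdot> x)" "quo Y \<cdot> (q \<cdot> x)" "quo X \<cdot> (p \<cdot> y)" "quo Y \<cdot> (q \<cdot> y)"]
        pq qX qY by simp_all
    txt \<open>Pass from \<^term>\<open>x\<close> to \<^term>\<open>y\<close> by moving one coordinate at a time: \<^term>\<open>l\<close> inserts the second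
      coordinate of \<^term>\<open>x\<close>, \<^term>\<open>r\<close> the first coordinate of \<^term>\<open>y\<close>.\<close>
    have bang_pt: "bang Z \<cdot> w = Ide C one" if "w \<in> Arr C" "Dom C w = one" "Cod C w = Z" for Z w
      by (rule one_Ide) (use that Dom_Cod_obj(2) [of w] in auto)
    obtain l where l: "l \<in> Arr C" "Dom C l = X" "Cod C l = P" "p \<cdot> l = Ide C X" "q \<cdot> l = (q \<cdot> x) \<cdot> bang X"
      by (rule is_product_pair [OF P, of "Ide C X" "(q \<cdot> x) \<cdot> bang X"]) (use xy pq that in simp_all)
    obtain r where r: "r \<in> Arr C" "Dom C r = Y" "Cod C r = P" "p \<cdot> r = (p \<cdot> y) \<cdot> bang Y" "q \<cdot> r = Ide C Y"
      by (rule is_product_pair [OF P, of "(p \<cdot> y) \<cdot> bang Y" "Ide C Y"]) (use xy pq that in simp_all)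
    have l_at: "p \<cdot> (l \<cdot> w) = w" "q \<cdot> (l \<cdot> w) = q \<cdot> x" if "w \<in> Arr C" "Dom C w = one" "Cod C w = X" for w
      using Comp_eq [OF l(4), of w] Comp_eq [OF l(5), of w] bang_pt [OF that] that l(1-3) pq xy by simp_all
    have r_at: "p \<cdot> (r \<cdot> w) = p \<cdot> y" "q \<cdot> (r \<cdot> w) = w" if "w \<in> Arr C" "Dom C w = one" "Cod C w = Y" for w
      using Comp_eq [OF r(4), of w] Comp_eq [OF r(5), of w] bang_pt [OF that] that r(1-3) pq xy by simp_all
    have lx: "l \<cdot> (p \<cdot> x) = x"
      by (rule is_product_eq [OF P]) (use l_at [of "p \<cdot> x"] xy l(1-3) pq in simp_all)
    have ry: "r \<cdot> (q \<cdot> y) = y"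
      by (rule is_product_eq [OF P]) (use r_at [of "q \<cdot> y"] xy r(1-3) pq in simp_all)
    have lr: "l \<cdot> (p \<cdot> y) = r \<cdot> (q \<cdot> x)"
      by (rule is_product_eq [OF P])
        (use l_at [of "p \<cdot> y"] r_at [of "q \<cdot> x"] xy l(1-3) r(1-3) pq in simp_all)
    \<comment> \<open>\<open>quo P \<cdot> l\<close> ends in a decidable object, so it depends on a
      point of \<open>X\<close> only through its image under \<open>quo X\<close>. The same holds
      for \<open>r\<close> and \<open>Y\<close>.\<close>
    obtain k where k: "k \<in> Arr C" "Dom C k = X'" "k \<cdot> quo X = quo P \<cdot> l" "Cod C k = P'"
      using reflection_factor [OF quo_reflection [OF obj(1)], of "quo P \<cdot> l"] l(1-3) qP qX by auto
    obtain k' where k': "k' \<in> Arr C" "Dom C k' = Y'" "k' \<cdot> quo Y = quo P \<cdot> r" "Cod C k' = P'"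
      using reflection_factor [OF quo_reflection [OF obj(2)], of "quo P \<cdot> r"] r(1-3) qP qY by auto
    have kq: "quo P \<cdot> (l \<cdot> w) = k \<cdot> (quo X \<cdot> w)" if "w \<in> Arr C" "Cod C w = X" for w
      using Comp_eq [OF k(3), of w] that k qX qP l(1-3) by simp
    have kq': "quo P \<cdot> (r \<cdot> w) = k' \<cdot> (quo Y \<cdot> w)" if "w \<in> Arr C" "Cod C w = Y" for w
      using Comp_eq [OF k'(3), of w] that k' qY qP r(1-3) by simp
    have "quo P \<cdot> (l \<cdot> (p \<cdot> x)) = quo P \<cdot> (l \<cdot> (p \<cdot> y))"
      using kq [of "p \<cdot> x"] kq [of "p \<cdot> y"] xy pq eqs(1) by simp
    also have "\<dots> = quo P \<cdot> (r \<cdot> (q \<cdot> x))"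
      by (simp only: lr)
    also have "\<dots> = quo P \<cdot> (r \<cdot> (q \<cdot> y))"
      using kq' [of "q \<cdot> x"] kq' [of "q \<cdot> y"] xy pq eqs(2) by simp
    finally show ?thesis
      by (simp only: lx ry)
  qed
  obtain h where h: "h \<in> Arr C" "Dom C h = Pr X' Y'" "Cod C h = P'" "h \<cdot> e = quo P"
  proof (rule factor_points [of e "quo P"], goal_cases)
    case (6 d)
    show ?case
      by (rule surj) (rule 6)+
  next
    case (7 x y)
    show ?case
      by (rule resp) (use 7 e in simp_all)
  next
    case (8 h)
    show ?case
      by (rule 8(1)) (use 8 e qP in simp_all)
  qed (use e qP dec in simp_all)
  have eqs: "p' \<cdot> h = p1 X' Y'" "q' \<cdot> h = p2 X' Y'"
  proof -
    have at: "p' \<cdot> (h \<cdot> d) = p1 X' Y' \<cdot> d \<and> q' \<cdot> (h \<cdot> d) = p2 X' Y' \<cdot> d"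
      if d: "d \<in> Arr C" "Dom C d = one" "Cod C d = Pr X' Y'" for d
    proof -
      obtain x where x: "x \<in> Arr C" "Dom C x = one" "Cod C x = P" "e \<cdot> x = d"
        using surj [of d] d e by auto
      have "h \<cdot> d = quo P \<cdot> x"
        unfolding x(4) [symmetric] using Comp_eq [OF h(4), of x] x(1-3) h(1-3) e by simp
      moreover have "p' \<cdot> (quo P \<cdot> x) = quo X \<cdot> (p \<cdot> x)" "q' \<cdot> (quo P \<cdot> x) = quo Y \<cdot> (q \<cdot> x)"
        using Comp_eq [OF p'(4), of x] Comp_eq [OF q'(4), of x] p'(1-3) q'(1-3) x(1-3) qP qX qY pq by simp_all
      ultimately show ?thesis
        unfolding x(4) [symmetric] using e_comp [of x] x(1-3) qX qY pq by simp
    qed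
    show "p' \<cdot> h = p1 X' Y'"
      by (rule decidable_eqI [OF qX(4)]) (use at h(1-3) p'(1-3) qX qY in simp_all)
    show "q' \<cdot> h = p2 X' Y'"
      by (rule decidable_eqI [OF qY(4)]) (use at h(1-3) q'(1-3) qX qY in simp_all)
  qed
  \<comment> \<open>The second half of invertibility, on points; \<open>decidable_eqI\<close> then
    turns it into uniqueness of the pairing.\<close>
  have he: "h \<cdot> pair (p' \<cdot> z) (q' \<cdot> z) = z" if z: "z \<in> Arr C" "Dom C z = one" "Cod C z = P'" for z
  proof -
    obtain x where x: "x \<in> Arr C" "Dom C x = one" "Cod C x = P" "quo P \<cdot> x = z"
      by (rule quo_point_lift [of P z]) (use z qP that in simp_all)
    have "p' \<cdot> z = quo X \<cdot> (p \<cdot> x)" "q' \<cdot> z = quo Y \<cdot> (q \<cdot> x)"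
      unfolding x(4) [symmetric]
      using Comp_eq [OF p'(4), of x] Comp_eq [OF q'(4), of x] p'(1-3) q'(1-3) x(1-3) qP qX qY pq by simp_all
    then have "h \<cdot> pair (p' \<cdot> z) (q' \<cdot> z) = h \<cdot> (e \<cdot> x)"
      using e_comp [of x] x(1-3) by simp
    also have "\<dots> = quo P \<cdot> x"
      using Comp_eq [OF h(4), of x] x(1-3) h(1-3) e by simp
    finally show ?thesis
      using x(4) by simp
  qed
  interpret D: category "Dec C"
    by (rule Dec_category)
  have "is_product (Dec C) X' Y' P' p' q'"
  proof (rule D.is_productI, goal_cases)
    case (7 f g)
    then have fg: "f \<in> Arr C" "g \<in> Arr C" "Dom C f = Dom C g" "Cod C f = X'" "Cod C g = Y'" "decidable C (Dom C g)"
      by simp_all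
    have "p' \<cdot> (h \<cdot> pair f g) = f" "q' \<cdot> (h \<cdot> pair f g) = g"
      using Comp_eq [OF eqs(1), of "pair f g"] Comp_eq [OF eqs(2), of "pair f g"] fg p'(1-3) q'(1-3) h(1-3) by simp_all
    then show ?case
      using fg h qP by (intro exI [of _ "h \<cdot> pair f g"]) simp
  next
    case (8 f g)
    then have fg: "f \<in> Arr C" "g \<in> Arr C" "Dom C f = Dom C g" "Cod C f = P'" "Cod C g = P'"
      and eq: "p' \<cdot> f = p' \<cdot> g" "q' \<cdot> f = q' \<cdot> g"
      by simp_all
    show ?case
    proof (rule decidable_eqI [OF qP(4) fg])
      fix x
      assume x: "x \<in> Arr C" "Dom C x = one" "Cod C x = Dom C f"
      have eqs: "p' \<cdot> (f \<cdot> x) = p' \<cdot> (g \<cdot> x)" "q' \<cdot> (f \<cdot> x) = q' \<cdot> (g \<cdot> x)"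
        using Comp_eq [OF eq(1), of x] Comp_eq [OF eq(2), of x] x fg p'(1-3) q'(1-3) by simp_all
      have "f \<cdot> x = h \<cdot> pair (p' \<cdot> (f \<cdot> x)) (q' \<cdot> (f \<cdot> x))"
        by (rule he [symmetric]) (use x fg in simp_all)
      also have "\<dots> = g \<cdot> x"
        unfolding eqs by (rule he) (use x fg in simp_all)
      finally show "f \<cdot> x = g \<cdot> x" .
    qed
  qed (use p' q' qX qY qP in simp_all)
  then show ?thesis
    by (simp add: X'_def Y'_def P'_def)
qed

text \<open>Points lift along \<open>quo T\<close>, and \<open>T\<close> has only one point, so all
  arrows from a decidable object to the quotient agree on points.\<close>

lemma quo_terminal:
  assumes T: "terminal C T"
  shows "terminal (Dec C) (Cod C (quo T))"
  unfolding terminal_def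
proof (intro conjI ballI)
  have T' [simp]: "T \<in> Obj C"
    by (rule terminal_obj [OF T])
  show "Cod C (quo T) \<in> Obj (Dec C)"
    by simp
  fix X
  assume "X \<in> Obj (Dec C)"
  then have X: "decidable C X" "X \<in> Obj C"
    using decidable_obj by simp_all
  obtain u where u: "u \<in> Arr C" "Dom C u = X" "Cod C u = T"
    using terminal_arrow [OF T X(2)] by blast
  show "\<exists>!f. f \<in> Hom (Dec C) X (Cod C (quo T))"
  proof (rule ex1I)
    show "quo T \<cdot> u \<in> Hom (Dec C) X (Cod C (quo T))"
      using u X by simp
    fix f
    assume "f \<in> Hom (Dec C) X (Cod C (quo T))"
    then have f: "f \<in> Arr C" "Dom C f = X" "Cod C f = Cod C (quo T)"
      by simp_all
    show "f = quo T \<cdot> u"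
    proof (rule decidable_eqI [of "Cod C (quo T)"])
      fix x
      assume x: "x \<in> Arr C" "Dom C x = one" "Cod C x = Dom C f"
      obtain y where y: "y \<in> Arr C" "Dom C y = one" "Cod C y = T" "quo T \<cdot> y = f \<cdot> x"
        by (rule quo_point_lift [of T "f \<cdot> x"]) (use f x that in simp_all)
      have "y = u \<cdot> x"
        by (rule terminal_eq [OF T]) (use y u x f in simp_all)
      then show "f \<cdot> x = (quo T \<cdot> u) \<cdot> x"
        using y u x f by simp
    qed (use f u in simp_all)
  qed
qed

lemma precohesive: "precohesive_over_Dec C"
proof -
  have incl [simp]: "on_obj inclusion Y = Y" "on_arr inclusion h = h" for Y :: 'a and h :: 'b
    by (simp_all add: inclusion_def)
  obtain fl \<epsilon> where A1: "adjunction C (Dec C) fl inclusion quo \<epsilon>"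
    and fl: "\<And>X. on_obj fl X = Cod C (quo X)"
  proof (rule left_adjoint_from_universal_arrows [OF inclusion_functor, of "\<lambda>X. Cod C (quo X)" quo], goal_cases)
    case (3 X A f)
    then have f: "f \<in> Arr C" "Dom C f = X" "Cod C f = A" "decidable C A" "X \<in> Obj C"
      by simp_all
    then show ?case
      using quo_reflection [OF f(5), unfolded reflection_def, THEN conjunct2, THEN conjunct2, THEN conjunct2,
          rule_format, of f] by simp
  next
    case (4 F \<epsilon>)
    then show ?case
      by blast
  qed simp_all
  obtain fp \<eta>' where A2: "adjunction (Dec C) C inclusion fp \<eta>' pts"
    and fp: "\<And>X. on_obj fp X = Dom C (pts X)"
  proof (rule right_adjoint_from_universal_arrows [OF inclusion_functor, of "\<lambda>X. Dom C (pts X)" pts], goal_cases)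
    case (3 X A g)
    then have g: "X \<in> Obj C" "g \<in> Arr C" "Dom C g = A" "Cod C g = X" "decidable C A"
      by simp_all
    have "g \<sqsubseteq> pts X"
      using pts_coreflection [of X] g unfolding coreflection_def by simp
    then obtain h where h: "h \<in> Arr C" "Dom C h = A" "Cod C h = Dom C (pts X)" "pts X \<cdot> h = g"
      by (rule throughE) (use g in simp)
    show ?case
    proof (rule ex1I [of _ h])
      show "h \<in> Hom (Dec C) A (Dom C (pts X)) \<and> pts X \<cdot> on_arr inclusion h = g"
        using h g by simp
      show "h' = h" if "h' \<in> Hom (Dec C) A (Dom C (pts X)) \<and> pts X \<cdot> on_arr inclusion h' = g" for h'
        by (rule monicD [of "pts X"]) (use that h g in simp_all)
    qed
  next
    case (4 G \<eta>)
    then show ?case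
      by blast
  qed simp_all
  interpret A1: adjunction C "Dec C" fl inclusion quo \<epsilon>
    by (rule A1)
  interpret A2: adjunction "Dec C" C inclusion fp \<eta>' pts
    by (rule A2)
  note A1.unit_arr [simp del] A2.counit_arr [simp del]
  have fp_arr: "on_arr fp h \<in> Arr C" "Dom C (on_arr fp h) = Dom C (pts (Dom C h))"
    "Cod C (on_arr fp h) = Dom C (pts (Cod C h))" "pts (Cod C h) \<cdot> on_arr fp h = h \<cdot> pts (Dom C h)"
    if h: "h \<in> Arr C" for h
    using A2.right.on_arr_arr [OF h] A2.counit_natural [of h "Dom C h" "Cod C h"] h by (simp_all add: fp)
  \<comment> \<open>The pair \<open>k\<close> consists of a codiscrete object on \<open>A\<close>
    and its counit, to be chosen together for all \<open>A\<close>.\<close>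
  define codisc where "codisc A k \<longleftrightarrow> fst k \<in> Obj C \<and> snd k \<in> Arr C \<and>
      Dom C (snd k) = Dom C (pts (fst k)) \<and> Cod C (snd k) = A \<and>
      (\<forall>X g. X \<in> Obj C \<longrightarrow> g \<in> Arr C \<longrightarrow> Dom C g = Dom C (pts X) \<longrightarrow> Cod C g = A \<longrightarrow>
        (\<exists>!h. h \<in> Hom C X (fst k) \<and> (\<exists>t. t \<in> Hom C (Dom C (pts X)) (Dom C (pts (fst k))) \<and>
          pts (fst k) \<cdot> t = h \<cdot> pts X \<and> snd k \<cdot> t = g)))" for A k
  have "\<exists>k. codisc A k" if A: "decidable C A" for A
    unfolding codisc_def
    by (rule codiscrete [OF A], rule exI [of _ "(_, _)"]) (simp only: fst_conv snd_conv, blast)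
  then obtain k where codisc: "\<And>A. decidable C A \<Longrightarrow> codisc A (k A)"
    by metis
  have k: "fst (k A) \<in> Obj C \<and> snd (k A) \<in> Arr C \<and>
      Dom C (snd (k A)) = Dom C (pts (fst (k A))) \<and> Cod C (snd (k A)) = A" if "decidable C A" for A
    using codisc [OF that] unfolding codisc_def by (elim conjE) (intro conjI)
  have k_ex1: "\<exists>!h. h \<in> Hom C X (fst (k A)) \<and> (\<exists>t. t \<in> Hom C (Dom C (pts X)) (Dom C (pts (fst (k A)))) \<and>
          pts (fst (k A)) \<cdot> t = h \<cdot> pts X \<and> snd (k A) \<cdot> t = g)"
    if "decidable C A" "X \<in> Obj C" "g \<in> Arr C" "Dom C g = Dom C (pts X)" "Cod C g = A" for A X g
    by (rule codisc [OF that(1), unfolded codisc_def, THEN conjunct2, THEN conjunct2, THEN conjunct2, THEN conjunct2,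
      rule_format, OF that(2-5)])
  obtain fu \<eta>'' where A3: "adjunction C (Dec C) fp fu \<eta>'' (\<lambda>A. snd (k A))"
  proof (rule right_adjoint_from_universal_arrows
      [OF A2.right.functor_between_axioms, of "\<lambda>A. fst (k A)" "\<lambda>A. snd (k A)"], goal_cases)
    case (1 A)
    then show ?case
      using k by simp
  next
    case (2 A)
    then show ?case
      using k [of A] by (simp add: fp)
  next
    case (3 A X g)
    then have g: "decidable C A" "X \<in> Obj C" "g \<in> Arr C" "Dom C g = Dom C (pts X)" "Cod C g = A"
      by (simp_all add: fp)
    \<comment> \<open>The arrow \<open>t\<close> of \<open>codiscrete\<close> is forced to be
      \<open>on_arr fp h\<close>, because \<open>pts\<close> is monic; this turns that lemma into
      the universal property over the functor \<open>fp\<close>.\<close>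
    have iff: "(\<exists>t. t \<in> Hom C (Dom C (pts X)) (Dom C (pts (fst (k A)))) \<and>
        pts (fst (k A)) \<cdot> t = h \<cdot> pts X \<and> snd (k A) \<cdot> t = g) \<longleftrightarrow> snd (k A) \<cdot> on_arr fp h = g"
      if h: "h \<in> Hom C X (fst (k A))" for h
    proof
      assume "\<exists>t. t \<in> Hom C (Dom C (pts X)) (Dom C (pts (fst (k A)))) \<and>
        pts (fst (k A)) \<cdot> t = h \<cdot> pts X \<and> snd (k A) \<cdot> t = g"
      then obtain t where t: "t \<in> Arr C" "Dom C t = Dom C (pts X)" "Cod C t = Dom C (pts (fst (k A)))"
        "pts (fst (k A)) \<cdot> t = h \<cdot> pts X" "snd (k A) \<cdot> t = g"
        by auto
      have "t = on_arr fp h"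
        by (rule monicD [of "pts (fst (k A))"]) (use t h fp_arr [of h] k [OF g(1)] in simp_all)
      with t show "snd (k A) \<cdot> on_arr fp h = g"
        by simp
    next
      assume "snd (k A) \<cdot> on_arr fp h = g"
      then show "\<exists>t. t \<in> Hom C (Dom C (pts X)) (Dom C (pts (fst (k A)))) \<and>
        pts (fst (k A)) \<cdot> t = h \<cdot> pts X \<and> snd (k A) \<cdot> t = g"
        using h fp_arr [of h] by (intro exI [of _ "on_arr fp h"]) simp
    qed
    show ?case
      using k_ex1 [OF g] iff by (simp cong: conj_cong)
  next
    case (4 G \<eta>)
    then show ?case
      by blast
  qed
  have "preserves_finite_products C (Dec C) fl"
    unfolding preserves_finite_products_def fl
  proof (intro conjI allI impI)
    show "terminal (Dec C) (Cod C (quo T))" if "terminal C T" for T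
      using quo_terminal [OF that] .
    fix X Y P p q
    assume P: "is_product C X Y P p q"
    note pq = is_productD [OF P]
    show "is_product (Dec C) (Cod C (quo X)) (Cod C (quo Y)) (Cod C (quo P)) (on_arr fl p) (on_arr fl q)"
      by (rule quo_product [OF P])
        (use A1.left.on_arr_arr [of p] A1.left.on_arr_arr [of q] A1.unit_natural [of p P X] A1.unit_natural [of q P Y]
          pq fl in simp_all)
  qed
  then show ?thesis
    unfolding precohesive_over_Dec_def precohesive_via_def
    using elementary_topos_axioms Dec_topos A1 A2 A3 inclusion_fully_faithful pts_arr(1) by blast
qed

end

theorem theoremC:
  fixes E :: "('o, 'a) precategory"
  assumes "elementary_topos E"
    and "NS E"
  shows "DQO E \<and> DSO E \<longleftrightarrow> precohesive_over_Dec E"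
proof
  interpret nullstellensatz_topos E
    using assms by (simp add: nullstellensatz_topos_def nullstellensatz_topos_axioms_def)
  show "DQO E \<and> DSO E" if "precohesive_over_Dec E"
    using DQO_DSO_if_precohesive [OF that] .
  show "precohesive_over_Dec E" if "DQO E \<and> DSO E"
  proof -
    interpret mclarty_topos E
      by unfold_locales (use that in simp_all)
    show ?thesis
      by (rule precohesive)
  qed
qed

end
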